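(* Let $N>2$. Let $\mathcal D$ be the following $N\times N$ matrix: for $N=2n$, $\mathcal D$ is the permutation matrix exchanging the indices $n$ and $n+1$ and fixing the others; for $N=2n+1$, $\mathcal D$ is diagonal with entry $-1$ in position $n+1$ and all other diagonal entries $1$. Then $T\mapsto T^\sharp:=\mathcal D T\mathcal D^{-1}$ defines an involutive Hopf algebra automorphism $\sharp$ of $SO_q(N)$. Moreover: 1. If $q\in\mathbb R$, then $\sharp$ commutes with $\star$, $\star^\sharp:=\sharp\circ\star$ is a $*$-conjugation on $SO_q(N)$, and its real form is $SO_q(N-1,1)$, i.e. its classical limit group is isomorphic to $SO(N-1,1)$. 2. If $|q|=1$, then $\sharp$ commutes with $\times$, $\times^\sharp:=\sharp\circ\times$ is a $*$-conjugation on $SO_q(N)$, and its real form is $SO_q(n+1,n-1)$ if $N=2n$, and $SO_q(n,n+1)$ if $N=2n+1$ (i.e. its classical limit group is isomorphic to $SO(n+1,n-1)$, respectively $SO(n,n+1)$). For $N=2n+1$ the conjugation $\times^\sharp$ is equivalent to $\times$.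
   Context: Let $N>2$; $N=2n$ or $N=2n+1$. Indices run over $1,\dots,N$; $a':=N+1-a$; for $N=2n+1$ set $n_2=(N+1)/2=n+1$. The vector $\rho$ is $(\rho_1,\dots,\rho_N)=(\tfrac N2-1,\tfrac N2-2,\dots,\tfrac12,0,-\tfrac12,\dots,-\tfrac N2+1)$ for $N$ odd and $(\tfrac N2-1,\tfrac N2-2,\dots,1,0,0,-1,\dots,-\tfrac N2+1)$ for $N$ even. The deformation parameter $q\in\mathbb C\setminus\{0\}$ is not a root of unity; for $N$ odd a square root $q^{1/2}$ is fixed (real when $q$ is real; normalized so that $q^{1/2}\to1$ as $q\to1$). The metric is $C_{ab}=q^{-\rho_a}\delta_{ab'}$; its inverse $C^{ab}$ has the same matrix entries. The nonzero entries of the matrix $R$ (no summation) are: $R^{aa}{}_{aa}=q$ ($a\ne n_2$); $R^{aa'}{}_{aa'}=q^{-1}$ ($a\neq n_2$); $R^{n_2n_2}{}_{n_2n_2}=1$ ($N$ odd); $R^{ab}{}_{ab}=1$ ($a\ne b$, $a'\neq b$); $R^{ab}{}_{ba}=q-q^{-1}$ ($a>b$, $a'\ne b$); $R^{aa'}{}_{a'a}=(q-q^{-1})(1-q^{\rho_a-\rho_{a'}})$ ($a>a'$); $R^{aa'}{}_{bb'}=-(q-q^{-1})q^{\rho_a-\rho_b}$ ($a>b$, $a'\neq b$). The relation $R_{12}T_1T_2=T_2T_1R_{12}$ means $R^{ab}{}_{ef}T^e{}_cT^f{}_d=T^b{}_fT^a{}_eR^{ef}{}_{cd}$. $SO_q(N)$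 is the unital complex algebra generated by $T^a{}_b$ subject to $R_{12}T_1T_2=T_2T_1R_{12}$, $TCT^t=C\,I$, $T^tCT=C\,I$ and $\det_qT=1$, with Hopf structure $\Delta(T^a{}_b)=T^a{}_c\otimes T^c{}_b$, $\varepsilon(T^a{}_b)=\delta^a_b$, antipode $\kappa(T)=CT^tC$. Here $\hat R^{ab}{}_{cd}=R^{ba}{}_{cd}$, $P_0{}^{ab}{}_{cd}=(C_{ef}C^{ef})^{-1}C^{ab}C_{cd}$, $P_A=\frac1{q+q^{-1}}[-\hat R+q\,\mathbf 1-(q-q^{1-N})P_0]$, and $\det_qT$ is the group-like element through which $T$ coacts on the one-dimensional degree $N$ part of the quantum exterior algebra (generators $\xi^a$, relations $(\mathbf 1-P_A)^{ab}{}_{cd}\xi^c\xi^d=0$, coaction $\xi^a\mapsto T^a{}_b\otimes\xi^b$). A $*$-conjugation ($*$-structure) on a Hopf algebra is an antilinear, antimultiplicative map with $*^2=\mathrm{id}$, $\Delta\circ *=( *\otimes * )\circ\Delta$ and $\varepsilon(a^* )=\overline{\varepsilon(a)}$. Two of them, $*$ and $*'$, are equivalent if $*'=\alpha\circ *\circ\alpha^{-1}$ for some Hopf algebra automorphism $\alpha$. Two known conjugations on $SO_q(N)$ are: $\times$, for $|q|=1$, $T^\times=T$ (entrywise); and $\star$, for $q\in\mathbb R$, $T^\star=[\kappa(T)]^t=C^tTC^t$. Real form / classical limit: for a $*$-conjugation of the form $T^*=U_qTU_q^{-1}$ with $U_q$ a numerical matrix with limit $U_1$ as $q\to1$, the classical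 limit group is $\{g\in SL_N(\mathbb C): g^tC_{q=1}g=C_{q=1},\ \overline g=U_1gU_1^{-1}\}$. $SO(l,m)$ denotes the group of real matrices of determinant $1$ preserving a nondegenerate symmetric form of signature $(l,m)$. Saying that the real form is $SO_q(l,m)$ means that this classical limit group is isomorphic to $SO(l,m)$ by a complex linear change of basis. *)

theory Defs
  imports
    "HOL-Algebra.Algebraic_Closure_Type"
    "HOL-Algebra.QuotRing"
    "HOL-Library.Poly_Mapping"
    "HOL-Library.Product_Plus"
    "HOL-Combinatorics.Transposition"
    "Jordan_Normal_Form.Determinant"
    "Jordan_Normal_Form.Gauss_Jordan_Elimination"
begin

text \<open>
  Conventions. Indices run over \<open>0, \<dots>, N - 1\<close> instead of \<open>1, \<dots>, N\<close>, so that the involution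
  \<open>a' = N + 1 - a\<close> becomes \<open>N - 1 - a\<close> and, for \<open>N = 2 n + 1\<close>, the middle index becomes \<open>n\<close>.
  All structures depend on \<open>q\<close> through a square root \<open>h\<close> with \<open>q = h^2\<close>; for even \<open>N\<close> only
  even powers of \<open>h\<close>, i.e. powers of \<open>q\<close>, occur.
\<close>

section \<open>Numerical data\<close>

definition pri :: "nat \<Rightarrow> nat \<Rightarrow> nat" where
  "pri N a = N - 1 - a"

text \<open>The integer \<open>2 \<rho>\<^sub>a\<close>.\<close>

definition rho2 :: "nat \<Rightarrow> nat \<Rightarrow> int" where
  "rho2 N a =
     (if a < pri N a then int N - 2 - 2 * int a
      else if a = pri N a then 0
      else int N - 2 * int a)"

definition metric :: "nat \<Rightarrow> complex \<Rightarrow> complex mat" where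
  "metric N h = mat N N (\<lambda>(a, b). if a = pri N b then h powi (- rho2 N a) else 0)"

text \<open>\<open>Rm N h a b c d\<close> is \<open>R\<close> with upper indices \<open>a b\<close> and lower indices \<open>c d\<close>.\<close>

definition Rm :: "nat \<Rightarrow> complex \<Rightarrow> nat \<Rightarrow> nat \<Rightarrow> nat \<Rightarrow> nat \<Rightarrow> complex" where
  "Rm N h a b c d =
     (let q = h\<^sup>2 in
      if c = a \<and> d = b then
        (if b = a then (if a = pri N a then 1 else q)
         else if b = pri N a then inverse q else 1)
      else if c = b \<and> d = a \<and> a > b then
        (if b = pri N a then (q - inverse q) * (1 - h powi (rho2 N a - rho2 N b))
         else q - inverse q)
      else if b = pri N a \<and> d = pri N c \<and> a > c \<and> c \<noteq> pri N a then
        - (q - inverse q) * h powi (rho2 N a - rho2 N c)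
      else 0)"

definition Rhat :: "nat \<Rightarrow> complex \<Rightarrow> nat \<Rightarrow> nat \<Rightarrow> nat \<Rightarrow> nat \<Rightarrow> complex" where
  "Rhat N h a b c d = Rm N h b a c d"

text \<open>The inverse metric \<open>C\<^sup>a\<^sup>b\<close> has the same entries as the metric.\<close>

definition P0 :: "nat \<Rightarrow> complex \<Rightarrow> nat \<Rightarrow> nat \<Rightarrow> nat \<Rightarrow> nat \<Rightarrow> complex" where
  "P0 N h a b c d =
     inverse (\<Sum>e<N. \<Sum>f<N. metric N h $$ (e, f) * metric N h $$ (e, f))
       * metric N h $$ (a, b) * metric N h $$ (c, d)"

definition PA :: "nat \<Rightarrow> complex \<Rightarrow> nat \<Rightarrow> nat \<Rightarrow> nat \<Rightarrow> nat \<Rightarrow> complex" where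
  "PA N h a b c d =
     (let q = h\<^sup>2 in
      inverse (q + inverse q) *
        (- Rhat N h a b c d + q * (if a = c \<and> b = d then 1 else 0)
         - (q - q powi (1 - int N)) * P0 N h a b c d))"

definition Dmat :: "nat \<Rightarrow> complex mat" where
  "Dmat N =
     (if even N
      then mat N N (\<lambda>(i, j). if i = Transposition.transpose (N div 2 - 1) (N div 2) j then 1 else 0)
      else mat_diag N (\<lambda>i. if i = N div 2 then - 1 else 1))"

text \<open>\<^const>\<open>mat_inverse\<close> yields \<open>Some\<close> exactly on invertible square matrices.\<close>

abbreviation minv :: "complex mat \<Rightarrow> complex mat" where
  "minv U \<equiv> the (mat_inverse U)"

section \<open>Free algebras and their tensor products\<close>

text \<open>Words form the free monoid under concatenation; \<^typ>\<open>'x list \<Rightarrow>\<^sub>0 complex\<close> is its monoid algebra.\<close>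

instantiation list :: (type) monoid_add
begin
definition zero_list :: "'a list" where "zero_list = []"
definition plus_list :: "'a list \<Rightarrow> 'a list \<Rightarrow> 'a list" where "plus_list xs ys = xs @ ys"
instance by standard (simp_all add: zero_list_def plus_list_def)
end

definition monoid_alg :: "'m::monoid_add set \<Rightarrow> ('m \<Rightarrow>\<^sub>0 complex) ring" where
  "monoid_alg M = ring_of_type_algebra\<lparr>carrier := {p. Poly_Mapping.keys p \<subseteq> M}\<rparr>"

abbreviation free_alg :: "'x set \<Rightarrow> ('x list \<Rightarrow>\<^sub>0 complex) ring" where
  "free_alg A \<equiv> monoid_alg (lists A)"

text \<open>The tensor product of two free algebras is the monoid algebra of the product of the free monoids.\<close>

abbreviation free_tensor :: "'x set \<Rightarrow> 'y set \<Rightarrow> ('x list \<times> 'y list \<Rightarrow>\<^sub>0 complex) ring" where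
  "free_tensor A B \<equiv> monoid_alg (lists A \<times> lists B)"

definition cst :: "complex \<Rightarrow> 'm::monoid_add \<Rightarrow>\<^sub>0 complex" where
  "cst c = Poly_Mapping.single 0 c"

definition var :: "'x \<Rightarrow> 'x list \<Rightarrow>\<^sub>0 complex" where
  "var x = Poly_Mapping.single [x] 1"

definition tens :: "('x list \<Rightarrow>\<^sub>0 complex) \<Rightarrow> ('y list \<Rightarrow>\<^sub>0 complex) \<Rightarrow> ('x list \<times> 'y list \<Rightarrow>\<^sub>0 complex)" where
  "tens p r = (\<Sum>v\<in>Poly_Mapping.keys p. \<Sum>w\<in>Poly_Mapping.keys r. Poly_Mapping.single (v, w) (Poly_Mapping.lookup p v * Poly_Mapping.lookup r w))"

text \<open>
  The extensions of an assignment of the letters to a linear multiplicative, a linear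
  antimultiplicative, and an antilinear antimultiplicative map on the free algebra.
\<close>

definition alg_ext :: "('x \<Rightarrow> ('m::monoid_add \<Rightarrow>\<^sub>0 complex)) \<Rightarrow> ('x list \<Rightarrow>\<^sub>0 complex) \<Rightarrow> ('m \<Rightarrow>\<^sub>0 complex)" where
  "alg_ext f p = (\<Sum>w\<in>Poly_Mapping.keys p. cst (Poly_Mapping.lookup p w) * prod_list (map f w))"

definition anti_ext :: "('x \<Rightarrow> ('m::monoid_add \<Rightarrow>\<^sub>0 complex)) \<Rightarrow> ('x list \<Rightarrow>\<^sub>0 complex) \<Rightarrow> ('m \<Rightarrow>\<^sub>0 complex)" where
  "anti_ext f p = (\<Sum>w\<in>Poly_Mapping.keys p. cst (Poly_Mapping.lookup p w) * prod_list (map f (rev w)))"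

definition star_ext :: "('x \<Rightarrow> ('m::monoid_add \<Rightarrow>\<^sub>0 complex)) \<Rightarrow> ('x list \<Rightarrow>\<^sub>0 complex) \<Rightarrow> ('m \<Rightarrow>\<^sub>0 complex)" where
  "star_ext f p = (\<Sum>w\<in>Poly_Mapping.keys p. cst (cnj (Poly_Mapping.lookup p w)) * prod_list (map f (rev w)))"

text \<open>
  The ideal \<open>I \<otimes> G + F \<otimes> J\<close> of \<open>F \<otimes> G\<close> (for the free algebras \<open>F\<close>, \<open>G\<close> on \<open>A\<close>, \<open>B\<close>), that is, the
  kernel of \<open>F \<otimes> G \<rightarrow> F/I \<otimes> G/J\<close>. Hence the quotient by it is \<open>F/I \<otimes> G/J\<close>.
\<close>

definition tensor_ideal ::
  "'x set \<Rightarrow> ('x list \<Rightarrow>\<^sub>0 complex) set \<Rightarrow> 'y set \<Rightarrow> ('y list \<Rightarrow>\<^sub>0 complex) set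
     \<Rightarrow> ('x list \<times> 'y list \<Rightarrow>\<^sub>0 complex) set" where
  "tensor_ideal A I B J =
     Idl\<^bsub>free_tensor A B\<^esub> ((\<lambda>x. tens x 1) ` I \<union> (\<lambda>y. tens 1 y) ` J)"

text \<open>The map on cosets induced by a map \<open>f\<close> into \<open>S\<close>, with values taken modulo the ideal \<open>J\<close>.\<close>

definition induced :: "'b ring \<Rightarrow> 'b set \<Rightarrow> ('a \<Rightarrow> 'b) \<Rightarrow> 'a set \<Rightarrow> 'b set" where
  "induced S J f A = the_elem ((\<lambda>x. J +>\<^bsub>S\<^esub> f x) ` A)"

section \<open>The quantum group\<close>

type_synonym talg = "(nat \<times> nat) list \<Rightarrow>\<^sub>0 complex"
type_synonym ttens = "(nat \<times> nat) list \<times> (nat \<times> nat) list \<Rightarrow>\<^sub>0 complex"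

abbreviation T_idx :: "nat \<Rightarrow> (nat \<times> nat) set" where
  "T_idx N \<equiv> {..<N} \<times> {..<N}"

definition T :: "nat \<Rightarrow> nat \<Rightarrow> talg" where
  "T a b = var (a, b)"

definition rtt_rel :: "nat \<Rightarrow> complex \<Rightarrow> nat \<Rightarrow> nat \<Rightarrow> nat \<Rightarrow> nat \<Rightarrow> talg" where
  "rtt_rel N h a b c d =
     (\<Sum>e<N. \<Sum>f<N. cst (Rm N h a b e f) * T e c * T f d)
     - (\<Sum>e<N. \<Sum>f<N. T b f * T a e * cst (Rm N h e f c d))"

text \<open>The entries of \<open>T C T\<^sup>t - C\<close> and \<open>T\<^sup>t C T - C\<close>.\<close>

definition metric_rel1 :: "nat \<Rightarrow> complex \<Rightarrow> nat \<Rightarrow> nat \<Rightarrow> talg" where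
  "metric_rel1 N h a b =
     (\<Sum>c<N. \<Sum>d<N. T a c * cst (metric N h $$ (c, d)) * T b d) - cst (metric N h $$ (a, b))"

definition metric_rel2 :: "nat \<Rightarrow> complex \<Rightarrow> nat \<Rightarrow> nat \<Rightarrow> talg" where
  "metric_rel2 N h a b =
     (\<Sum>c<N. \<Sum>d<N. T c a * cst (metric N h $$ (c, d)) * T d b) - cst (metric N h $$ (a, b))"

definition O_rels :: "nat \<Rightarrow> complex \<Rightarrow> talg set" where
  "O_rels N h =
     {rtt_rel N h a b c d | a b c d. a < N \<and> b < N \<and> c < N \<and> d < N}
     \<union> {metric_rel1 N h a b | a b. a < N \<and> b < N}
     \<union> {metric_rel2 N h a b | a b. a < N \<and> b < N}"

definition O_ideal :: "nat \<Rightarrow> complex \<Rightarrow> talg set" where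
  "O_ideal N h = Idl\<^bsub>free_alg (T_idx N)\<^esub> (O_rels N h)"

definition Delta_free :: "nat \<Rightarrow> talg \<Rightarrow> ttens" where
  "Delta_free N = alg_ext (\<lambda>(a, b). \<Sum>c<N. tens (T a c) (T c b))"

definition eps_free :: "talg \<Rightarrow> complex" where
  "eps_free p = (\<Sum>w\<in>Poly_Mapping.keys p. Poly_Mapping.lookup p w * prod_list (map (\<lambda>(a, b). if a = b then 1 else 0) w))"

text \<open>\<open>\<kappa>(T) = C T\<^sup>t C\<close>.\<close>

definition kappa_T :: "nat \<Rightarrow> complex \<Rightarrow> nat \<Rightarrow> nat \<Rightarrow> talg" where
  "kappa_T N h a b =
     (\<Sum>c<N. \<Sum>d<N. cst (metric N h $$ (a, c) * metric N h $$ (d, b)) * T d c)"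

definition kappa_free :: "nat \<Rightarrow> complex \<Rightarrow> talg \<Rightarrow> talg" where
  "kappa_free N h = anti_ext (\<lambda>(a, b). kappa_T N h a b)"

subsection \<open>Quantum exterior algebra and quantum determinant\<close>

definition ext_ideal :: "nat \<Rightarrow> complex \<Rightarrow> (nat list \<Rightarrow>\<^sub>0 complex) set" where
  "ext_ideal N h =
     Idl\<^bsub>free_alg {..<N}\<^esub>
       {\<Sum>c<N. \<Sum>d<N. cst ((if a = c \<and> b = d then 1 else 0) - PA N h a b c d) * var c * var d
        | a b. a < N \<and> b < N}"

definition coact_free :: "nat \<Rightarrow> (nat list \<Rightarrow>\<^sub>0 complex) \<Rightarrow> ((nat \<times> nat) list \<times> nat list \<Rightarrow>\<^sub>0 complex)" where
  "coact_free N = alg_ext (\<lambda>a. \<Sum>b<N. tens (T a b) (var b))"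

text \<open>
  \<open>D\<close> represents the quantum determinant: in the algebra without the determinant relation it is
  group-like, and the coaction on the degree \<open>N\<close> part of the exterior algebra is
  \<open>\<omega> \<mapsto> D \<otimes> \<omega>\<close>. As that part is one-dimensional, such a \<open>D\<close> is unique modulo \<^const>\<open>O_ideal\<close>.
\<close>

definition is_qdet :: "nat \<Rightarrow> complex \<Rightarrow> talg \<Rightarrow> bool" where
  "is_qdet N h D \<longleftrightarrow>
     D \<in> carrier (free_alg (T_idx N)) \<and>
     Delta_free N D - tens D D \<in> tensor_ideal (T_idx N) (O_ideal N h) (T_idx N) (O_ideal N h) \<and>
     eps_free D = 1 \<and>
     (\<forall>\<omega>\<in>carrier (free_alg {..<N}). (\<forall>w\<in>Poly_Mapping.keys \<omega>. length w = N) \<longrightarrow>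
        coact_free N \<omega> - tens D \<omega> \<in> tensor_ideal (T_idx N) (O_ideal N h) {..<N} (ext_ideal N h))"

subsection \<open>The Hopf algebra\<close>

definition SO_ideal :: "nat \<Rightarrow> complex \<Rightarrow> talg set" where
  "SO_ideal N h = Idl\<^bsub>free_alg (T_idx N)\<^esub> (O_rels N h \<union> {D - 1 | D. is_qdet N h D})"

definition SOq :: "nat \<Rightarrow> complex \<Rightarrow> talg set ring" where
  "SOq N h = free_alg (T_idx N) Quot SO_ideal N h"

definition SO_class :: "nat \<Rightarrow> complex \<Rightarrow> talg \<Rightarrow> talg set" where
  "SO_class N h x = SO_ideal N h +>\<^bsub>free_alg (T_idx N)\<^esub> x"

definition gen :: "nat \<Rightarrow> complex \<Rightarrow> nat \<Rightarrow> nat \<Rightarrow> talg set" where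
  "gen N h a b = SO_class N h (T a b)"

definition scal :: "nat \<Rightarrow> complex \<Rightarrow> complex \<Rightarrow> talg set \<Rightarrow> talg set" where
  "scal N h c x = SO_class N h (cst c) \<otimes>\<^bsub>SOq N h\<^esub> x"

definition SO2_ideal :: "nat \<Rightarrow> complex \<Rightarrow> ttens set" where
  "SO2_ideal N h = tensor_ideal (T_idx N) (SO_ideal N h) (T_idx N) (SO_ideal N h)"

definition SOq2 :: "nat \<Rightarrow> complex \<Rightarrow> ttens set ring" where
  "SOq2 N h = free_tensor (T_idx N) (T_idx N) Quot SO2_ideal N h"

definition pure :: "nat \<Rightarrow> complex \<Rightarrow> talg set \<Rightarrow> talg set \<Rightarrow> ttens set" where
  "pure N h x y =
     the_elem {SO2_ideal N h +>\<^bsub>free_tensor (T_idx N) (T_idx N)\<^esub> tens u v | u v. u \<in> x \<and> v \<in> y}"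

text \<open>
  \<open>\<phi> \<otimes> \<phi>\<close>, for \<open>\<phi>\<close> linear or antilinear: every element of the tensor square is a finite sum of
  pure tensors, and \<open>\<Sum> x\<^sub>i \<otimes> y\<^sub>i\<close> is sent to \<open>\<Sum> \<phi> x\<^sub>i \<otimes> \<phi> y\<^sub>i\<close>.
\<close>

definition tensor_sq :: "nat \<Rightarrow> complex \<Rightarrow> (talg set \<Rightarrow> talg set) \<Rightarrow> ttens set \<Rightarrow> ttens set" where
  "tensor_sq N h \<phi> z =
     the_elem {\<Oplus>\<^bsub>SOq2 N h\<^esub>i\<in>{..<k}. pure N h (\<phi> (x i)) (\<phi> (y i)) | (k::nat) x y.
       x \<in> {..<k} \<rightarrow> carrier (SOq N h) \<and> y \<in> {..<k} \<rightarrow> carrier (SOq N h) \<and>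
       z = (\<Oplus>\<^bsub>SOq2 N h\<^esub>i\<in>{..<k}. pure N h (x i) (y i))}"

definition Delta :: "nat \<Rightarrow> complex \<Rightarrow> talg set \<Rightarrow> ttens set" where
  "Delta N h = induced (free_tensor (T_idx N) (T_idx N)) (SO2_ideal N h) (Delta_free N)"

definition eps :: "nat \<Rightarrow> complex \<Rightarrow> talg set \<Rightarrow> complex" where
  "eps N h A = the_elem (eps_free ` A)"

definition kappa :: "nat \<Rightarrow> complex \<Rightarrow> talg set \<Rightarrow> talg set" where
  "kappa N h = induced (free_alg (T_idx N)) (SO_ideal N h) (kappa_free N h)"

section \<open>Automorphisms and conjugations\<close>

definition hopf_automorphism :: "nat \<Rightarrow> complex \<Rightarrow> (talg set \<Rightarrow> talg set) \<Rightarrow> bool" where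
  "hopf_automorphism N h \<phi> \<longleftrightarrow>
     \<phi> \<in> ring_iso (SOq N h) (SOq N h) \<and>
     (\<forall>x\<in>carrier (SOq N h).
        (\<forall>c. \<phi> (scal N h c x) = scal N h c (\<phi> x)) \<and>
        Delta N h (\<phi> x) = tensor_sq N h \<phi> (Delta N h x) \<and>
        eps N h (\<phi> x) = eps N h x \<and>
        kappa N h (\<phi> x) = \<phi> (kappa N h x))"

definition star_conjugation :: "nat \<Rightarrow> complex \<Rightarrow> (talg set \<Rightarrow> talg set) \<Rightarrow> bool" where
  "star_conjugation N h s \<longleftrightarrow>
     s \<in> carrier (SOq N h) \<rightarrow> carrier (SOq N h) \<and>
     (\<forall>x\<in>carrier (SOq N h). \<forall>y\<in>carrier (SOq N h).
        s (x \<oplus>\<^bsub>SOq N h\<^esub> y) = s x \<oplus>\<^bsub>SOq N h\<^esub> s y \<and>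
        s (x \<otimes>\<^bsub>SOq N h\<^esub> y) = s y \<otimes>\<^bsub>SOq N h\<^esub> s x) \<and>
     (\<forall>x\<in>carrier (SOq N h).
        (\<forall>c. s (scal N h c x) = scal N h (cnj c) (s x)) \<and>
        s (s x) = x \<and>
        Delta N h (s x) = tensor_sq N h s (Delta N h x) \<and>
        eps N h (s x) = cnj (eps N h x))"

definition conj_equivalent ::
  "nat \<Rightarrow> complex \<Rightarrow> (talg set \<Rightarrow> talg set) \<Rightarrow> (talg set \<Rightarrow> talg set) \<Rightarrow> bool" where
  "conj_equivalent N h s s' \<longleftrightarrow>
     (\<exists>\<alpha>. hopf_automorphism N h \<alpha> \<and>
       (\<forall>x\<in>carrier (SOq N h). s' x = \<alpha> (s (inv_into (carrier (SOq N h)) \<alpha> x))))"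

text \<open>The entries of \<open>U T U\<^sup>-\<^sup>1\<close>.\<close>

definition UTU :: "nat \<Rightarrow> complex mat \<Rightarrow> nat \<Rightarrow> nat \<Rightarrow> talg" where
  "UTU N U a b = (\<Sum>c<N. \<Sum>d<N. cst (U $$ (a, c) * minv U $$ (d, b)) * T c d)"

definition sharp :: "nat \<Rightarrow> complex \<Rightarrow> talg set \<Rightarrow> talg set" where
  "sharp N h = induced (free_alg (T_idx N)) (SO_ideal N h) (alg_ext (\<lambda>(a, b). UTU N (Dmat N) a b))"

text \<open>
  The known conjugations: \<open>T\<^sup>\<times> = T\<close> (meant for \<open>|q| = 1\<close>) and \<open>T\<^sup>\<star> = [\<kappa>(T)]\<^sup>t\<close> (meant for real \<open>q\<close>).
\<close>

definition times_conj :: "nat \<Rightarrow> complex \<Rightarrow> talg set \<Rightarrow> talg set" where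
  "times_conj N h = induced (free_alg (T_idx N)) (SO_ideal N h) (star_ext (\<lambda>(a, b). T a b))"

definition star_conj :: "nat \<Rightarrow> complex \<Rightarrow> talg set \<Rightarrow> talg set" where
  "star_conj N h = induced (free_alg (T_idx N)) (SO_ideal N h) (star_ext (\<lambda>(a, b). kappa_T N h b a))"

definition times_sharp :: "nat \<Rightarrow> complex \<Rightarrow> talg set \<Rightarrow> talg set" where
  "times_sharp N h = sharp N h \<circ> times_conj N h"

definition star_sharp :: "nat \<Rightarrow> complex \<Rightarrow> talg set \<Rightarrow> talg set" where
  "star_sharp N h = sharp N h \<circ> star_conj N h"

section \<open>Admissible parameters and the classical limit\<close>

text \<open>
  The admissible \<open>h = q\<^sup>1\<^sup>/\<^sup>2\<close>. For odd \<open>N\<close> the square root is required to be real when \<open>q\<close> is.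
\<close>

definition q_roots :: "nat \<Rightarrow> complex set" where
  "q_roots N = {h. h \<noteq> 0 \<and> (\<forall>k>0. (h\<^sup>2) ^ k \<noteq> 1) \<and> (odd N \<and> h\<^sup>2 \<in> \<real> \<longrightarrow> h \<in> \<real>)}"

definition q_roots_real :: "nat \<Rightarrow> complex set" where
  "q_roots_real N = {h \<in> q_roots N. h\<^sup>2 \<in> \<real>}"

definition q_roots_unit :: "nat \<Rightarrow> complex set" where
  "q_roots_unit N = {h \<in> q_roots N. cmod (h\<^sup>2) = 1}"

text \<open>The classical limit group determined by \<open>U\<^sub>1\<close>; note that \<open>q = 1\<close> is \<open>h = 1\<close>.\<close>

definition limit_group :: "nat \<Rightarrow> complex mat \<Rightarrow> complex mat set" where
  "limit_group N U1 =
     {g \<in> carrier_mat N N. det g = 1 \<and> transpose_mat g * metric N 1 * g = metric N 1 \<and>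
        map_mat cnj g = U1 * g * minv U1}"

text \<open>\<open>SO(l, m)\<close>, its real matrices being regarded as complex ones.\<close>

definition SO_real :: "nat \<Rightarrow> nat \<Rightarrow> complex mat set" where
  "SO_real l m =
     (let E = mat_diag (l + m) (\<lambda>i. if i < l then 1 else - 1) :: real mat in
      map_mat complex_of_real `
        {g \<in> carrier_mat (l + m) (l + m). det g = 1 \<and> transpose_mat g * E * g = E})"

text \<open>
  The family of conjugations \<open>s h\<close>, \<open>h \<in> H\<close>, has the form \<open>T \<mapsto> U\<^sub>h T U\<^sub>h\<^sup>-\<^sup>1\<close> with \<open>U\<^sub>h \<rightarrow> U\<^sub>1\<close> as
  \<open>q \<rightarrow> 1\<close> (with the normalization \<open>q\<^sup>1\<^sup>/\<^sup>2 \<rightarrow> 1\<close>, i.e. \<open>h \<rightarrow> 1\<close>), and its classical limit group is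
  \<open>SO(l, m)\<close> up to a complex linear change of basis.
\<close>

definition has_real_form ::
  "nat \<Rightarrow> complex set \<Rightarrow> (complex \<Rightarrow> talg set \<Rightarrow> talg set) \<Rightarrow> nat \<Rightarrow> nat \<Rightarrow> bool" where
  "has_real_form N H s l m \<longleftrightarrow>
     (\<exists>U U1.
        (\<forall>h\<in>H. U h \<in> carrier_mat N N \<and> invertible_mat (U h) \<and>
           (\<forall>a<N. \<forall>b<N. s h (gen N h a b) = SO_class N h (UTU N (U h) a b))) \<and>
        U1 \<in> carrier_mat N N \<and> invertible_mat U1 \<and>
        (\<forall>a<N. \<forall>b<N. ((\<lambda>h. U h $$ (a, b)) \<longlongrightarrow> U1 $$ (a, b)) (at 1 within H)) \<and>
        (\<exists>M\<in>carrier_mat N N. invertible_mat M \<and>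
           limit_group N U1 = (\<lambda>g. M * g * minv M) ` SO_real l m))"

end

(*
  The automorphism, the conjugations and their composites send T^a_b to u_a u_b^{-1} T^{tau a}_{tau b}
  for an involution tau of the indices and scalars u_a. For such a monomial map the compatibility with
  the RTT and metric relations reduces to entrywise identities between R, C, tau and u. The relation
  det_q T = 1 is preserved because the map on matrix entries, tensored with the analogous monomial map of
  the quantum exterior algebra, intertwines the coaction; so it sends det_q T to another element through
  which T coacts on the one-dimensional top degree. The antipode respects this relation because
  kappa(D) inverts the group-like element D. The signatures of the classical limits are read off explicit
  bases fixed by the limiting real structure and orthogonal for the limiting metric.
*)
theory Submission
  imports Defs
begin

section \<open>Linear and antilinear maps of monoid algebras\<close>

text \<open>The quantum determinant is given by a property, not by a formula: the relation is
  imposed for every \<open>D\<close> with \<open>is_qdet\<close>, so a map descends only if it sends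
  each such \<open>D\<close> to another one. Testing this on an arbitrary form of top degree
  requires the companion map of the exterior algebra to be onto. For real q the entries of
  \<open>R\<close> and \<open>C\<close> are real and prime-symmetric, and the relations go over into
  each other directly. For |q| = 1 conjugation inverts \<open>R\<close>, and R^{-1} differs from
  R_21 by a multiple of P - K, with P the flip and K of rank one: P drops out of the RTT relation, K
  is absorbed by the two metric relations. The projector P_A is still respected because of the exact
  value of the trace of C C^t, which is nonzero since q is not a root of unity. A monomial map
  depends on its weights only up to a common factor, so involutivity, commutation and equivalence of
  conjugations turn into identities between index maps and weights. That freedom is used for odd N,
  where the diagonal matrix realising the equivalence squares to minus \<open>Dmat\<close>.\<close>

lemma cst_0 [simp]: "cst 0 = 0"
  by (simp add: cst_def)

lemma cst_1 [simp]: "cst 1 = 1"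
  by (simp add: cst_def)

lemma cst_add: "cst (x + y) = cst x + cst y"
  by (simp add: cst_def single_add)

lemma cst_uminus: "cst (- x) = - cst x"
  by (simp add: cst_def single_uminus)

lemma cst_diff: "cst (x - y) = cst x - cst y"
  by (simp add: cst_def single_diff)

lemma cst_mult: "cst (x * y) = cst x * cst y"
  by (simp add: cst_def mult_single)

lemma cst_sum: "cst (\<Sum>i\<in>I. f i) = (\<Sum>i\<in>I. cst (f i))"
  by (induction I rule: infinite_finite_induct) (simp_all add: cst_add)

lemma cst_times_single: "cst c * Poly_Mapping.single m z = Poly_Mapping.single m (c * z)"
  by (simp add: cst_def mult_single)

lemma poly_mapping_sum_singles:
  fixes p :: "'m \<Rightarrow>\<^sub>0 'c::comm_monoid_add"
  shows "p = (\<Sum>m\<in>Poly_Mapping.keys p. Poly_Mapping.single m (Poly_Mapping.lookup p m))"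
  by (rule poly_mapping_eqI)
    (simp add: lookup_sum lookup_single when_def in_keys_iff sum.delta)

text \<open>Linearity reduces every identity below to single words. The bound \<open>M\<close> on
  the support is carried along so that the step for a single word knows which alphabet its letters
  come from.\<close>

lemma poly_mapping_single_induct [consumes 1, case_names zero single add]:
  fixes p :: "'m \<Rightarrow>\<^sub>0 'c::comm_monoid_add"
  assumes "Poly_Mapping.keys p \<subseteq> M"
    and "P 0"
    and "\<And>m z. m \<in> M \<Longrightarrow> P (Poly_Mapping.single m z)"
    and "\<And>x y. P x \<Longrightarrow> P y \<Longrightarrow> P (x + y)"
  shows "P p"
proof -
  have "P (\<Sum>m\<in>K. Poly_Mapping.single m (Poly_Mapping.lookup p m))" if "finite K" "K \<subseteq> M" for K
    using that by (induction rule: finite_induct) (auto intro: assms)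
  from this[OF finite_keys assms(1)] show ?thesis
    by (simp flip: poly_mapping_sum_singles)
qed

lemma cst_central: "p * cst c = cst c * p"
  by (rule poly_mapping_single_induct[of p UNIV])
    (auto simp: cst_def mult_single algebra_simps)

lemma cst_left_commute: "p * (cst c * r) = cst c * (p * r)"
  by (metis cst_central mult.assoc)

lemma cst_cst_mult: "cst c * (cst d * p) = cst (c * d) * p"
  by (simp add: cst_mult mult.assoc)

lemma cst_mult_mult: "(cst c * p) * (cst d * r) = cst (c * d) * (p * r)"
  by (metis cst_cst_mult cst_left_commute mult.assoc)

text \<open>A flag instead of two notions lets linear and antilinear maps share the proofs that
  follow.\<close>

definition cj :: "bool \<Rightarrow> complex \<Rightarrow> complex" where
  "cj b z = (if b then cnj z else z)"

lemma cj_simps [simp]: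
  "cj b 0 = 0" "cj b 1 = 1" "cj b (x + y) = cj b x + cj b y" "cj b (- x) = - cj b x"
  "cj b (x - y) = cj b x - cj b y" "cj b (x * y) = cj b x * cj b y"
  "cj b (inverse x) = inverse (cj b x)" "cj b (x / y) = cj b x / cj b y"
  "cj b (cj b x) = x" "cj b x = 0 \<longleftrightarrow> x = 0" "cj False x = x" "cj True x = cnj x"
  by (auto simp: cj_def)

text \<open>Here \<open>F\<close> gives the images of whole words. Scalars enter through
  \<open>cj b\<close>, while multiplicativity is a property of \<open>F\<close>; the antipode needs
  the two separated, being linear but antimultiplicative.\<close>

definition lin_ext ::
  "bool \<Rightarrow> ('m \<Rightarrow> ('k::monoid_add \<Rightarrow>\<^sub>0 complex)) \<Rightarrow> ('m \<Rightarrow>\<^sub>0 complex) \<Rightarrow> ('k \<Rightarrow>\<^sub>0 complex)" where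
  "lin_ext b F p = (\<Sum>m\<in>Poly_Mapping.keys p. cst (cj b (Poly_Mapping.lookup p m)) * F m)"

text \<open>Cancellation may shrink the support of a sum, so additivity is proved over a common
  finite superset of the supports.\<close>

lemma lin_ext_superset:
  assumes "finite S" "Poly_Mapping.keys p \<subseteq> S"
  shows "lin_ext b F p = (\<Sum>m\<in>S. cst (cj b (Poly_Mapping.lookup p m)) * F m)"
  unfolding lin_ext_def by (rule sum.mono_neutral_left) (use assms in \<open>auto simp: in_keys_iff\<close>)

lemma lin_ext_additive: "additive (lin_ext b F)"
proof
  fix p r :: "'a \<Rightarrow>\<^sub>0 complex"
  let ?S = "Poly_Mapping.keys p \<union> Poly_Mapping.keys r"
  have "Poly_Mapping.keys (p + r) \<subseteq> ?S" by (rule keys_add)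
  then show "lin_ext b F (p + r) = lin_ext b F p + lin_ext b F r"
    by (simp add: lin_ext_superset[of ?S] lookup_add cst_add distrib_right sum.distrib)
qed

lemmas lin_ext_zero [simp] = additive.zero[OF lin_ext_additive]
lemmas lin_ext_add = additive.add[OF lin_ext_additive]
lemmas lin_ext_diff = additive.diff[OF lin_ext_additive]
lemmas lin_ext_sum = additive.sum[OF lin_ext_additive]

lemma lin_ext_single [simp]: "lin_ext b F (Poly_Mapping.single m z) = cst (cj b z) * F m"
  by (cases "z = 0") (simp_all add: lin_ext_def)

lemma lin_ext_cst_mult: "lin_ext b F (cst z * p) = cst (cj b z) * lin_ext b F p"
  by (rule poly_mapping_single_induct[of p UNIV])
    (auto simp: cst_times_single lin_ext_add distrib_left cst_mult mult.assoc)

lemma lin_ext_cst: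
  fixes F :: "'m::monoid_add \<Rightarrow> ('k::monoid_add \<Rightarrow>\<^sub>0 complex)"
  shows "F 0 = 1 \<Longrightarrow> lin_ext b F (cst z) = cst (cj b z)"
  by (simp add: cst_def[of z])

lemma lin_ext_one:
  fixes F :: "'m::monoid_add \<Rightarrow> ('k::monoid_add \<Rightarrow>\<^sub>0 complex)"
  shows "F 0 = 1 \<Longrightarrow> lin_ext b F 1 = 1"
  using lin_ext_cst[of F b 1] by simp

text \<open>Constants are central, so the order of factors (flag \<open>a\<close>) and the treatment
  of scalars (flag \<open>b\<close>) do not interact; it is enough to multiply single words.\<close>

lemma lin_ext_mult:
  assumes "\<And>m n. F (m + n) = (if a then F n * F m else F m * F n)"
  shows "lin_ext b F (p * r) = (if a then lin_ext b F r * lin_ext b F p else lin_ext b F p * lin_ext b F r)"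
proof (rule poly_mapping_single_induct[of p UNIV])
  fix m z
  show "lin_ext b F (Poly_Mapping.single m z * r)
    = (if a then lin_ext b F r * lin_ext b F (Poly_Mapping.single m z)
       else lin_ext b F (Poly_Mapping.single m z) * lin_ext b F r)"
    by (rule poly_mapping_single_induct[of r UNIV])
      (auto simp: mult_single lin_ext_add assms cst_mult_mult distrib_left distrib_right
        mult.commute[where 'a = complex])
qed (auto simp: lin_ext_add distrib_left distrib_right)

lemma additive_eqI:
  assumes "additive f" "additive g" "Poly_Mapping.keys p \<subseteq> M"
    and "\<And>m z. m \<in> M \<Longrightarrow> f (Poly_Mapping.single m z) = g (Poly_Mapping.single m z)"
  shows "f p = g p"
  using assms(3)
  by (induction p rule: poly_mapping_single_induct)
    (auto simp: assms(4) additive.add[OF assms(1)] additive.add[OF assms(2)]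
      additive.zero[OF assms(1)] additive.zero[OF assms(2)])

lemma additive_comp: "additive f \<Longrightarrow> additive g \<Longrightarrow> additive (\<lambda>x. f (g x))"
  by (simp add: additive_def)

lemma keys_lin_ext:
  assumes "\<And>m. m \<in> M \<Longrightarrow> Poly_Mapping.keys (F m) \<subseteq> M'" "Poly_Mapping.keys p \<subseteq> M"
  shows "Poly_Mapping.keys (lin_ext b F p) \<subseteq> M'"
proof -
  have "Poly_Mapping.keys (cst z * x) \<subseteq> Poly_Mapping.keys x" for z and x :: "'b \<Rightarrow>\<^sub>0 complex"
    using keys_mult[of "cst z" x] by (auto simp: cst_def split: if_splits)
  then show ?thesis
    unfolding lin_ext_def using assms by (fastforce dest!: subsetD[OF keys_sum])
qed

lemma alg_ext_eq: "alg_ext f = lin_ext False (\<lambda>w. prod_list (map f w))"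
  by (simp add: fun_eq_iff alg_ext_def lin_ext_def)

lemma anti_ext_eq: "anti_ext f = lin_ext False (\<lambda>w. prod_list (map f (rev w)))"
  by (simp add: fun_eq_iff anti_ext_def lin_ext_def)

lemma star_ext_eq: "star_ext f = lin_ext True (\<lambda>w. prod_list (map f (rev w)))"
  by (simp add: fun_eq_iff star_ext_def lin_ext_def)

lemma zero_list_eq: "(0 :: 'a list) = []"
  by (simp add: zero_list_def)

lemma plus_list_eq: "xs + ys = xs @ ys"
  by (simp add: plus_list_def)

lemma single_Cons: "Poly_Mapping.single (x # w) z = cst z * var x * Poly_Mapping.single w 1"
  by (simp add: cst_def var_def mult_single plus_list_eq zero_list_eq)

subsection \<open>Tensors\<close>

lemma tens_eq: "tens p r = lin_ext False (\<lambda>v. lin_ext False (\<lambda>w. Poly_Mapping.single (v, w) 1) r) p"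
  by (simp add: tens_def lin_ext_def sum_distrib_left cst_times_single)

lemma additive_tens_left: "additive (\<lambda>p. tens p r)"
  by (simp add: tens_eq lin_ext_additive)

lemma additive_tens_right: "additive (tens p)"
proof (rule additive.intro)
  fix x y
  show "tens p (x + y) = tens p x + tens p y"
    by (simp add: tens_eq lin_ext_def[of False _ p] lin_ext_add distrib_left sum.distrib)
qed

lemmas tens_add_left = additive.add[OF additive_tens_left]
  and tens_diff_left = additive.diff[OF additive_tens_left]
  and tens_sum_left = additive.sum[OF additive_tens_left]
  and tens_zero_left [simp] = additive.zero[OF additive_tens_left]
  and tens_add_right = additive.add[OF additive_tens_right]
  and tens_diff_right = additive.diff[OF additive_tens_right]
  and tens_sum_right = additive.sum[OF additive_tens_right]
  and tens_zero_right [simp] = additive.zero[OF additive_tens_right]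

lemma tens_single:
  "tens (Poly_Mapping.single v c) (Poly_Mapping.single w d) = Poly_Mapping.single (v, w) (c * d)"
  by (simp add: tens_eq cst_times_single)

lemma tens_cst_left: "tens (cst c * p) r = cst c * tens p r"
  by (simp add: tens_eq lin_ext_cst_mult)

lemma tens_cst_right: "tens p (cst c * r) = cst c * tens p r"
  by (simp add: tens_eq lin_ext_cst_mult lin_ext_def[of False _ p] sum_distrib_left cst_cst_mult
      mult.commute[where 'a = complex])

lemma tens_one_one: "tens 1 1 = 1"
  using tens_single[of 0 1 0 1] by (simp flip: zero_prod_def)

lemma tens_mult: "tens (p * p') (r * r') = tens p r * tens p' r'"
proof (rule poly_mapping_single_induct[of p UNIV])
  fix v c
  show "tens (Poly_Mapping.single v c * p') (r * r') = tens (Poly_Mapping.single v c) r * tens p' r'"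
  proof (rule poly_mapping_single_induct[of p' UNIV])
    fix v' c'
    show "tens (Poly_Mapping.single v c * Poly_Mapping.single v' c') (r * r')
      = tens (Poly_Mapping.single v c) r * tens (Poly_Mapping.single v' c') r'"
    proof (rule poly_mapping_single_induct[of r UNIV])
      fix w d
      show "tens (Poly_Mapping.single v c * Poly_Mapping.single v' c') (Poly_Mapping.single w d * r')
        = tens (Poly_Mapping.single v c) (Poly_Mapping.single w d) * tens (Poly_Mapping.single v' c') r'"
        by (rule poly_mapping_single_induct[of r' UNIV])
          (auto simp: mult_single tens_single tens_add_right algebra_simps)
    qed (auto simp: tens_add_right algebra_simps)
  qed (auto simp: tens_add_left algebra_simps)
qed (auto simp: tens_add_left algebra_simps)

lemma keys_tens:
  assumes "Poly_Mapping.keys p \<subseteq> A" "Poly_Mapping.keys r \<subseteq> B"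
  shows "Poly_Mapping.keys (tens p r) \<subseteq> A \<times> B"
  unfolding tens_eq
  by (rule keys_lin_ext[OF keys_lin_ext[of B] assms(1)]) (use assms in auto)

text \<open>Both factors share the flag \<open>b\<close>: scalars move across the tensor sign, so a
  linear map cannot be tensored with an antilinear one.\<close>

definition tensor_map ::
  "bool \<Rightarrow> ('x list \<Rightarrow> ('y list \<Rightarrow>\<^sub>0 complex)) \<Rightarrow> ('z list \<Rightarrow> ('u list \<Rightarrow>\<^sub>0 complex))
     \<Rightarrow> ('x list \<times> 'z list \<Rightarrow>\<^sub>0 complex) \<Rightarrow> ('y list \<times> 'u list \<Rightarrow>\<^sub>0 complex)" where
  "tensor_map b F G = lin_ext b (\<lambda>(v, w). tens (F v) (G w))"

lemma tensor_map_tens: "tensor_map b F G (tens p r) = tens (lin_ext b F p) (lin_ext b G r)"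
proof (rule poly_mapping_single_induct[of p UNIV])
  fix v c
  show "tensor_map b F G (tens (Poly_Mapping.single v c) r)
    = tens (lin_ext b F (Poly_Mapping.single v c)) (lin_ext b G r)"
    by (rule poly_mapping_single_induct[of r UNIV])
      (auto simp: tensor_map_def tens_single lin_ext_add tens_add_right tens_cst_left tens_cst_right
        cst_cst_mult mult.commute[where 'a = complex])
qed (auto simp: tensor_map_def lin_ext_add tens_add_left)

lemma additive_tensor_map: "additive (tensor_map b F G)"
  by (simp add: tensor_map_def lin_ext_additive)

lemma tensor_map_mult:
  assumes "\<And>m n. F (m + n) = (if a then F n * F m else F m * F n)"
    and "\<And>m n. G (m + n) = (if a then G n * G m else G m * G n)"
  shows "tensor_map b F G (p * r)
    = (if a then tensor_map b F G r * tensor_map b F G p else tensor_map b F G p * tensor_map b F G r)"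
  unfolding tensor_map_def
  by (rule lin_ext_mult) (auto simp: assms tens_mult split: prod.split)

section \<open>Ideals and quotients of monoid algebras\<close>

lemma monoid_alg_simps [simp]:
  "carrier (monoid_alg M) = {p. Poly_Mapping.keys p \<subseteq> M}"
  "x \<otimes>\<^bsub>monoid_alg M\<^esub> y = x * y" "x \<oplus>\<^bsub>monoid_alg M\<^esub> y = x + y"
  "\<one>\<^bsub>monoid_alg M\<^esub> = 1" "\<zero>\<^bsub>monoid_alg M\<^esub> = 0"
  by (simp_all add: monoid_alg_def ring_of_type_algebra_def)

definition cls :: "'m::monoid_add set \<Rightarrow> ('m \<Rightarrow>\<^sub>0 complex) set \<Rightarrow> ('m \<Rightarrow>\<^sub>0 complex) \<Rightarrow> ('m \<Rightarrow>\<^sub>0 complex) set" where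
  "cls M I x = I +>\<^bsub>monoid_alg M\<^esub> x"

lemma cls_eq: "cls M I x = (\<lambda>i. i + x) ` I"
  by (auto simp: cls_def a_r_coset_def r_coset_def)

text \<open>The type contains the full monoid algebra; the algebra on \<open>M\<close> is cut out by
  supports. Closure of the carrier is therefore a statement about \<open>keys\<close>, and
  subtraction can be that of the type.\<close>

locale submonoid_alg =
  fixes M :: "'m::monoid_add set"
  assumes zero_mem: "0 \<in> M" and add_mem: "x \<in> M \<Longrightarrow> y \<in> M \<Longrightarrow> x + y \<in> M"
begin

abbreviation "R \<equiv> monoid_alg M"

lemma keys_add_subset: "Poly_Mapping.keys x \<subseteq> M \<Longrightarrow> Poly_Mapping.keys y \<subseteq> M \<Longrightarrow> Poly_Mapping.keys (x + y) \<subseteq> M"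
  using keys_add[of x y] by auto

lemma keys_mult_subset: "Poly_Mapping.keys x \<subseteq> M \<Longrightarrow> Poly_Mapping.keys y \<subseteq> M \<Longrightarrow> Poly_Mapping.keys (x * y) \<subseteq> M"
  using keys_mult[of x y] add_mem by blast

lemma keys_uminus_subset: "Poly_Mapping.keys (- x) \<subseteq> M \<longleftrightarrow> Poly_Mapping.keys (x :: 'm \<Rightarrow>\<^sub>0 complex) \<subseteq> M"
  by (auto simp: in_keys_iff)

lemma keys_diff_subset:
  "Poly_Mapping.keys x \<subseteq> M \<Longrightarrow> Poly_Mapping.keys (y :: 'm \<Rightarrow>\<^sub>0 complex) \<subseteq> M \<Longrightarrow> Poly_Mapping.keys (x - y) \<subseteq> M"
  using keys_add_subset[of x "- y"] by (simp add: keys_uminus_subset)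

lemma keys_cst_subset: "Poly_Mapping.keys (cst c) \<subseteq> M"
  using zero_mem by (simp add: cst_def)

lemma keys_one_subset: "Poly_Mapping.keys (1 :: 'm \<Rightarrow>\<^sub>0 complex) \<subseteq> M"
  using zero_mem by simp

lemma keys_sum_subset: "(\<And>i. i \<in> I \<Longrightarrow> Poly_Mapping.keys (f i) \<subseteq> M) \<Longrightarrow> Poly_Mapping.keys (\<Sum>i\<in>I. f i) \<subseteq> M"
  by (induction I rule: infinite_finite_induct) (simp_all add: keys_add_subset)

lemma ring_monoid_alg: "ring R"
proof (rule ringI)
  show "abelian_group R"
  proof (rule abelian_groupI)
    fix x assume "x \<in> carrier R"
    then show "\<exists>y\<in>carrier R. y \<oplus>\<^bsub>R\<^esub> x = \<zero>\<^bsub>R\<^esub>"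
      by (intro bexI[of _ "- x"]) (auto simp: keys_uminus_subset)
  qed (simp_all add: keys_add_subset add_ac zero_mem)
  show "Group.monoid R"
    by (rule monoidI) (simp_all add: keys_mult_subset keys_one_subset mult.assoc zero_mem)
qed (auto simp: algebra_simps)

sublocale ring R by (rule ring_monoid_alg)

lemma a_inv_eq: "x \<in> carrier R \<Longrightarrow> \<ominus>\<^bsub>R\<^esub> x = - x"
  by (rule minus_equality) (auto simp: keys_uminus_subset)

text \<open>The generated ideal consists of finite sums of products a g b. To avoid handling such
  sums, \<open>J\<close> is the intersection of all predicates closed under the three rules; it is
  an ideal containing \<open>G\<close>, hence contains the generated one.\<close>

lemma genideal_induct [consumes 2, case_names zero add gen]:
  assumes "x \<in> Idl\<^bsub>R\<^esub> G" "G \<subseteq> carrier R"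
    and "P 0"
    and "\<And>x y. P x \<Longrightarrow> P y \<Longrightarrow> P (x + y)"
    and "\<And>a g b. Poly_Mapping.keys a \<subseteq> M \<Longrightarrow> g \<in> G \<Longrightarrow> Poly_Mapping.keys b \<subseteq> M \<Longrightarrow> P (a * g * b)"
  shows "P x"
proof -
  define adm where "adm Q \<longleftrightarrow> Q 0 \<and> (\<forall>x y. Q x \<longrightarrow> Q y \<longrightarrow> Q (x + y)) \<and>
    (\<forall>a g b. Poly_Mapping.keys a \<subseteq> M \<longrightarrow> g \<in> G \<longrightarrow> Poly_Mapping.keys b \<subseteq> M \<longrightarrow> Q (a * g * b))"
    for Q :: "('m \<Rightarrow>\<^sub>0 complex) \<Rightarrow> bool"
  define J where "J = {x. \<forall>Q. adm Q \<longrightarrow> Q x}"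
  have J_0: "0 \<in> J" by (simp add: J_def adm_def)
  have J_add: "x + y \<in> J" if "x \<in> J" "y \<in> J" for x y
    unfolding J_def
  proof (intro CollectI allI impI)
    fix Q assume Q: "adm Q"
    then have "Q x" "Q y" using that unfolding J_def by blast+
    then show "Q (x + y)" using Q by (simp add: adm_def)
  qed
  have J_mult: "c * x * d \<in> J" if x: "x \<in> J" and cd: "Poly_Mapping.keys c \<subseteq> M" "Poly_Mapping.keys d \<subseteq> M" for c x d
  proof -
    \<comment> \<open>Multiplication by \<open>c\<close> and \<open>d\<close> is absorbed in the
      outer factors of a g b, so the translated predicate is again admissible.\<close>
    have "adm (\<lambda>x. Q (c * x * d))" if Q: "adm Q" for Q
      unfolding adm_def
    proof (intro conjI allI impI)
      fix a g b :: "'m \<Rightarrow>\<^sub>0 complex" assume *: "Poly_Mapping.keys a \<subseteq> M" "g \<in> G" "Poly_Mapping.keys b \<subseteq> M"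
      have "Q ((c * a) * g * (b * d))"
        using Q * cd by (simp add: adm_def keys_mult_subset)
      then show "Q (c * (a * g * b) * d)" by (simp add: mult.assoc)
    qed (use Q in \<open>auto simp: adm_def algebra_simps\<close>)
    then show ?thesis using x unfolding J_def by blast
  qed
  have J_sub: "J \<subseteq> carrier R"
  proof
    fix x assume "x \<in> J"
    moreover have "adm (\<lambda>x. x \<in> carrier R)"
      using assms(2) by (simp add: adm_def keys_add_subset keys_mult_subset subset_eq[of G])
    ultimately show "x \<in> carrier R" unfolding J_def by blast
  qed
  have "ideal J R"
  proof (rule idealI)
    show "ring R" by (rule ring_monoid_alg)
    show "subgroup J (add_monoid R)"
    proof (rule group.subgroupI)
      show "Group.group (add_monoid R)" by (rule a_group)
      fix a assume a: "a \<in> J"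
      have "- 1 * a * 1 \<in> J"
        using a by (rule J_mult) (auto simp: keys_uminus_subset zero_mem)
      then have "\<ominus>\<^bsub>R\<^esub> a \<in> J"
        using a J_sub by (auto simp: a_inv_eq)
      then show "inv\<^bsub>add_monoid R\<^esub> a \<in> J" by (simp add: a_inv_def)
    qed (use J_sub J_0 J_add in auto)
    fix a x assume "a \<in> J" "x \<in> carrier R"
    then show "x \<otimes>\<^bsub>R\<^esub> a \<in> J" "a \<otimes>\<^bsub>R\<^esub> x \<in> J"
      using J_mult[of a x 1] J_mult[of a 1 x] zero_mem by auto
  qed
  moreover have "G \<subseteq> J"
  proof
    fix g assume "g \<in> G"
    then have "Q (1 * g * 1)" if "adm Q" for Q
      using that keys_one_subset unfolding adm_def by blast
    then have "Q g" if "adm Q" for Q using that by simp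
    then show "g \<in> J" unfolding J_def by blast
  qed
  ultimately have "x \<in> J"
    using assms(1) by (auto simp: genideal_def)
  moreover have "adm P"
    using assms(3-5) by (simp add: adm_def)
  ultimately show ?thesis unfolding J_def by blast
qed

end

locale monoid_alg_ideal = submonoid_alg M + ideal I "monoid_alg M" for M :: "'m::monoid_add set" and I
begin

lemma mem_carrier: "x \<in> I \<Longrightarrow> Poly_Mapping.keys x \<subseteq> M"
  using a_Hcarr by auto

lemma zero_mem_ideal: "0 \<in> I"
  using additive_subgroup.zero_closed[OF is_additive_subgroup] by simp

lemma add_mem_ideal: "x \<in> I \<Longrightarrow> y \<in> I \<Longrightarrow> x + y \<in> I"
  using additive_subgroup.a_closed[OF is_additive_subgroup] by simp

lemma mult_left_mem_ideal: "x \<in> I \<Longrightarrow> Poly_Mapping.keys a \<subseteq> M \<Longrightarrow> a * x \<in> I"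
  using I_l_closed[of x a] by simp

lemma mult_right_mem_ideal: "x \<in> I \<Longrightarrow> Poly_Mapping.keys a \<subseteq> M \<Longrightarrow> x * a \<in> I"
  using I_r_closed[of x a] by simp

lemma cst_mult_mem_ideal: "x \<in> I \<Longrightarrow> cst c * x \<in> I"
  by (rule mult_left_mem_ideal[OF _ keys_cst_subset])

lemma uminus_mem_ideal: "x \<in> I \<Longrightarrow> - x \<in> I"
  using cst_mult_mem_ideal[of x "- 1"] by (simp add: cst_uminus)

lemma diff_mem_ideal: "x \<in> I \<Longrightarrow> y \<in> I \<Longrightarrow> x - y \<in> I"
  using add_mem_ideal[of x "- y"] uminus_mem_ideal by simp

lemma sum_mem_ideal: "(\<And>i. i \<in> K \<Longrightarrow> f i \<in> I) \<Longrightarrow> (\<Sum>i\<in>K. f i) \<in> I"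
  by (induction K rule: infinite_finite_induct) (auto intro: zero_mem_ideal add_mem_ideal)

lemma mem_cls_iff: "y \<in> cls M I x \<longleftrightarrow> y - x \<in> I"
  by (force simp: cls_eq image_iff)

lemma cls_eq_iff: "cls M I x = cls M I y \<longleftrightarrow> x - y \<in> I"
proof
  assume "cls M I x = cls M I y"
  moreover have "x \<in> cls M I x" by (simp add: mem_cls_iff zero_mem_ideal)
  ultimately show "x - y \<in> I" by (simp add: mem_cls_iff)
next
  assume *: "x - y \<in> I"
  have "z - x \<in> I \<longleftrightarrow> z - y \<in> I" for z
    using add_mem_ideal[OF _ *, of "z - x"] diff_mem_ideal[OF _ *, of "z - y"] by auto
  then show "cls M I x = cls M I y" by (auto simp: mem_cls_iff)
qed

lemma carrier_Quot: "carrier (R Quot I) = cls M I ` carrier R"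
  by (auto simp: FactRing_def A_RCOSETS_def RCOSETS_def cls_def a_r_coset_def)

lemma Quot_zero: "\<zero>\<^bsub>R Quot I\<^esub> = cls M I 0"
  by (simp add: FactRing_def cls_eq)

lemma Quot_add: "x \<in> carrier R \<Longrightarrow> y \<in> carrier R \<Longrightarrow> cls M I x \<oplus>\<^bsub>R Quot I\<^esub> cls M I y = cls M I (x + y)"
  using a_rcos_sum[of x y] by (simp add: FactRing_def cls_def)

lemma Quot_mult: "x \<in> carrier R \<Longrightarrow> y \<in> carrier R \<Longrightarrow> cls M I x \<otimes>\<^bsub>R Quot I\<^esub> cls M I y = cls M I (x * y)"
  using rcoset_mult_add[of x y] by (simp add: FactRing_def cls_def)

lemma Quot_finsum:
  fixes f :: "'k \<Rightarrow> ('m \<Rightarrow>\<^sub>0 complex)"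
  assumes "finite K" "\<And>i. i \<in> K \<Longrightarrow> f i \<in> carrier R"
  shows "(\<Oplus>\<^bsub>R Quot I\<^esub>i\<in>K. cls M I (f i)) = cls M I (\<Sum>i\<in>K. f i)"
proof -
  interpret Q: ring "R Quot I" by (rule quotient_is_ring)
  show ?thesis
    using assms
  proof (induction rule: finite_induct)
    case (insert k K)
    have sub: "Poly_Mapping.keys (\<Sum>i\<in>K. f i) \<subseteq> M"
      using insert.prems by (intro keys_sum_subset) auto
    have "(\<Oplus>\<^bsub>R Quot I\<^esub>i\<in>insert k K. cls M I (f i)) = cls M I (f k) \<oplus>\<^bsub>R Quot I\<^esub> (\<Oplus>\<^bsub>R Quot I\<^esub>i\<in>K. cls M I (f i))"
      by (rule Q.finsum_insert) (use insert in \<open>auto simp: carrier_Quot\<close>)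
    also have "(\<Oplus>\<^bsub>R Quot I\<^esub>i\<in>K. cls M I (f i)) = cls M I (\<Sum>i\<in>K. f i)"
      using insert by simp
    finally show ?case
      using insert.prems sub insert.hyps by (simp add: Quot_add)
  qed (simp add: Quot_zero)
qed

text \<open>A map out of a coset given by \<open>the_elem\<close> has the expected value once it is
  constant there. Members y of the coset of \<open>x\<close> have support in \<open>M\<close>
  because y = (y - x) + x.\<close>

lemma the_elem_image_cls:
  assumes "\<And>y. y - x \<in> I \<Longrightarrow> Poly_Mapping.keys y \<subseteq> M \<Longrightarrow> g y = g x" "Poly_Mapping.keys x \<subseteq> M"
  shows "the_elem (g ` cls M I x) = g x"
proof -
  have eq: "g y = g x" if "y \<in> cls M I x" for y
  proof (rule assms(1))
    show "y - x \<in> I" using that by (simp only: mem_cls_iff)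
    then show "Poly_Mapping.keys y \<subseteq> M"
      using keys_add_subset[OF mem_carrier assms(2), of "y - x"] by simp
  qed
  have "x \<in> cls M I x" by (simp add: mem_cls_iff zero_mem_ideal)
  then have "(\<lambda>_. g x) ` cls M I x = {g x}" by (rule image_constant)
  also have "(\<lambda>_. g x) ` cls M I x = g ` cls M I x" using eq by (intro image_cong) simp_all
  finally have "g ` cls M I x = {g x}" .
  then show ?thesis by simp
qed

end

lemma induced_cls:
  assumes "monoid_alg_ideal M I" "monoid_alg_ideal M' J" "additive f" "\<And>x. x \<in> I \<Longrightarrow> f x \<in> J"
    and "Poly_Mapping.keys x \<subseteq> M"
  shows "induced (monoid_alg M') J f (cls M I x) = cls M' J (f x)"
proof -
  interpret I: monoid_alg_ideal M I by fact
  interpret J: monoid_alg_ideal M' J by fact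
  show ?thesis
    unfolding induced_def cls_def[of M', symmetric]
  proof (rule I.the_elem_image_cls)
    fix y assume "y - x \<in> I"
    then have "f y - f x \<in> J" using assms(4)[of "y - x"] by (simp only: additive.diff[OF assms(3)])
    then show "cls M' J (f y) = cls M' J (f x)" by (simp only: J.cls_eq_iff)
  qed (rule assms(5))
qed

text \<open>A product a g b goes to the product of the images in the same or the reverse order, in
  both cases a multiple of the image of a generator. The descent of the structure maps rests on
  this.\<close>

lemma genideal_image:
  assumes "submonoid_alg M" "monoid_alg_ideal M' J" "additive f" "G \<subseteq> carrier (monoid_alg M)"
    and "\<And>x y. f (x * y) = (if a then f y * f x else f x * f y)"
    and "\<And>x. Poly_Mapping.keys x \<subseteq> M \<Longrightarrow> Poly_Mapping.keys (f x) \<subseteq> M'"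
    and "\<And>g. g \<in> G \<Longrightarrow> f g \<in> J"
    and "x \<in> Idl\<^bsub>monoid_alg M\<^esub> G"
  shows "f x \<in> J"
proof -
  interpret submonoid_alg M by fact
  interpret J: monoid_alg_ideal M' J by fact
  show ?thesis
    using assms(8,4)
  proof (induction rule: genideal_induct)
    case zero
    then show ?case by (simp add: additive.zero[OF assms(3)] J.zero_mem_ideal)
  next
    case (add x y)
    then show ?case by (simp add: additive.add[OF assms(3)] J.add_mem_ideal)
  next
    case (gen c g d)
    then show ?case
      by (simp add: assms J.mult_left_mem_ideal J.mult_right_mem_ideal)
  qed
qed

lemma submonoid_lists: "submonoid_alg (lists A)"
  by standard (auto simp: zero_list_eq plus_list_eq)

lemma submonoid_lists_Times: "submonoid_alg (lists A \<times> lists B)"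
  by standard (auto simp: zero_list_eq plus_list_eq zero_prod_def)

lemma monoid_alg_idealI:
  assumes "submonoid_alg M" "G \<subseteq> carrier (monoid_alg M)"
  shows "monoid_alg_ideal M (Idl\<^bsub>monoid_alg M\<^esub> G)"
proof -
  interpret submonoid_alg M by fact
  show ?thesis
    using genideal_ideal[OF assms(2)] assms(1) by (simp add: monoid_alg_ideal_def)
qed

lemma genideal_mem:
  assumes "submonoid_alg M" "G \<subseteq> carrier (monoid_alg M)" "g \<in> G"
  shows "g \<in> Idl\<^bsub>monoid_alg M\<^esub> G"
  using submonoid_alg.ring_monoid_alg[OF assms(1)] ring.genideal_self assms(2,3) by blast

section \<open>Symmetries of the numerical data\<close>

lemma pri_less: "a < N \<Longrightarrow> pri N a < N"
  by (simp add: pri_def)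

lemma pri_pri: "a < N \<Longrightarrow> pri N (pri N a) = a"
  by (simp add: pri_def)

lemma pri_eq_iff: "a < N \<Longrightarrow> b < N \<Longrightarrow> pri N a = pri N b \<longleftrightarrow> a = b"
  by (auto simp: pri_def)

lemma pri_less_iff: "a < N \<Longrightarrow> b < N \<Longrightarrow> pri N a < pri N b \<longleftrightarrow> b < a"
  by (auto simp: pri_def)

lemma eq_pri_iff: "a < N \<Longrightarrow> b < N \<Longrightarrow> a = pri N b \<longleftrightarrow> b = pri N a"
  by (auto simp: pri_def)

lemma rho2_pri: "a < N \<Longrightarrow> rho2 N (pri N a) = - rho2 N a"
  by (auto simp: rho2_def pri_def)

lemma dim_metric [simp]: "dim_row (metric N h) = N" "dim_col (metric N h) = N"
  by (simp_all add: metric_def)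

lemma metric_nth:
  "a < N \<Longrightarrow> b < N \<Longrightarrow> metric N h $$ (a, b) = (if b = pri N a then h powi (- rho2 N a) else 0)"
  by (auto simp: metric_def pri_def)

lemma sum_metric_right:
  fixes f :: "nat \<Rightarrow> 'b::comm_monoid_add"
  assumes "a < N" "\<And>b. b < N \<Longrightarrow> b \<noteq> pri N a \<Longrightarrow> f b = 0"
  shows "(\<Sum>b<N. f b) = f (pri N a)"
  using assms pri_less[of a N] by (subst sum.remove[of _ "pri N a"]) (auto intro!: sum.neutral)


section \<open>Entries of the R-matrix and their symmetries\<close>

lemma Rm_diag:
  "Rm N h a b a b = (if b = a then (if a = pri N a then 1 else h\<^sup>2) else if b = pri N a then inverse (h\<^sup>2) else 1)"
  by (simp add: Rm_def Let_def)

lemma Rm_swap: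
  assumes "a \<noteq> b" "a < N" "b < N"
  shows "Rm N h a b b a = (if b < a then (h\<^sup>2 - inverse (h\<^sup>2)) *
    (if b = pri N a then 1 - h powi (2 * rho2 N a) else 1) else 0)"
  using assms by (simp add: Rm_def Let_def rho2_pri)

lemma Rm_cross:
  assumes "a \<noteq> c" "c \<noteq> pri N a"
  shows "Rm N h a (pri N a) c (pri N c)
    = (if c < a then - (h\<^sup>2 - inverse (h\<^sup>2)) * h powi (rho2 N a - rho2 N c) else 0)"
  using assms by (simp add: Rm_def Let_def)

lemma Rm_eq_0:
  assumes "\<not> (c = a \<and> d = b)" "\<not> (c = b \<and> d = a)" "\<not> (b = pri N a \<and> d = pri N c)"
  shows "Rm N h a b c d = 0"
proof -
  have "(c = a \<and> d = b) = False" "(c = b \<and> d = a \<and> b < a) = False"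
    "(b = pri N a \<and> d = pri N c \<and> c < a \<and> c \<noteq> pri N a) = False"
    using assms by blast+
  then show ?thesis unfolding Rm_def Let_def by (simp only: if_False)
qed

text \<open>The three shapes of nonzero entries. The case \<open>cross\<close> leaves out c = a and
  c = a', where the entry is already diagonal or swapped.\<close>

lemma Rm_index_cases [consumes 4, case_names diag swap cross zero]:
  assumes "a < N" "b < N" "c < N" "d < N"
  obtains (diag) "c = a" "d = b"
  | (swap) "a \<noteq> b" "c = b" "d = a"
  | (cross) "b = pri N a" "d = pri N c" "c \<noteq> a" "c \<noteq> pri N a" "pri N a \<noteq> c"
  | (zero) "\<not> (c = a \<and> d = b)" "\<not> (c = b \<and> d = a)" "\<not> (b = pri N a \<and> d = pri N c)"
proof (cases "c = a \<and> d = b \<or> c = b \<and> d = a \<or> \<not> (b = pri N a \<and> d = pri N c)")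
  case True
  then show thesis using diag swap zero by blast
next
  case False
  then have "c \<noteq> a" "c \<noteq> pri N a" using assms by (auto simp: pri_pri)
  with False cross show thesis by metis
qed

text \<open>Priming reverses the order of indices and negates \<rho>; exchanging the two tensor
  factors restores the inequality and the exponent of each entry.\<close>

lemma Rm_pri:
  assumes "a < N" "b < N" "c < N" "d < N"
  shows "Rm N h (pri N b) (pri N a) (pri N d) (pri N c) = Rm N h a b c d"
  using assms
proof (cases rule: Rm_index_cases)
  case diag
  then show ?thesis using assms by (auto simp: Rm_diag pri_eq_iff pri_pri)
next
  case swap
  then show ?thesis using assms
    by (auto simp: Rm_swap pri_eq_iff pri_pri pri_less pri_less_iff rho2_pri)
next
  case cross
  then show ?thesis using assms by (simp add: pri_pri Rm_cross)
next
  case zero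
  then show ?thesis using assms
    by (subst (1 2) Rm_eq_0) (auto simp: pri_eq_iff pri_pri)
qed

text \<open>In the cross entries the order reversal by priming and \<rho>_{a'} = -\<rho>_a
  compensate the exchange of upper and lower indices. This is the known identity R^t = R_21.\<close>

lemma Rm_transpose:
  assumes "a < N" "b < N" "c < N" "d < N"
  shows "Rm N h d c b a = Rm N h a b c d"
  using assms
proof (cases rule: Rm_index_cases)
  case diag
  then show ?thesis using assms by (auto simp: Rm_diag pri_eq_iff pri_pri)
next
  case swap
  then show ?thesis by simp
next
  case cross
  then have "pri N c \<noteq> pri N a" "pri N a \<noteq> pri N (pri N c)" using assms by (auto simp: pri_eq_iff pri_pri)
  with Rm_cross[of "pri N c" "pri N a" N h] show ?thesis using assms cross
    by (simp add: pri_pri Rm_cross pri_less_iff rho2_pri)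
next
  case zero
  then show ?thesis
    by (subst (1 2) Rm_eq_0) (use assms in \<open>auto simp: pri_eq_iff pri_pri\<close>)
qed

lemma powi_double: "(x::complex) powi (2 * k) = x\<^sup>2 powi k"
  by (simp add: power_int_mult)

lemma cnj_powi: "cnj (h powi k) = cnj h powi k"
  by (simp add: power_int_def)

text \<open>For odd N the root \<open>h\<close> itself is real. For even N it may be imaginary, but
  2\<rho>_a is even and only powers of q occur.\<close>

lemma cnj_powi_rho2:
  assumes "h \<in> q_roots_real N"
  shows "cnj (h powi rho2 N a) = h powi rho2 N a"
proof (cases "odd N")
  case True
  then have "h \<in> \<real>" using assms by (auto simp: q_roots_real_def q_roots_def)
  then show ?thesis by (simp add: cnj_powi Reals_cnj_iff)
next
  case False
  then have "even (rho2 N a)" by (auto simp: rho2_def)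
  then obtain k where k: "rho2 N a = 2 * k" by (elim evenE)
  have "h\<^sup>2 \<in> \<real>" using assms by (auto simp: q_roots_real_def)
  then have "cnj (h\<^sup>2) = h\<^sup>2" by (simp only: Reals_cnj_iff)
  then show ?thesis by (simp only: k powi_double cnj_powi)
qed

lemma q_roots_nonzero: "h \<in> q_roots N \<Longrightarrow> h \<noteq> 0"
  by (simp add: q_roots_def)

lemma q_roots_real_subset: "h \<in> q_roots_real N \<Longrightarrow> h \<in> q_roots N"
  by (simp add: q_roots_real_def)

lemma q_roots_unit_subset: "h \<in> q_roots_unit N \<Longrightarrow> h \<in> q_roots N"
  by (simp add: q_roots_unit_def)

lemma cnj_q_real: "h \<in> q_roots_real N \<Longrightarrow> cnj (h\<^sup>2) = h\<^sup>2"
  by (simp add: q_roots_real_def Reals_cnj_iff)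

lemma cnj_q_unit: "h \<in> q_roots_unit N \<Longrightarrow> cnj h = inverse h"
proof -
  assume "h \<in> q_roots_unit N"
  then have "(cmod h)\<^sup>2 = 1"
    by (simp add: q_roots_unit_def norm_power)
  then have "cmod h = 1"
    using norm_ge_zero[of h] by (auto simp: power2_eq_1_iff)
  then show ?thesis
    by (metis complex_norm_square inverse_unique of_real_1 one_power2)
qed

lemma cnj_Rm_real:
  assumes "h \<in> q_roots_real N" "a < N" "b < N" "c < N" "d < N"
  shows "cnj (Rm N h a b c d) = Rm N h a b c d"
proof -
  note h = cnj_powi_rho2[OF assms(1)] cnj_q_real[OF assms(1), simplified]
    q_roots_nonzero[OF q_roots_real_subset[OF assms(1)]]
  show ?thesis
    using assms(2-5)
  proof (cases rule: Rm_index_cases)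
    case swap
    have "cnj (h powi (2 * rho2 N a)) = h powi (2 * rho2 N a)"
      using h by (simp add: powi_double cnj_powi)
    with swap h show ?thesis using assms by (simp add: Rm_swap)
  next
    case zero
    then show ?thesis by (simp add: Rm_eq_0)
  qed (use h assms in \<open>auto simp: Rm_diag Rm_cross power_int_diff\<close>)
qed


lemma cnj_metric_real:
  assumes "h \<in> q_roots_real N" "a < N" "b < N"
  shows "cnj (metric N h $$ (a, b)) = metric N h $$ (a, b)"
  using cnj_powi_rho2[OF assms(1), of a] assms(2,3)
  by (simp add: metric_nth power_int_minus)

lemma metric_pri:
  assumes "a < N" "b < N"
  shows "metric N h $$ (pri N b, pri N a) = metric N h $$ (a, b)"
  using assms by (auto simp: metric_nth pri_pri pri_less pri_eq_iff rho2_pri)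

text \<open>Conjugation inverts \<open>h\<close>, and \<rho>_{a'} = -\<rho>_a turns the inverted
  antidiagonal entry into the transposed one.\<close>

lemma cnj_metric_unit:
  assumes "h \<in> q_roots_unit N" "a < N" "b < N"
  shows "cnj (metric N h $$ (a, b)) = metric N h $$ (b, a)"
  using cnj_q_unit[OF assms(1)] assms(2,3)
  by (auto simp: metric_nth pri_pri pri_less rho2_pri cnj_powi power_int_inverse power_int_minus)

lemma powi_add_nonzero: "h \<in> q_roots N \<Longrightarrow> h powi (k + l) = h powi k * h powi l"
  by (simp add: power_int_add q_roots_nonzero)

text \<open>
  For \<open>|q| = 1\<close> conjugation replaces \<open>R\<close> by \<open>R\<^sup>-\<^sup>1\<close>, which differs from \<open>R\<^sub>2\<^sub>1\<close> by the
  permutation operator and a rank one term.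
\<close>

lemma cnj_Rm_unit:
  assumes "h \<in> q_roots_unit N" "a < N" "b < N" "c < N" "d < N"
  shows "cnj (Rm N h a b c d) = Rm N h b a d c - (h\<^sup>2 - inverse (h\<^sup>2)) *
    ((if a = d \<and> b = c then 1 else 0) - metric N h $$ (a, b) * metric N h $$ (d, c))"
proof -
  note q = q_roots_unit_subset[OF assms(1)]
  note [simp] = cnj_q_unit[OF assms(1)] q_roots_nonzero[OF q]
  have cnj_powi': "cnj (h powi k) = h powi (- k)" for k
    by (simp add: cnj_powi power_int_inverse power_int_minus)
  show ?thesis
    using assms(2-5)
  proof (cases rule: Rm_index_cases)
    \<comment> \<open>For a = b the flip term turns q into its inverse, for b = a' the rank one term
      turns q^{-1} into q, and at the middle index of odd N the two cancel.\<close>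
    case diag
    have iff: "a = pri N b \<longleftrightarrow> b = pri N a"
      using assms(2,3) by (rule eq_pri_iff)
    have mm: "metric N h $$ (a, b) * metric N h $$ (b, a) = (if b = pri N a then 1 else 0)"
      using assms(2) unfolding metric_nth[OF assms(2,3)] metric_nth[OF assms(3,2)] iff
      by (auto simp: rho2_pri power_int_minus)
    have "Rm N h b a b a = Rm N h a b a b"
      unfolding Rm_diag iff by auto
    then show ?thesis
      unfolding diag mm by (simp add: Rm_diag power_inverse)
  next
    case swap
    define p where "p = h powi rho2 N a"
    have p: "h powi (2 * rho2 N a) = p * p" "h powi (2 * rho2 N (pri N a)) = inverse (p * p)"
      using assms(2) powi_add_nonzero[OF q, of "rho2 N a" "rho2 N a"]
      by (simp_all add: p_def rho2_pri power_int_minus)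
    have mm: "metric N h $$ (a, b) * metric N h $$ (a, b) = (if b = pri N a then inverse (p * p) else 0)"
      using assms(2,3) by (simp add: metric_nth p_def power_int_minus)
    have cp: "cnj p = inverse p"
      unfolding p_def cnj_powi' power_int_minus ..
    have iff: "a = pri N b \<longleftrightarrow> b = pri N a"
      using assms(2,3) by (rule eq_pri_iff)
    have L: "Rm N h a b b a = (if b < a then (h\<^sup>2 - inverse (h\<^sup>2)) *
        (if b = pri N a then 1 - p * p else 1) else 0)"
      unfolding Rm_swap[OF swap(1) assms(2,3)] p ..
    have R: "Rm N h b a a b = (if a < b then (h\<^sup>2 - inverse (h\<^sup>2)) *
        (if b = pri N a then 1 - inverse (p * p) else 1) else 0)"
      unfolding Rm_swap[OF swap(1)[symmetric] assms(3,2)] iff using p(2) by simp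
    have "a < b \<longleftrightarrow> \<not> b < a" using swap(1) by auto
    then show ?thesis
      unfolding swap(2,3) L R mm
      by (cases "b < a"; cases "b = pri N a") (simp_all add: cp power_inverse algebra_simps)
  next
    case cross
    then have ne: "pri N c \<noteq> pri N a" "pri N a \<noteq> pri N (pri N c)" "pri N c \<noteq> a"
      using assms by (auto simp: pri_eq_iff pri_pri)
    have "Rm N h b a d c = (if a < c then - (h\<^sup>2 - inverse (h\<^sup>2)) * h powi (rho2 N c - rho2 N a) else 0)"
      using Rm_cross[of "pri N a" "pri N c" N h] cross ne assms
      by (auto simp: pri_pri rho2_pri pri_less_iff)
    moreover have "metric N h $$ (a, b) * metric N h $$ (d, c) = h powi (rho2 N c - rho2 N a)"
      using assms(2-5) cross powi_add_nonzero[OF q, of "- rho2 N a" "rho2 N c"]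
      by (simp add: metric_nth pri_pri rho2_pri)
    moreover have "cnj (Rm N h a b c d) = (if c < a then (h\<^sup>2 - inverse (h\<^sup>2)) * h powi (rho2 N c - rho2 N a) else 0)"
      using cnj_powi'[of "rho2 N a - rho2 N c"] cross by (simp add: Rm_cross power_inverse algebra_simps)
    moreover have "\<not> (a = d \<and> b = c)"
      using cross by auto
    ultimately show ?thesis using cross
      by (cases "a < c") (simp_all add: algebra_simps)
  next
    case zero
    then have "Rm N h b a d c = 0"
      using assms(2-5) by (intro Rm_eq_0) (auto simp: pri_pri)
    moreover have "metric N h $$ (a, b) * metric N h $$ (d, c) = 0"
      using zero assms(2-5) by (auto simp: metric_nth pri_pri)
    ultimately show ?thesis using zero by (auto simp: Rm_eq_0)
  qed
qed

text \<open>A nonzero entry either permutes its two indices or leads from a pair (a, a') to a pair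
  (c, c'), and all such pairs have total weight 1. This is the invariance of \<open>R\<close> under
  the diagonal torus of the orthogonal group.\<close>

lemma Rm_weight:
  fixes u :: "nat \<Rightarrow> complex"
  assumes "\<And>a. a < N \<Longrightarrow> u a * u (pri N a) = 1" "a < N" "b < N" "c < N" "d < N"
  shows "Rm N h a b c d * (u a * u b) = Rm N h a b c d * (u c * u d)"
  using assms(2-5)
  by (cases rule: Rm_index_cases) (use assms in \<open>auto simp: Rm_eq_0\<close>)

subsection \<open>The trace of the squared metric\<close>

abbreviation metric_trace :: "nat \<Rightarrow> complex \<Rightarrow> complex" where
  "metric_trace N h \<equiv> (\<Sum>e<N. \<Sum>f<N. metric N h $$ (e, f) * metric N h $$ (e, f))"

lemma metric_trace_powi:
  "metric_trace N h = (\<Sum>e<N. h\<^sup>2 powi (- rho2 N e))"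
proof (rule sum.cong[OF refl])
  fix e assume e: "e \<in> {..<N}"
  then have "(\<Sum>f<N. metric N h $$ (e, f) * metric N h $$ (e, f))
    = metric N h $$ (e, pri N e) * metric N h $$ (e, pri N e)"
    by (intro sum_metric_right) (auto simp: metric_nth)
  also have "\<dots> = h\<^sup>2 powi (- rho2 N e)"
    using e by (simp add: metric_nth pri_less power2_eq_square power_int_mult_distrib)
  finally show "(\<Sum>f<N. metric N h $$ (e, f) * metric N h $$ (e, f)) = h\<^sup>2 powi (- rho2 N e)" .
qed

text \<open>After multiplication by q - q^{-1} the geometric sums telescope. The exponents increase
  by 2 within each half but not across the middle, whence two formulas; the extra q - q^{-1} comes
  from the second zero exponent for even N and from the middle index for odd N.\<close>

lemma metric_trace_partial:
  assumes "q \<noteq> (0 :: complex)" "m \<le> N"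
  shows "(q - inverse q) * (\<Sum>e<m. q powi (- rho2 N e)) =
    (if 2 * m \<le> N then q powi (2 * int m + 1 - int N) - q powi (1 - int N)
     else q powi (2 * int m - 1 - int N) - q powi (1 - int N) + (q - inverse q))"
  using assms(2)
proof (induction m)
  case (Suc m)
  have step: "(q - inverse q) * q powi k = q powi (k + 1) - q powi (k - 1)" for k
    using assms(1) by (simp add: power_int_add power_int_diff algebra_simps divide_inverse)
  have "(q - inverse q) * (\<Sum>e<Suc m. q powi (- rho2 N e))
    = (q - inverse q) * (\<Sum>e<m. q powi (- rho2 N e)) + (q powi (- rho2 N m + 1) - q powi (- rho2 N m - 1))"
    unfolding sum.lessThan_Suc distrib_left step ..
  also have "\<dots> = (if 2 * Suc m \<le> N then q powi (2 * int (Suc m) + 1 - int N) - q powi (1 - int N)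
     else q powi (2 * int (Suc m) - 1 - int N) - q powi (1 - int N) + (q - inverse q))"
  proof -
    consider "2 * m < N - 1" | "2 * m = N - 1" | "2 * m = N" | "2 * m > N" by linarith
    then show ?thesis
    proof cases
      case 1
      then have e: "- rho2 N m + 1 = 2 * int (Suc m) + 1 - int N" "- rho2 N m - 1 = 2 * int m + 1 - int N"
        by (auto simp: rho2_def pri_def)
      have le: "2 * m \<le> N" "2 * Suc m \<le> N" using 1 by auto
      have IH: "(q - inverse q) * (\<Sum>e<m. q powi (- rho2 N e)) = q powi (2 * int m + 1 - int N) - q powi (1 - int N)"
        using le Suc by simp
      show ?thesis unfolding IH e using le by simp
    next
      case 2
      then have e: "rho2 N m = 0" and N: "int N = 2 * int m + 1"
        using Suc.prems by (auto simp: rho2_def pri_def)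
      have IH: "(q - inverse q) * (\<Sum>e<m. q powi (- rho2 N e)) = q powi (2 * int m + 1 - int N) - q powi (1 - int N)"
        using 2 Suc by simp
      show ?thesis unfolding IH e using 2 N by (simp add: power_int_minus)
    next
      case 3
      then have e: "rho2 N m = 0" and N: "int N = 2 * int m"
        using Suc.prems by (auto simp: rho2_def pri_def)
      have IH: "(q - inverse q) * (\<Sum>e<m. q powi (- rho2 N e)) = q powi (2 * int m + 1 - int N) - q powi (1 - int N)"
        using 3 Suc by simp
      show ?thesis unfolding IH e using 3 N by (simp add: power_int_minus)
    next
      case 4
      then have e: "- rho2 N m + 1 = 2 * int (Suc m) - 1 - int N" "- rho2 N m - 1 = 2 * int m - 1 - int N"
        by (auto simp: rho2_def pri_def)
      have IH: "(q - inverse q) * (\<Sum>e<m. q powi (- rho2 N e))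
          = q powi (2 * int m - 1 - int N) - q powi (1 - int N) + (q - inverse q)"
        using 4 Suc by simp
      show ?thesis unfolding IH e using 4 by simp
    qed
  qed
  finally show ?case .
qed simp

text \<open>At x = q the left side is q - q^{-1} times \<open>metric_trace\<close>; the
  factorisation shows that it can vanish only at roots of unity.\<close>

lemma quantum_dim_factor:
  fixes x :: complex
  assumes "x \<noteq> 0" "N \<ge> 2"
  shows "x - inverse x + x powi (int N - 1) - x powi (1 - int N)
    = x powi (1 - int N) * ((x ^ N - 1) * (x ^ (N - 2) + 1))"
proof -
  define z where "z = x powi (int N - 1)"
  have z: "z \<noteq> 0" using assms(1) by (simp add: z_def)
  have "x ^ N = x powi (int N - 1 + 1)"
    by simp
  also have "\<dots> = z * x powi 1"
    unfolding z_def by (rule power_int_add) (use assms(1) in simp)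
  also have "\<dots> = z * x" by simp
  finally have xz1: "x ^ N = z * x" .
  have "int N - 1 + - 1 = int (N - 2)" using assms(2) by simp
  then have "x ^ (N - 2) = x powi (int N - 1 + - 1)"
    by (simp only: power_int_of_nat)
  also have "\<dots> = z * x powi (- 1)"
    unfolding z_def by (rule power_int_add) (use assms(1) in simp)
  also have "\<dots> = z * inverse x" by simp
  finally have xz2: "x ^ (N - 2) = z * inverse x" .
  have iz: "x powi (1 - int N) = inverse z"
    unfolding z_def power_int_minus[symmetric] by simp
  \<comment> \<open>With the inverses replaced by variables \<open>y\<close> and \<open>w\<close>
    the identity becomes polynomial modulo x y = 1 and z w = 1.\<close>
  have "w * ((z * x - 1) * (z * y + 1)) = x - y + z - w" if "x * y = 1" "z * w = 1" for x y z w :: complex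
  proof -
    have "w * ((z * x - 1) * (z * y + 1)) = (z * w) * (z * (x * y)) + (z * w) * x - (z * w) * y - w"
      by (simp only: ring_distribs mult_ac) simp
    then show ?thesis using that by simp
  qed
  moreover have "x * inverse x = 1" "z * inverse z = 1" using z assms(1) by simp_all
  ultimately have "inverse z * ((z * x - 1) * (z * inverse x + 1)) = x - inverse x + z - inverse z"
    by blast
  then show ?thesis
    unfolding xz1 xz2 iz z_def[symmetric] by (rule sym)
qed

lemma metric_trace_eq:
  assumes "h \<in> q_roots N" "N > 2"
  shows "(h\<^sup>2 - inverse (h\<^sup>2)) * metric_trace N h
      = h\<^sup>2 - inverse (h\<^sup>2) + h\<^sup>2 powi (int N - 1) - h\<^sup>2 powi (1 - int N)"
proof -
  have q: "h\<^sup>2 \<noteq> 0" using q_roots_nonzero[OF assms(1)] by simp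
  have "\<not> 2 * N \<le> N" using assms(2) by simp
  then show ?thesis
    unfolding metric_trace_powi metric_trace_partial[OF q order.refl] by simp
qed

lemma metric_trace_nonzero:
  assumes "h \<in> q_roots N" "N > 2"
  shows "metric_trace N h \<noteq> 0"
proof -
  let ?q = "h\<^sup>2"
  have q: "?q \<noteq> 0" using q_roots_nonzero[OF assms(1)] by simp
  have root: "?q ^ k \<noteq> 1" if "k > 0" for k
    using assms(1) that by (simp add: q_roots_def)
  \<comment> \<open>Otherwise q would be a root of unity of order dividing 2(N - 2), and this
    exponent is positive because N > 2.\<close>
  have "?q ^ (N - 2) \<noteq> - 1"
  proof
    assume "?q ^ (N - 2) = - 1"
    then have "?q ^ ((N - 2) * 2) = (- 1)\<^sup>2" by (simp only: power_mult)
    with root[of "(N - 2) * 2"] assms(2) show False by simp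
  qed
  then have "?q ^ (N - 2) + 1 \<noteq> 0"
    by (metis add_eq_0_iff2)
  moreover have "?q ^ N - 1 \<noteq> 0" using root[of N] assms(2) by simp
  moreover have "?q powi (1 - int N) \<noteq> 0" using q by simp
  ultimately have "?q powi (1 - int N) * ((?q ^ N - 1) * (?q ^ (N - 2) + 1)) \<noteq> 0"
    by (simp only: mult_eq_0_iff simp_thms)
  then have "(?q - inverse ?q) * metric_trace N h \<noteq> 0"
    unfolding metric_trace_eq[OF assms] using quantum_dim_factor[OF q less_imp_le[OF assms(2)]]
    by (simp only: simp_thms)
  then show ?thesis unfolding mult_eq_0_iff by blast
qed

subsection \<open>The projector onto the antisymmetric part\<close>

lemma PA_eq:
  "PA N h a b c d = inverse (h\<^sup>2 + inverse (h\<^sup>2)) *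
     (- Rm N h b a c d + h\<^sup>2 * (if a = c \<and> b = d then 1 else 0)
      - (h\<^sup>2 - h\<^sup>2 powi (1 - int N)) *
        (inverse (metric_trace N h) * metric N h $$ (a, b) * metric N h $$ (c, d)))"
  by (simp add: PA_def P0_def Rhat_def Let_def)

lemma PA_pri:
  assumes "a < N" "b < N" "c < N" "d < N"
  shows "PA N h (pri N b) (pri N a) (pri N d) (pri N c) = PA N h a b c d"
  using assms unfolding PA_eq
  by (simp add: Rm_pri metric_pri) (auto simp: pri_eq_iff)

text \<open>Each of the three summands of \<open>PA\<close> conserves weight: the braid matrix by
  \<open>Rm_weight\<close>, the identity trivially, and \<open>P0\<close> because both of its metric
  entries join indices of total weight 1.\<close>

lemma PA_weight:
  fixes u :: "nat \<Rightarrow> complex"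
  assumes u: "\<And>a. a < N \<Longrightarrow> u a * u (pri N a) = 1" and "a < N" "b < N" "c < N" "d < N"
  shows "PA N h a b c d * (u a * u b) = PA N h a b c d * (u c * u d)"
proof -
  have "Rm N h b a c d * (u a * u b) = Rm N h b a c d * (u c * u d)"
    using Rm_weight[of N u b a c d h] assms by (simp add: mult.commute[of "u b"])
  moreover have "metric N h $$ (a, b) * metric N h $$ (c, d) * (u a * u b)
      = metric N h $$ (a, b) * metric N h $$ (c, d) * (u c * u d)"
    using assms by (simp add: metric_nth)
  moreover have "(if a = c \<and> b = d then 1 else 0) * (u a * u b) = (if a = c \<and> b = d then 1 else 0) * (u c * u d)"
    by simp
  moreover have "i * (- r + y * e - w * (s * m * m')) * v = i * (- r + y * e - w * (s * m * m')) * v'"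
    if "r * v = r * v'" "m * m' * v = m * m' * v'" "e * v = e * v'" for i r y e w s m m' v v' :: complex
  proof -
    have expand: "i * (- r + y * e - w * (s * m * m')) * v = i * (- (r * v) + y * (e * v) - w * s * (m * m' * v))" for v
      by (simp add: algebra_simps)
    show ?thesis unfolding expand that ..
  qed
  ultimately show ?thesis unfolding PA_eq by blast
qed

lemma cnj_metric_trace_real:
  assumes "h \<in> q_roots_real N"
  shows "cnj (metric_trace N h) = metric_trace N h"
  unfolding cnj_sum by (intro sum.cong refl) (simp add: cnj_metric_real[OF assms])

lemma cnj_metric_trace_unit:
  assumes "h \<in> q_roots_unit N"
  shows "cnj (metric_trace N h) = metric_trace N h"
  unfolding cnj_sum by (subst sum.swap) (intro sum.cong refl, simp add: cnj_metric_unit[OF assms])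

lemma cnj_PA_real:
  assumes "h \<in> q_roots_real N" "a < N" "b < N" "c < N" "d < N"
  shows "cnj (PA N h a b c d) = PA N h a b c d"
proof -
  have "cnj (h\<^sup>2 powi k) = h\<^sup>2 powi k" for k
    using cnj_q_real[OF assms(1)] by (simp only: cnj_powi)
  then show ?thesis
    using assms cnj_q_real[OF assms(1)] cnj_metric_trace_real[OF assms(1)] unfolding PA_eq
    by (simp add: cnj_Rm_real cnj_metric_real del: complex_cnj_power)
qed

text \<open>Conjugating the braid matrix produces multiples of the identity and of the rank one
  matrix. The first corrects q^{-1} to q; the second must change q^{-1} - q^{N-1} into q - q^{1-N},
  and that is exactly what the value of (q - q^{-1}) times \<open>metric_trace\<close>
  provides.\<close>

lemma cnj_PA_unit:
  assumes "h \<in> q_roots_unit N" "N > 2" "a < N" "b < N" "c < N" "d < N"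
  shows "cnj (PA N h a b c d) = PA N h b a d c"
proof -
  note q = q_roots_unit_subset[OF assms(1)]
  define x where "x = h\<^sup>2"
  define s where "s = metric_trace N h"
  define z where "z = x powi (1 - int N)"
  define m where "m = metric N h $$ (b, a) * metric N h $$ (d, c)"
  define e where "e = (if b = d \<and> a = c then 1 else 0 :: complex)"
  have cx: "cnj x = inverse x"
    using cnj_q_unit[OF assms(1)] by (simp add: x_def power_inverse)
  have cz: "cnj z = x powi (int N - 1)"
    unfolding z_def cnj_powi cx power_int_inverse power_int_minus[symmetric] by simp
  have s: "(x - inverse x) * s = x - inverse x + x powi (int N - 1) - z"
    unfolding x_def s_def z_def by (rule metric_trace_eq[OF q assms(2)])
  have s0: "s \<noteq> 0"
    unfolding s_def by (rule metric_trace_nonzero[OF q assms(2)])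
  have R: "cnj (Rm N h b a c d) = Rm N h a b d c - (x - inverse x) * (e - m)"
    using cnj_Rm_unit[OF assms(1) assms(4,3,5,6)] by (simp add: x_def e_def m_def)
  have M: "cnj (metric N h $$ (a, b)) * cnj (metric N h $$ (c, d)) = m"
    using assms by (simp add: cnj_metric_unit m_def)
  have E: "(if a = c \<and> b = d then 1 else 0) = e"
    by (auto simp: e_def)
  have "cnj (PA N h a b c d) = inverse (x + inverse x) *
     (- (Rm N h a b d c - (x - inverse x) * (e - m)) + inverse x * e
      - (inverse x - x powi (int N - 1)) * (inverse s * m))"
    unfolding PA_eq E x_def[symmetric] s_def[symmetric] z_def[symmetric]
    using M cnj_metric_trace_unit[OF assms(1), folded s_def]
    by (simp add: R cx cz e_def mult.assoc add.commute)
  also have "- (Rm N h a b d c - (x - inverse x) * (e - m)) + inverse x * e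
      - (inverse x - x powi (int N - 1)) * (inverse s * m)
    = - Rm N h a b d c + x * e - ((x - inverse x) * m + (inverse x - x powi (int N - 1)) * (inverse s * m))"
    by (simp add: algebra_simps)
  \<comment> \<open>The rank one term is given the factor \<open>inverse s\<close> of
    \<open>P0\<close>, so that the trace formula can be inserted.\<close>
  also have "(x - inverse x) * m = (x - inverse x + x powi (int N - 1) - z) * (inverse s * m)"
    unfolding s[symmetric] using s0 by simp
  also have "\<dots> + (inverse x - x powi (int N - 1)) * (inverse s * m) = (x - z) * (inverse s * m)"
    by (simp add: algebra_simps)
  finally show ?thesis
    unfolding PA_eq m_def e_def x_def s_def z_def by (simp add: mult.assoc)
qed

subsection \<open>The diagram automorphism\<close>

text \<open>
  Conjugation by \<open>\<D>\<close> sends \<open>T\<^sup>a\<^sub>b\<close> to \<open>u\<^sub>a / u\<^sub>b\<close> times \<open>T\<close> with the indices \<open>\<tau> a\<close>, \<open>\<tau> b\<close>, where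
  \<open>\<tau>\<close> is \<open>flip_idx N\<close> and \<open>u\<close> is \<open>flip_sgn N\<close>.
\<close>

definition flip_idx :: "nat \<Rightarrow> nat \<Rightarrow> nat" where
  "flip_idx N a = (if even N then Transposition.transpose (N div 2 - 1) (N div 2) a else a)"

definition flip_sgn :: "nat \<Rightarrow> nat \<Rightarrow> complex" where
  "flip_sgn N a = (if odd N \<and> a = N div 2 then - 1 else 1)"

text \<open>For even N these two indices are the only ones that \<open>flip_idx\<close> moves, and
  the only pair whose order it changes.\<close>

definition mid :: "nat \<Rightarrow> nat \<Rightarrow> bool" where
  "mid N a \<longleftrightarrow> even N \<and> (a = N div 2 - 1 \<or> a = N div 2)"

lemma flip_idx_eq: "flip_idx N a = (if mid N a then (if a = N div 2 then N div 2 - 1 else N div 2) else a)"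
  by (auto simp: flip_idx_def mid_def transpose_def)

lemma flip_idx_less: "N > 2 \<Longrightarrow> a < N \<Longrightarrow> flip_idx N a < N"
  by (auto simp: flip_idx_eq)

lemma flip_idx_flip_idx [simp]: "flip_idx N (flip_idx N a) = a"
  by (simp add: flip_idx_def)

lemma flip_idx_eq_iff [simp]: "flip_idx N a = flip_idx N b \<longleftrightarrow> a = b"
  by (metis flip_idx_flip_idx)

lemma mid_pri: "N > 2 \<Longrightarrow> a < N \<Longrightarrow> mid N a \<Longrightarrow> flip_idx N a = pri N a \<and> rho2 N a = 0 \<and> a \<noteq> pri N a"
  by (auto simp: flip_idx_eq mid_def pri_def rho2_def elim!: evenE)

lemma mid_mid: "N > 2 \<Longrightarrow> a < N \<Longrightarrow> b < N \<Longrightarrow> mid N a \<Longrightarrow> mid N b \<Longrightarrow> b = a \<or> b = pri N a"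
  by (auto simp: mid_def pri_def elim!: evenE)

lemma flip_idx_pri: "N > 2 \<Longrightarrow> a < N \<Longrightarrow> flip_idx N (pri N a) = pri N (flip_idx N a)"
  by (cases "even N") (auto simp: flip_idx_def pri_def transpose_def elim!: evenE)

lemma rho2_flip_idx: "N > 2 \<Longrightarrow> a < N \<Longrightarrow> rho2 N (flip_idx N a) = rho2 N a"
  using mid_pri[of N a] rho2_pri[of a N] by (cases "mid N a") (auto simp: flip_idx_eq)

lemma flip_idx_less_iff:
  assumes "a \<noteq> b" "\<not> (mid N a \<and> mid N b)"
  shows "flip_idx N a < flip_idx N b \<longleftrightarrow> a < b"
  using assms by (auto simp: flip_idx_eq mid_def)

lemma flip_sgn_pri: "a < N \<Longrightarrow> flip_sgn N a * flip_sgn N (pri N a) = 1"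
  by (auto simp: flip_sgn_def pri_def elim!: oddE)

lemma flip_sgn_idx: "flip_sgn N (flip_idx N a) = flip_sgn N a"
  by (simp add: flip_sgn_def flip_idx_def)

lemma metric_flip:
  assumes "N > 2" "a < N" "b < N"
  shows "metric N h $$ (flip_idx N a, flip_idx N b) = metric N h $$ (a, b)"
  using assms by (simp add: metric_nth flip_idx_less rho2_flip_idx flip: flip_idx_pri)

text \<open>The entries of \<open>R\<close> depend on equality, priming, \<rho> and the order of the
  indices. The flip respects all of these except the order of the two middle indices of even N, and
  there the entry contains 1 - q^{2\<rho>} with \<rho> = 0, so it vanishes either way.\<close>

lemma Rm_flip:
  assumes N: "N > 2" and abcd: "a < N" "b < N" "c < N" "d < N"
  shows "Rm N h (flip_idx N a) (flip_idx N b) (flip_idx N c) (flip_idx N d) = Rm N h a b c d"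
proof -
  have pri_iff: "flip_idx N y = pri N (flip_idx N x) \<longleftrightarrow> y = pri N x" if "x < N" for x y
    using that N by (simp flip: flip_idx_pri)
  show ?thesis
    using abcd
  proof (cases rule: Rm_index_cases)
    case diag
    show ?thesis
      unfolding diag Rm_diag pri_iff[OF abcd(1)] by simp
  next
    case swap
    have ne: "flip_idx N a \<noteq> flip_idx N b" using swap(1) by simp
    show ?thesis
    proof (cases "mid N a \<and> mid N b")
      case True
      then have "b = pri N a" "rho2 N a = 0"
        using mid_mid[OF N abcd(1,2)] mid_pri[OF N abcd(1)] swap(1) by auto
      then show ?thesis
        unfolding swap(2,3) Rm_swap[OF swap(1) abcd(1,2)]
          Rm_swap[OF ne flip_idx_less[OF N abcd(1)] flip_idx_less[OF N abcd(2)]]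
          pri_iff[OF abcd(1)] rho2_flip_idx[OF N abcd(1)] by simp
    next
      case False
      then have "flip_idx N b < flip_idx N a \<longleftrightarrow> b < a"
        using swap(1) by (intro flip_idx_less_iff) auto
      then show ?thesis
        unfolding swap(2,3) Rm_swap[OF swap(1) abcd(1,2)]
          Rm_swap[OF ne flip_idx_less[OF N abcd(1)] flip_idx_less[OF N abcd(2)]]
          pri_iff[OF abcd(1)] rho2_flip_idx[OF N abcd(1)] by simp
    qed
  next
    case cross
    \<comment> \<open>In a cross entry c is neither a nor a', whereas the two middle indices are
      primes of each other.\<close>
    have "\<not> (mid N c \<and> mid N a)"
      using mid_mid[OF N abcd(1,3)] cross by auto
    then have less: "flip_idx N c < flip_idx N a \<longleftrightarrow> c < a"
      using cross by (intro flip_idx_less_iff) auto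
    have ne: "flip_idx N a \<noteq> flip_idx N c" "flip_idx N c \<noteq> pri N (flip_idx N a)"
      using cross abcd by (auto simp: pri_iff)
    show ?thesis
      unfolding cross(1,2) flip_idx_pri[OF N abcd(1)] flip_idx_pri[OF N abcd(3)] Rm_cross[OF ne]
        Rm_cross[OF cross(3)[symmetric] cross(4)] less rho2_flip_idx[OF N abcd(1)] rho2_flip_idx[OF N abcd(3)] ..
  next
    case zero
    have "Rm N h (flip_idx N a) (flip_idx N b) (flip_idx N c) (flip_idx N d) = 0"
      using zero abcd by (intro Rm_eq_0) (auto simp: pri_iff)
    then show ?thesis using zero by (simp add: Rm_eq_0)
  qed
qed

lemma PA_flip:
  assumes "N > 2" "a < N" "b < N" "c < N" "d < N"
  shows "PA N h (flip_idx N a) (flip_idx N b) (flip_idx N c) (flip_idx N d) = PA N h a b c d"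
  using assms by (simp add: PA_eq Rm_flip metric_flip)

section \<open>Structure maps on the ideals\<close>

definition word_ext :: "bool \<Rightarrow> ('x \<Rightarrow> ('k::monoid_add \<Rightarrow>\<^sub>0 complex)) \<Rightarrow> 'x list \<Rightarrow> ('k \<Rightarrow>\<^sub>0 complex)" where
  "word_ext a f w = prod_list (map f (if a then rev w else w))"

lemma word_ext_add: "word_ext a f (v + w) = (if a then word_ext a f w * word_ext a f v else word_ext a f v * word_ext a f w)"
  by (simp add: word_ext_def plus_list_eq)

lemma word_ext_0 [simp]: "word_ext a f 0 = 1"
  by (simp add: word_ext_def zero_list_eq)

lemma alg_ext_word: "alg_ext f = lin_ext False (word_ext False f)"
  and anti_ext_word: "anti_ext f = lin_ext False (word_ext True f)"
  and star_ext_word: "star_ext f = lin_ext True (word_ext True f)"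
  by (simp_all add: alg_ext_eq anti_ext_eq star_ext_eq word_ext_def[abs_def])

abbreviation free_ext where
  "free_ext b a f \<equiv> lin_ext b (word_ext a f)"

lemma free_ext_mult:
  "free_ext b a f (p * r) = (if a then free_ext b a f r * free_ext b a f p else free_ext b a f p * free_ext b a f r)"
  by (rule lin_ext_mult) (rule word_ext_add)

lemma free_ext_cst: "free_ext b a f (cst z) = cst (cj b z)"
  by (simp add: lin_ext_cst)

lemma free_ext_one: "free_ext b a f 1 = 1"
  by (simp add: lin_ext_one)

lemma free_ext_var: "free_ext b a f (var x) = f x"
  by (simp add: var_def word_ext_def)

lemma keys_word_ext:
  assumes "submonoid_alg M" "\<And>x. x \<in> A \<Longrightarrow> Poly_Mapping.keys (f x) \<subseteq> M" "w \<in> lists A"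
  shows "Poly_Mapping.keys (word_ext a f w) \<subseteq> M"
proof -
  interpret submonoid_alg M by fact
  have "set xs \<subseteq> A \<Longrightarrow> Poly_Mapping.keys (prod_list (map f xs)) \<subseteq> M" for xs
    by (induction xs) (simp_all add: keys_mult_subset assms(2) zero_mem)
  moreover have "set (if a then rev w else w) \<subseteq> A" using assms(3) by auto
  ultimately show ?thesis by (simp only: word_ext_def)
qed

lemma keys_free_ext:
  assumes "submonoid_alg M" "\<And>x. x \<in> A \<Longrightarrow> Poly_Mapping.keys (f x) \<subseteq> M" "Poly_Mapping.keys p \<subseteq> lists A"
  shows "Poly_Mapping.keys (free_ext b a f p) \<subseteq> M"
  by (rule keys_lin_ext[OF keys_word_ext[OF assms(1,2)] assms(3)])

lemma free_ext_eqI: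
  assumes "\<And>x. x \<in> A \<Longrightarrow> f x = g x" "Poly_Mapping.keys p \<subseteq> lists A"
  shows "free_ext b a f p = free_ext b a g p"
proof (rule additive_eqI[OF lin_ext_additive lin_ext_additive assms(2)])
  fix w z assume "w \<in> lists A"
  then have "word_ext a f w = word_ext a g w"
    by (auto simp: word_ext_def intro!: arg_cong[where f = prod_list] assms(1))
  then show "free_ext b a f (Poly_Mapping.single w z) = free_ext b a g (Poly_Mapping.single w z)"
    by simp
qed

text \<open>Universal property of the free algebra. Two composites, such as the coproduct after a
  monomial map and the reverse, are both identified with the extension of one \<open>f\<close>, so
  that only letters have to be compared.\<close>

lemma free_ext_unique:
  assumes "additive \<Phi>" "\<And>z. \<Phi> (cst z) = cst (cj b z)"
    and "\<And>p r. \<Phi> (p * r) = (if a then \<Phi> r * \<Phi> p else \<Phi> p * \<Phi> r)"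
    and "\<And>x. x \<in> A \<Longrightarrow> \<Phi> (var x) = f x"
    and "Poly_Mapping.keys p \<subseteq> lists A"
  shows "\<Phi> p = free_ext b a f p"
proof (rule additive_eqI[OF assms(1) lin_ext_additive assms(5)])
  have *: "\<Phi> (Poly_Mapping.single w 1) = free_ext b a f (Poly_Mapping.single w 1)" if "w \<in> lists A" for w
    using that
  proof (induction w)
    case Nil
    then show ?case
      using assms(2)[of 1] by (simp add: zero_list_eq[symmetric] free_ext_one)
  next
    case (Cons x w)
    have "Poly_Mapping.single (x # w) 1 = var x * Poly_Mapping.single w 1"
      using single_Cons[of x w 1] by simp
    then show ?case
      using Cons assms(4)[of x] by (simp only: assms(3) free_ext_mult free_ext_var)
  qed
  fix w z assume w: "w \<in> lists A"
  have e: "Poly_Mapping.single w z = cst z * Poly_Mapping.single w 1"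
    by (simp add: cst_times_single)
  show "\<Phi> (Poly_Mapping.single w z) = free_ext b a f (Poly_Mapping.single w z)"
    unfolding e assms(3) free_ext_mult *[OF w] assms(2) free_ext_cst ..
qed

lemma sum_swap4:
  fixes F :: "nat \<Rightarrow> nat \<Rightarrow> nat \<Rightarrow> nat \<Rightarrow> 'b::comm_monoid_add"
  shows "(\<Sum>e<N. \<Sum>f<N. \<Sum>g<N. \<Sum>k<N. F e f g k) = (\<Sum>g<N. \<Sum>k<N. \<Sum>e<N. \<Sum>f<N. F e f g k)"
proof -
  have *: "(\<Sum>e<N. \<Sum>g<N. \<Sum>k<N. G e g k) = (\<Sum>g<N. \<Sum>k<N. \<Sum>e<N. G e g k)"
    for G :: "nat \<Rightarrow> nat \<Rightarrow> nat \<Rightarrow> 'b"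
    by (rule trans[OF sum.swap]) (intro sum.cong refl sum.swap)
  show ?thesis
    unfolding *[of "F e" for e] by (rule *)
qed

lemma sum_involution:
  assumes "\<And>a. a < N \<Longrightarrow> t a < N" "\<And>a. a < N \<Longrightarrow> t (t a) = a"
  shows "(\<Sum>e<N. F (t e)) = (\<Sum>e<N. F e)"
  by (rule sum.reindex_bij_witness[of _ t t]) (use assms in auto)

lemma sum_involution2:
  assumes "\<And>a. a < N \<Longrightarrow> t a < N" "\<And>a. a < N \<Longrightarrow> t (t a) = a"
  shows "(\<Sum>e<N. \<Sum>f<N. F (t e) (t f)) = (\<Sum>e<N. \<Sum>f<N. F e f)"
proof -
  have "(\<Sum>e<N. \<Sum>f<N. F (t e) (t f)) = (\<Sum>e<N. \<Sum>f<N. F (t e) f)"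
    by (intro sum.cong refl sum_involution assms)
  also have "\<dots> = (\<Sum>e<N. \<Sum>f<N. F e f)"
    by (rule sum_involution[OF assms, where F = "\<lambda>e. \<Sum>f<N. F e f"])
  finally show ?thesis .
qed

section \<open>Ideals in tensor products of free algebras\<close>

lemma tensor_ideal_ideal:
  assumes "monoid_alg_ideal (lists A) I" "monoid_alg_ideal (lists B) J"
  shows "monoid_alg_ideal (lists A \<times> lists B) (tensor_ideal A I B J)"
    and "(\<lambda>x. tens x 1) ` I \<union> (\<lambda>y. tens 1 y) ` J \<subseteq> carrier (free_tensor A B)"
proof -
  interpret I: monoid_alg_ideal "lists A" I by fact
  interpret J: monoid_alg_ideal "lists B" J by fact
  show *: "(\<lambda>x. tens x 1) ` I \<union> (\<lambda>y. tens 1 y) ` J \<subseteq> carrier (free_tensor A B)"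
    unfolding monoid_alg_simps
    by (intro Un_least image_subsetI CollectI keys_tens I.mem_carrier J.mem_carrier
        I.keys_one_subset J.keys_one_subset)
  show "monoid_alg_ideal (lists A \<times> lists B) (tensor_ideal A I B J)"
    unfolding tensor_ideal_def by (rule monoid_alg_idealI[OF submonoid_lists_Times *])
qed

lemma tensor_ideal_left:
  assumes "monoid_alg_ideal (lists A) I" "monoid_alg_ideal (lists B) J"
    and "x \<in> I" "Poly_Mapping.keys y \<subseteq> lists B"
  shows "tens x y \<in> tensor_ideal A I B J"
proof -
  interpret I: monoid_alg_ideal "lists A" I by fact
  interpret IJ: monoid_alg_ideal "lists A \<times> lists B" "tensor_ideal A I B J"
    by (rule tensor_ideal_ideal) fact+
  have "tens x 1 \<in> tensor_ideal A I B J"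
    unfolding tensor_ideal_def
    by (rule genideal_mem[OF submonoid_lists_Times tensor_ideal_ideal(2)[OF assms(1,2)]])
      (use assms(3) in blast)
  then have "tens x 1 * tens 1 y \<in> tensor_ideal A I B J"
    by (rule IJ.mult_right_mem_ideal) (rule keys_tens[OF I.keys_one_subset assms(4)])
  then show ?thesis by (simp flip: tens_mult)
qed

lemma tensor_ideal_right:
  assumes "monoid_alg_ideal (lists A) I" "monoid_alg_ideal (lists B) J"
    and "Poly_Mapping.keys x \<subseteq> lists A" "y \<in> J"
  shows "tens x y \<in> tensor_ideal A I B J"
proof -
  interpret J: monoid_alg_ideal "lists B" J by fact
  interpret IJ: monoid_alg_ideal "lists A \<times> lists B" "tensor_ideal A I B J"
    by (rule tensor_ideal_ideal) fact+
  have "tens 1 y \<in> tensor_ideal A I B J"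
    unfolding tensor_ideal_def
    by (rule genideal_mem[OF submonoid_lists_Times tensor_ideal_ideal(2)[OF assms(1,2)]])
      (use assms(4) in blast)
  then have "tens x 1 * tens 1 y \<in> tensor_ideal A I B J"
    by (rule IJ.mult_left_mem_ideal) (rule keys_tens[OF assms(3) J.keys_one_subset])
  then show ?thesis by (simp flip: tens_mult)
qed

lemma tensor_ideal_mono:
  assumes "monoid_alg_ideal (lists A) I'" "monoid_alg_ideal (lists B) J'" "I \<subseteq> I'" "J \<subseteq> J'"
  shows "tensor_ideal A I B J \<subseteq> tensor_ideal A I' B J'"
proof -
  have "ring (free_tensor A B)"
    by (rule submonoid_alg.ring_monoid_alg[OF submonoid_lists_Times])
  then show ?thesis
    unfolding tensor_ideal_def[of A I]
    by (rule ring.genideal_minimal)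
      (use tensor_ideal_ideal(1)[OF assms(1,2)] assms(3,4)
          tensor_ideal_left[OF assms(1,2) _ submonoid_alg.keys_one_subset[OF submonoid_lists]]
          tensor_ideal_right[OF assms(1,2) submonoid_alg.keys_one_subset[OF submonoid_lists]]
        in \<open>auto simp: monoid_alg_ideal_def\<close>)
qed

lemma keys_tensor_map:
  assumes "\<And>w. w \<in> lists A \<Longrightarrow> Poly_Mapping.keys (F w) \<subseteq> lists A'"
    "\<And>w. w \<in> lists B \<Longrightarrow> Poly_Mapping.keys (G w) \<subseteq> lists B'"
    and "Poly_Mapping.keys x \<subseteq> lists A \<times> lists B"
  shows "Poly_Mapping.keys (tensor_map b F G x) \<subseteq> lists A' \<times> lists B'"
  unfolding tensor_map_def
proof (rule keys_lin_ext[OF _ assms(3)])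
  fix m assume "m \<in> lists A \<times> lists B"
  then obtain v w where "m = (v, w)" "v \<in> lists A" "w \<in> lists B" by blast
  then show "Poly_Mapping.keys (case m of (v, w) \<Rightarrow> tens (F v) (G w)) \<subseteq> lists A' \<times> lists B'"
    using keys_tens[OF assms(1,2)] by simp
qed

lemma tensor_map_tensor_ideal:
  assumes "monoid_alg_ideal (lists A) I" "monoid_alg_ideal (lists B) J"
    and "monoid_alg_ideal (lists A) I'" "monoid_alg_ideal (lists B) J'"
    and F: "\<And>x. x \<in> A \<Longrightarrow> Poly_Mapping.keys (f x) \<subseteq> lists A" "\<And>x. x \<in> I \<Longrightarrow> free_ext b a f x \<in> I'"
    and G: "\<And>x. x \<in> B \<Longrightarrow> Poly_Mapping.keys (g x) \<subseteq> lists B" "\<And>x. x \<in> J \<Longrightarrow> free_ext b a g x \<in> J'"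
    and x: "x \<in> tensor_ideal A I B J"
  shows "tensor_map b (word_ext a f) (word_ext a g) x \<in> tensor_ideal A I' B J'"
  using x unfolding tensor_ideal_def[of A I]
proof (rule genideal_image[OF submonoid_lists_Times tensor_ideal_ideal(1)[OF assms(3,4)] additive_tensor_map
      tensor_ideal_ideal(2)[OF assms(1,2)], rotated 3])
  show "tensor_map b (word_ext a f) (word_ext a g) (x * y) =
      (if a then tensor_map b (word_ext a f) (word_ext a g) y * tensor_map b (word_ext a f) (word_ext a g) x
       else tensor_map b (word_ext a f) (word_ext a g) x * tensor_map b (word_ext a f) (word_ext a g) y)" for x y
    by (rule tensor_map_mult) (rule word_ext_add)+
next
  fix x :: "'a list \<times> 'b list \<Rightarrow>\<^sub>0 complex" assume "Poly_Mapping.keys x \<subseteq> lists A \<times> lists B"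
  then show "Poly_Mapping.keys (tensor_map b (word_ext a f) (word_ext a g) x) \<subseteq> lists A \<times> lists B"
    by (rule keys_tensor_map[rotated 2]) (rule keys_word_ext[OF submonoid_lists], use F G in simp_all)+
next
  fix y assume "y \<in> (\<lambda>x. tens x 1) ` I \<union> tens 1 ` J"
  then show "tensor_map b (word_ext a f) (word_ext a g) y \<in> tensor_ideal A I' B J'"
    using tensor_ideal_left[OF assms(3,4) F(2) submonoid_alg.keys_one_subset[OF submonoid_lists]]
      tensor_ideal_right[OF assms(3,4) submonoid_alg.keys_one_subset[OF submonoid_lists] G(2)]
    by (auto simp: tensor_map_tens free_ext_one)
qed


text \<open>No condition on \<open>h\<close> is fixed here. The coproduct and the counit descend for
  every \<open>h\<close>, the antipode for nonzero \<open>h\<close>; reality, |q| = 1 and roots of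
  unity matter only for the symmetries.\<close>

locale quantum_group =
  fixes N :: nat and h :: complex
begin

abbreviation "W \<equiv> lists (T_idx N)"

sublocale W: submonoid_alg W
  by (rule submonoid_lists)

lemma keys_T: "a < N \<Longrightarrow> b < N \<Longrightarrow> Poly_Mapping.keys (T a b) \<subseteq> W"
  by (simp add: T_def var_def)

lemma keys_rels:
  "a < N \<Longrightarrow> b < N \<Longrightarrow> c < N \<Longrightarrow> d < N \<Longrightarrow> Poly_Mapping.keys (rtt_rel N h a b c d) \<subseteq> W"
  "a < N \<Longrightarrow> b < N \<Longrightarrow> Poly_Mapping.keys (metric_rel1 N h a b) \<subseteq> W"
  "a < N \<Longrightarrow> b < N \<Longrightarrow> Poly_Mapping.keys (metric_rel2 N h a b) \<subseteq> W"
  unfolding rtt_rel_def metric_rel1_def metric_rel2_def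
  by (rule W.keys_diff_subset W.keys_sum_subset W.keys_mult_subset W.keys_cst_subset keys_T
      | assumption | simp only: lessThan_iff)+

lemma O_rels_carrier: "O_rels N h \<subseteq> carrier (free_alg (T_idx N))"
proof
  fix x assume "x \<in> O_rels N h"
  then show "x \<in> carrier (free_alg (T_idx N))"
    unfolding O_rels_def monoid_alg_simps by (elim UnE CollectE exE conjE) (simp_all only: keys_rels mem_Collect_eq)
qed

lemma is_qdet_carrier: "is_qdet N h D \<Longrightarrow> Poly_Mapping.keys D \<subseteq> W"
  by (simp add: is_qdet_def)

lemma SO_rels_carrier: "O_rels N h \<union> {D - 1 | D. is_qdet N h D} \<subseteq> carrier (free_alg (T_idx N))"
proof (intro Un_least O_rels_carrier subsetI)
  fix x assume "x \<in> {D - 1 | D. is_qdet N h D}"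
  then obtain D where "x = D - 1" "is_qdet N h D" by blast
  then show "x \<in> carrier (free_alg (T_idx N))"
    using W.keys_diff_subset[OF is_qdet_carrier W.keys_one_subset] by (simp only: monoid_alg_simps mem_Collect_eq)
qed

sublocale O: monoid_alg_ideal W "O_ideal N h"
  unfolding O_ideal_def by (rule monoid_alg_idealI[OF submonoid_lists O_rels_carrier])

sublocale SO: monoid_alg_ideal W "SO_ideal N h"
  unfolding SO_ideal_def by (rule monoid_alg_idealI[OF submonoid_lists SO_rels_carrier])

lemma O_rels_mem: "x \<in> O_rels N h \<Longrightarrow> x \<in> O_ideal N h"
  unfolding O_ideal_def by (rule genideal_mem[OF submonoid_lists O_rels_carrier])

lemma rtt_mem: "a < N \<Longrightarrow> b < N \<Longrightarrow> c < N \<Longrightarrow> d < N \<Longrightarrow> rtt_rel N h a b c d \<in> O_ideal N h"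
  by (rule O_rels_mem) (auto simp: O_rels_def)

lemma metric_rel1_mem: "a < N \<Longrightarrow> b < N \<Longrightarrow> metric_rel1 N h a b \<in> O_ideal N h"
  by (rule O_rels_mem) (auto simp: O_rels_def)

lemma metric_rel2_mem: "a < N \<Longrightarrow> b < N \<Longrightarrow> metric_rel2 N h a b \<in> O_ideal N h"
  by (rule O_rels_mem) (auto simp: O_rels_def)

lemma O_subset_SO: "O_ideal N h \<subseteq> SO_ideal N h"
  unfolding O_ideal_def
  by (rule W.genideal_minimal[OF SO.ideal_axioms])
    (use W.genideal_self[OF SO_rels_carrier] in \<open>simp add: SO_ideal_def\<close>)

lemma qdet_mem: "is_qdet N h D \<Longrightarrow> D - 1 \<in> SO_ideal N h"
  unfolding SO_ideal_def by (rule genideal_mem[OF submonoid_lists SO_rels_carrier]) blast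

lemma SO_ideal_image:
  assumes "monoid_alg_ideal M' J" "additive f"
    and "\<And>x y. f (x * y) = (if a then f y * f x else f x * f y)"
    and "\<And>x. Poly_Mapping.keys x \<subseteq> W \<Longrightarrow> Poly_Mapping.keys (f x) \<subseteq> M'"
    and "\<And>x. x \<in> O_rels N h \<Longrightarrow> f x \<in> J" "\<And>D. is_qdet N h D \<Longrightarrow> f (D - 1) \<in> J"
    and "x \<in> SO_ideal N h"
  shows "f x \<in> J"
proof (rule genideal_image[OF submonoid_lists assms(1,2) SO_rels_carrier assms(3)])
  show "x \<in> Idl\<^bsub>W.R\<^esub> (O_rels N h \<union> {D - 1 | D. is_qdet N h D})"
    using assms(7) by (simp add: SO_ideal_def)
  show "f g \<in> J" if "g \<in> O_rels N h \<union> {D - 1 | D. is_qdet N h D}" for g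
    using that assms(5,6) by blast
qed (rule assms(4))

lemma O_ideal_image:
  assumes "monoid_alg_ideal M' J" "additive f"
    and "\<And>x y. f (x * y) = (if a then f y * f x else f x * f y)"
    and "\<And>x. Poly_Mapping.keys x \<subseteq> W \<Longrightarrow> Poly_Mapping.keys (f x) \<subseteq> M'"
    and "\<And>x. x \<in> O_rels N h \<Longrightarrow> f x \<in> J"
    and "x \<in> O_ideal N h"
  shows "f x \<in> J"
proof (rule genideal_image[OF submonoid_lists assms(1,2) O_rels_carrier assms(3)])
  show "x \<in> Idl\<^bsub>W.R\<^esub> (O_rels N h)"
    using assms(6) by (simp add: O_ideal_def)
  show "f g \<in> J" if "g \<in> O_rels N h" for g
    using that assms(5) by blast
qed (rule assms(4))

abbreviation "W2 \<equiv> lists (T_idx N) \<times> lists (T_idx N)"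

lemma O2_ideal: "monoid_alg_ideal W2 (tensor_ideal (T_idx N) (O_ideal N h) (T_idx N) (O_ideal N h))"
  by (rule tensor_ideal_ideal(1)[OF O.monoid_alg_ideal_axioms O.monoid_alg_ideal_axioms])

lemma SO2_ideal: "monoid_alg_ideal W2 (SO2_ideal N h)"
  unfolding SO2_ideal_def
  by (rule tensor_ideal_ideal(1)[OF SO.monoid_alg_ideal_axioms SO.monoid_alg_ideal_axioms])

lemma O2_subset_SO2:
  "tensor_ideal (T_idx N) (O_ideal N h) (T_idx N) (O_ideal N h) \<subseteq> SO2_ideal N h"
  unfolding SO2_ideal_def 
  by (rule tensor_ideal_mono[OF SO.monoid_alg_ideal_axioms SO.monoid_alg_ideal_axioms O_subset_SO O_subset_SO])

lemma tens_O_left: "x \<in> O_ideal N h \<Longrightarrow> Poly_Mapping.keys y \<subseteq> W \<Longrightarrow>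
    tens x y \<in> tensor_ideal (T_idx N) (O_ideal N h) (T_idx N) (O_ideal N h)"
  by (rule tensor_ideal_left[OF O.monoid_alg_ideal_axioms O.monoid_alg_ideal_axioms])

lemma tens_O_right: "Poly_Mapping.keys x \<subseteq> W \<Longrightarrow> y \<in> O_ideal N h \<Longrightarrow>
    tens x y \<in> tensor_ideal (T_idx N) (O_ideal N h) (T_idx N) (O_ideal N h)"
  by (rule tensor_ideal_right[OF O.monoid_alg_ideal_axioms O.monoid_alg_ideal_axioms])

lemma tens_SO_left: "x \<in> SO_ideal N h \<Longrightarrow> Poly_Mapping.keys y \<subseteq> W \<Longrightarrow> tens x y \<in> SO2_ideal N h"
  unfolding SO2_ideal_def
  by (rule tensor_ideal_left[OF SO.monoid_alg_ideal_axioms SO.monoid_alg_ideal_axioms])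

lemma tens_SO_right: "Poly_Mapping.keys x \<subseteq> W \<Longrightarrow> y \<in> SO_ideal N h \<Longrightarrow> tens x y \<in> SO2_ideal N h"
  unfolding SO2_ideal_def
  by (rule tensor_ideal_right[OF SO.monoid_alg_ideal_axioms SO.monoid_alg_ideal_axioms])

end

lemma tens_left_cst: "tens (cst c) r = cst c * tens 1 r"
  using tens_cst_left[of c 1 r] by simp

lemma tens_right_cst: "tens p (cst c) = cst c * tens p 1"
  using tens_cst_right[of p c 1] by simp

lemma cst_inject: "cst x = cst y \<longleftrightarrow> x = y"
  by (metis cst_def lookup_single_eq)

context quantum_group
begin

subsection \<open>The coproduct\<close>

lemma Delta_free_eq: "Delta_free N = free_ext False False (\<lambda>(a, b). \<Sum>c<N. tens (T a c) (T c b))"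
  by (simp add: Delta_free_def alg_ext_word)

lemma Delta_free_additive: "additive (Delta_free N)"
  by (simp add: Delta_free_eq lin_ext_additive)

lemmas Delta_free_sum = additive.sum[OF Delta_free_additive]
  and Delta_free_diff = additive.diff[OF Delta_free_additive]

lemma Delta_free_mult: "Delta_free N (p * r) = Delta_free N p * Delta_free N r"
  by (simp add: Delta_free_eq free_ext_mult)

lemma Delta_free_cst: "Delta_free N (cst z) = cst z"
  by (simp add: Delta_free_eq free_ext_cst)

lemma Delta_free_T: "Delta_free N (T a b) = (\<Sum>c<N. tens (T a c) (T c b))"
  by (simp add: Delta_free_eq T_def free_ext_var)

lemma keys_Delta_free:
  assumes "Poly_Mapping.keys p \<subseteq> W"
  shows "Poly_Mapping.keys (Delta_free N p) \<subseteq> W2"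
  unfolding Delta_free_eq
proof (rule keys_free_ext[OF submonoid_lists_Times _ assms])
  interpret W2: submonoid_alg W2 by (rule submonoid_lists_Times)
  fix x :: "nat \<times> nat" assume "x \<in> T_idx N"
  then obtain a b where x: "x = (a, b)" "a < N" "b < N" by auto
  show "Poly_Mapping.keys (case x of (a, b) \<Rightarrow> \<Sum>c<N. tens (T a c) (T c b)) \<subseteq> W2"
    unfolding x prod.case by (intro W2.keys_sum_subset keys_tens keys_T) (simp_all add: x)
qed

lemma Delta_free_TT:
  "Delta_free N (T a b * T c d) = (\<Sum>g<N. \<Sum>k<N. tens (T a g * T c k) (T g b * T k d))"
  by (simp add: Delta_free_mult Delta_free_T sum_product tens_mult)

text \<open>In matrix form R T_1 T_2 goes to R T_1 T_2 \<otimes> T_1 T_2, and T_2 T_1 R to T_2 T_1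
  \<otimes> T_2 T_1 R. The mixed terms T_2 T_1 R \<otimes> T_1 T_2 and T_2 T_1 \<otimes> R T_1 T_2
  agree, since the scalar matrix moves across the tensor sign.\<close>

lemma Delta_rtt:
  assumes "a < N" "b < N" "c < N" "d < N"
  shows "Delta_free N (rtt_rel N h a b c d) =
    (\<Sum>g<N. \<Sum>k<N. tens (rtt_rel N h a b g k) (T g c * T k d))
    + (\<Sum>g<N. \<Sum>k<N. tens (T b k * T a g) (rtt_rel N h g k c d))"
proof -
  let ?A = "\<lambda>a b c d. \<Sum>e<N. \<Sum>f<N. cst (Rm N h a b e f) * (T e c * T f d)"
  let ?B = "\<lambda>a b c d. \<Sum>e<N. \<Sum>f<N. cst (Rm N h e f c d) * (T b f * T a e)"
  have rtt: "rtt_rel N h a b c d = ?A a b c d - ?B a b c d" for a b c d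
    unfolding rtt_rel_def cst_central[of "T _ _ * T _ _"] by (simp only: mult.assoc)
  have A: "Delta_free N (?A a b c d) = (\<Sum>g<N. \<Sum>k<N. tens (?A a b g k) (T g c * T k d))"
  proof -
    have "Delta_free N (?A a b c d) = (\<Sum>e<N. \<Sum>f<N. \<Sum>g<N. \<Sum>k<N.
        cst (Rm N h a b e f) * tens (T e g * T f k) (T g c * T k d))"
      by (simp only: Delta_free_sum Delta_free_mult[of "cst _"] Delta_free_cst Delta_free_TT sum_distrib_left)
    also have "\<dots> = (\<Sum>g<N. \<Sum>k<N. \<Sum>e<N. \<Sum>f<N.
        cst (Rm N h a b e f) * tens (T e g * T f k) (T g c * T k d))"
      by (rule sum_swap4)
    finally show ?thesis by (simp only: tens_sum_left tens_cst_left)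
  qed
  have B: "Delta_free N (?B a b c d) = (\<Sum>g<N. \<Sum>k<N. tens (T b k * T a g) (?B g k c d))"
  proof -
    have "Delta_free N (?B a b c d) = (\<Sum>e<N. \<Sum>f<N. \<Sum>k<N. \<Sum>g<N.
        cst (Rm N h e f c d) * tens (T b k * T a g) (T k f * T g e))"
      by (simp only: Delta_free_sum Delta_free_mult[of "cst _"] Delta_free_cst Delta_free_TT sum_distrib_left)
    also have "\<dots> = (\<Sum>k<N. \<Sum>g<N. \<Sum>e<N. \<Sum>f<N.
        cst (Rm N h e f c d) * tens (T b k * T a g) (T k f * T g e))"
      by (rule sum_swap4)
    also have "\<dots> = (\<Sum>g<N. \<Sum>k<N. \<Sum>e<N. \<Sum>f<N.
        cst (Rm N h e f c d) * tens (T b k * T a g) (T k f * T g e))"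
      by (rule sum.swap)
    finally show ?thesis by (simp only: tens_sum_right tens_cst_right)
  qed
  have C: "(\<Sum>g<N. \<Sum>k<N. tens (?B a b g k) (T g c * T k d)) = (\<Sum>g<N. \<Sum>k<N. tens (T b k * T a g) (?A g k c d))"
  proof -
    have "(\<Sum>g<N. \<Sum>k<N. tens (?B a b g k) (T g c * T k d)) = (\<Sum>g<N. \<Sum>k<N. \<Sum>e<N. \<Sum>f<N.
        cst (Rm N h e f g k) * tens (T b f * T a e) (T g c * T k d))"
      by (simp only: tens_sum_left tens_cst_left)
    also have "\<dots> = (\<Sum>e<N. \<Sum>f<N. \<Sum>g<N. \<Sum>k<N.
        cst (Rm N h e f g k) * tens (T b f * T a e) (T g c * T k d))"
      by (rule sum_swap4)
    finally show ?thesis by (simp only: tens_sum_right tens_cst_right)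
  qed
  show ?thesis
    unfolding rtt Delta_free_diff A B tens_diff_left tens_diff_right sum_subtractf C by simp
qed

text \<open>Inside the coproduct of T C T^t the same product reappears in the second tensor factor;
  replacing it there by \<open>C\<close> leaves T C T^t in the first factor. For T^t C T the factors
  change roles.\<close>

lemma Delta_metric_rel1:
  "Delta_free N (metric_rel1 N h a b) =
    (\<Sum>g<N. \<Sum>k<N. tens (T a g * T b k) (metric_rel1 N h g k)) + tens (metric_rel1 N h a b) 1"
proof -
  let ?C = "\<lambda>c d. cst (metric N h $$ (c, d))"
  let ?S = "\<lambda>a b. \<Sum>c<N. \<Sum>d<N. ?C c d * (T a c * T b d)"
  have rel: "metric_rel1 N h a b = ?S a b - ?C a b" for a b
    unfolding metric_rel1_def by (simp only: cst_central[of "T _ _"] mult.assoc)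
  have "Delta_free N (?S a b) = (\<Sum>c<N. \<Sum>d<N. \<Sum>g<N. \<Sum>k<N.
      ?C c d * tens (T a g * T b k) (T g c * T k d))"
    by (simp only: Delta_free_sum Delta_free_mult[of "cst _"] Delta_free_cst Delta_free_TT sum_distrib_left)
  also have "\<dots> = (\<Sum>g<N. \<Sum>k<N. \<Sum>c<N. \<Sum>d<N. ?C c d * tens (T a g * T b k) (T g c * T k d))"
    by (rule sum_swap4)
  also have "\<dots> = (\<Sum>g<N. \<Sum>k<N. tens (T a g * T b k) (?S g k))"
    by (simp only: tens_sum_right tens_cst_right)
  also have "\<dots> = (\<Sum>g<N. \<Sum>k<N. tens (T a g * T b k) (metric_rel1 N h g k))
      + (\<Sum>g<N. \<Sum>k<N. tens (T a g * T b k) (?C g k))"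
    by (simp only: rel flip: sum.distrib tens_add_right) simp
  also have "(\<Sum>g<N. \<Sum>k<N. tens (T a g * T b k) (?C g k)) = tens (?S a b) 1"
    by (simp only: tens_sum_left tens_cst_left tens_right_cst)
  finally show ?thesis
    unfolding rel[of a b]
    by (simp add: Delta_free_diff Delta_free_cst tens_diff_left tens_left_cst tens_one_one)
qed

lemma Delta_metric_rel2:
  "Delta_free N (metric_rel2 N h a b) =
    (\<Sum>g<N. \<Sum>k<N. tens (metric_rel2 N h g k) (T g a * T k b)) + tens 1 (metric_rel2 N h a b)"
proof -
  let ?C = "\<lambda>c d. cst (metric N h $$ (c, d))"
  let ?S = "\<lambda>a b. \<Sum>c<N. \<Sum>d<N. ?C c d * (T c a * T d b)"
  have rel: "metric_rel2 N h a b = ?S a b - ?C a b" for a b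
    unfolding metric_rel2_def by (simp only: cst_central[of "T _ _"] mult.assoc)
  have "Delta_free N (?S a b) = (\<Sum>c<N. \<Sum>d<N. \<Sum>g<N. \<Sum>k<N.
      ?C c d * tens (T c g * T d k) (T g a * T k b))"
    by (simp only: Delta_free_sum Delta_free_mult[of "cst _"] Delta_free_cst Delta_free_TT sum_distrib_left)
  also have "\<dots> = (\<Sum>g<N. \<Sum>k<N. \<Sum>c<N. \<Sum>d<N. ?C c d * tens (T c g * T d k) (T g a * T k b))"
    by (rule sum_swap4)
  also have "\<dots> = (\<Sum>g<N. \<Sum>k<N. tens (?S g k) (T g a * T k b))"
    by (simp only: tens_sum_left tens_cst_left)
  also have "\<dots> = (\<Sum>g<N. \<Sum>k<N. tens (metric_rel2 N h g k) (T g a * T k b))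
      + (\<Sum>g<N. \<Sum>k<N. tens (?C g k) (T g a * T k b))"
    by (simp only: rel flip: sum.distrib tens_add_left) simp
  also have "(\<Sum>g<N. \<Sum>k<N. tens (?C g k) (T g a * T k b)) = tens 1 (?S a b)"
    by (simp only: tens_sum_right tens_cst_right tens_left_cst)
  finally show ?thesis
    unfolding rel[of a b]
    by (simp add: Delta_free_diff Delta_free_cst tens_diff_right tens_right_cst tens_one_one)
qed

lemma Delta_O_rels:
  assumes "x \<in> O_rels N h"
  shows "Delta_free N x \<in> tensor_ideal (T_idx N) (O_ideal N h) (T_idx N) (O_ideal N h)"
proof -
  interpret O2: monoid_alg_ideal W2 "tensor_ideal (T_idx N) (O_ideal N h) (T_idx N) (O_ideal N h)"
    by (rule O2_ideal)
  from assms consider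
      (rtt) a b c d where "x = rtt_rel N h a b c d" "a < N" "b < N" "c < N" "d < N"
    | (rel1) a b where "x = metric_rel1 N h a b" "a < N" "b < N"
    | (rel2) a b where "x = metric_rel2 N h a b" "a < N" "b < N"
    unfolding O_rels_def by blast
  then show ?thesis
  proof cases
    case rtt
    show ?thesis
      unfolding rtt(1) Delta_rtt[OF rtt(2-)]
      by (intro O2.add_mem_ideal O2.sum_mem_ideal tens_O_left tens_O_right rtt_mem W.keys_mult_subset keys_T)
        (use rtt in auto)
  next
    case rel1
    show ?thesis
      unfolding rel1(1) Delta_metric_rel1
      by (intro O2.add_mem_ideal O2.sum_mem_ideal tens_O_left tens_O_right metric_rel1_mem
          W.keys_mult_subset W.keys_one_subset keys_T) (use rel1 in auto)
  next
    case rel2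
    show ?thesis
      unfolding rel2(1) Delta_metric_rel2
      by (intro O2.add_mem_ideal O2.sum_mem_ideal tens_O_left tens_O_right metric_rel2_mem
          W.keys_mult_subset W.keys_one_subset keys_T) (use rel2 in auto)
  qed
qed

lemma Delta_free_SO_ideal:
  assumes "x \<in> SO_ideal N h"
  shows "Delta_free N x \<in> SO2_ideal N h"
proof (rule SO_ideal_image[OF SO2_ideal Delta_free_additive, where a = False])
  interpret SO2: monoid_alg_ideal W2 "SO2_ideal N h" by (rule SO2_ideal)
  fix D assume D: "is_qdet N h D"
  then have "Delta_free N D - tens D D \<in> SO2_ideal N h"
    using O2_subset_SO2 by (auto simp: is_qdet_def)
  moreover have "tens (D - 1) D \<in> SO2_ideal N h" "tens 1 (D - 1) \<in> SO2_ideal N h"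
    using D by (simp_all add: tens_SO_left tens_SO_right qdet_mem is_qdet_carrier W.keys_one_subset del: keys_one)
  \<comment> \<open>D \<otimes> D - 1 \<otimes> 1 splits as (D - 1) \<otimes> D + 1 \<otimes> (D -
    1).\<close>
  ultimately have "(Delta_free N D - tens D D) + (tens (D - 1) D + tens 1 (D - 1)) \<in> SO2_ideal N h"
    by (intro SO2.add_mem_ideal)
  also have "(Delta_free N D - tens D D) + (tens (D - 1) D + tens 1 (D - 1)) = Delta_free N (D - 1)"
    using Delta_free_cst[of 1] by (simp add: Delta_free_diff tens_diff_left tens_diff_right tens_one_one)
  finally show "Delta_free N (D - 1) \<in> SO2_ideal N h" .
next
  show "Delta_free N x \<in> SO2_ideal N h" if "x \<in> O_rels N h" for x
    using Delta_O_rels[OF that] O2_subset_SO2 by blast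
qed (use assms keys_Delta_free in \<open>simp_all add: Delta_free_mult\<close>)

subsection \<open>The counit\<close>

text \<open>The counit takes complex values. Regarded as an endomorphism with constant values it
  becomes an instance of \<open>free_ext\<close>, with the zero ideal as target in the descent
  argument.\<close>

definition eps_letter :: "nat \<times> nat \<Rightarrow> talg" where
  "eps_letter = (\<lambda>(a, b). cst (if a = b then 1 else 0))"

lemma cst_eps_free: "cst (eps_free p) = free_ext False False eps_letter p"
proof -
  have "cst (prod_list (map (\<lambda>(a, b). if a = b then 1 else 0) w)) = prod_list (map eps_letter w)" for w
    by (induction w) (auto simp: cst_mult eps_letter_def)
  then show ?thesis
    by (simp add: eps_free_def lin_ext_def word_ext_def cst_sum cst_mult)
qed

lemma eps_free_additive: "additive eps_free"
proof (rule additive.intro)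
  fix x y
  have "cst (eps_free (x + y)) = (cst (eps_free x + eps_free y) :: talg)"
    by (simp add: cst_add cst_eps_free lin_ext_add)
  then show "eps_free (x + y) = eps_free x + eps_free y"
    by (simp only: cst_inject)
qed

lemma zero_ideal: "monoid_alg_ideal W {0}"
  using W.zeroideal W.submonoid_alg_axioms by (simp add: monoid_alg_ideal_def)

lemma eps_letter_T: "free_ext False False eps_letter (T a b) = cst (if a = b then 1 else 0)"
  by (simp add: T_def free_ext_var eps_letter_def)

lemma keys_eps: "Poly_Mapping.keys (free_ext False False eps_letter p) \<subseteq> W"
  unfolding cst_eps_free[symmetric] by (rule W.keys_cst_subset)

lemma sum_cst_delta2:
  assumes "c < N" "d < N"
  shows "(\<Sum>e<N. \<Sum>f<N. F e f * cst (if e = c then 1 else 0) * cst (if f = d then 1 else 0)) = (F c d :: talg)"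
proof -
  have "(\<Sum>f<N. F e f * cst (if e = c then 1 else 0) * cst (if f = d then 1 else 0))
      = (if e = c then F c d else 0)" for e
  proof -
    have "F e f * cst (if e = c then 1 else 0) * cst (if f = d then 1 else 0)
        = (if f = d then if e = c then F c d else 0 else 0)" for f
      by simp
    then show ?thesis using assms by simp
  qed
  then show ?thesis using assms by simp
qed

lemma eps_O_rels:
  assumes "x \<in> O_rels N h"
  shows "free_ext False False eps_letter x = 0"
proof -
  let ?\<epsilon> = "free_ext False False eps_letter"
  have sum2: "(\<Sum>e<N. \<Sum>f<N. G e f) = (F c d :: talg)"
    if "c < N" "d < N" "\<And>e f. G e f = F e f * cst (if e = c then 1 else 0) * cst (if f = d then 1 else 0)"
    for F G c d
    using sum_cst_delta2[OF that(1,2), of F] that(3) by simp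
  note simps = lin_ext_diff lin_ext_sum free_ext_mult if_False free_ext_cst cj_simps eps_letter_T
  from assms consider
      (rtt) a b c d where "x = rtt_rel N h a b c d" "a < N" "b < N" "c < N" "d < N"
    | (rel1) a b where "x = metric_rel1 N h a b" "a < N" "b < N"
    | (rel2) a b where "x = metric_rel2 N h a b" "a < N" "b < N"
    unfolding O_rels_def by blast
  then show ?thesis
  proof cases
    case rtt
    have "?\<epsilon> (\<Sum>e<N. \<Sum>f<N. cst (Rm N h a b e f) * T e c * T f d) = cst (Rm N h a b c d)"
      unfolding simps by (rule sum2) (use rtt in auto)
    moreover have "?\<epsilon> (\<Sum>e<N. \<Sum>f<N. T b f * T a e * cst (Rm N h e f c d)) = cst (Rm N h a b c d)"
      unfolding simps by (rule sum2) (use rtt in \<open>auto simp flip: cst_mult\<close>)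
    ultimately show ?thesis
      unfolding rtt(1) rtt_rel_def by (simp add: lin_ext_diff)
  next
    case rel1
    have "?\<epsilon> (\<Sum>c<N. \<Sum>d<N. T a c * cst (metric N h $$ (c, d)) * T b d) = cst (metric N h $$ (a, b))"
      unfolding simps by (rule sum2) (use rel1 in \<open>auto simp flip: cst_mult\<close>)
    then show ?thesis
      unfolding rel1(1) metric_rel1_def by (simp add: lin_ext_diff free_ext_cst)
  next
    case rel2
    have "?\<epsilon> (\<Sum>c<N. \<Sum>d<N. T c a * cst (metric N h $$ (c, d)) * T d b) = cst (metric N h $$ (a, b))"
      unfolding simps by (rule sum2) (use rel2 in \<open>auto simp flip: cst_mult\<close>)
    then show ?thesis
      unfolding rel2(1) metric_rel2_def by (simp add: lin_ext_diff free_ext_cst)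
  qed
qed

lemma eps_SO_ideal:
  assumes "x \<in> SO_ideal N h"
  shows "eps_free x = 0"
proof -
  have "free_ext False False eps_letter x \<in> {0}"
  proof (rule SO_ideal_image[OF zero_ideal lin_ext_additive, where a = False])
    fix D assume "is_qdet N h D"
    then have "eps_free D = 1" by (simp add: is_qdet_def)
    then have "free_ext False False eps_letter D = 1"
      unfolding cst_eps_free[symmetric] by simp
    then show "free_ext False False eps_letter (D - 1) \<in> {0}"
      by (simp add: lin_ext_diff free_ext_one)
  next
    fix x :: talg assume "Poly_Mapping.keys x \<subseteq> W"
    show "Poly_Mapping.keys (free_ext False False eps_letter x) \<subseteq> W"
      by (rule keys_eps)
  qed (use assms eps_O_rels in \<open>simp_all add: free_ext_mult\<close>)
  then show ?thesis
    unfolding cst_eps_free[symmetric] by (metis cst_0 cst_inject singletonD)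
qed

subsection \<open>The antipode\<close>

text \<open>This is q^{\<rho>_a}. The antipode and \<star> act on the generators with ratios of
  these weights, since \<open>C\<close> is antidiagonal.\<close>

definition rho_w :: "nat \<Rightarrow> complex" where
  "rho_w a = h powi rho2 N a"

lemma rho_w_pri: "h \<noteq> 0 \<Longrightarrow> a < N \<Longrightarrow> rho_w a * rho_w (pri N a) = 1"
  by (simp add: rho_w_def rho2_pri power_int_minus)

lemma rho_w_nonzero: "h \<noteq> 0 \<Longrightarrow> rho_w a \<noteq> 0"
  by (simp add: rho_w_def)

lemma metric_rho_w:
  "a < N \<Longrightarrow> b < N \<Longrightarrow> metric N h $$ (a, b) = (if b = pri N a then inverse (rho_w a) else 0)"
  by (simp add: metric_nth rho_w_def power_int_minus)

definition kappa_letter :: "nat \<times> nat \<Rightarrow> talg" where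
  "kappa_letter = (\<lambda>(a, b). kappa_T N h a b)"

abbreviation kappa_fr :: "talg \<Rightarrow> talg" where
  "kappa_fr \<equiv> free_ext False True kappa_letter"

lemma kappa_free_eq: "kappa_free N h = kappa_fr"
  by (simp add: kappa_free_def anti_ext_word kappa_letter_def)

lemma kappa_T_eq:
  assumes "a < N" "b < N" "h \<noteq> 0"
  shows "kappa_T N h a b = cst (rho_w b / rho_w a) * T (pri N b) (pri N a)"
proof -
  have "(\<Sum>d<N. cst (metric N h $$ (a, c) * metric N h $$ (d, b)) * T d c)
      = cst (metric N h $$ (a, c) * rho_w b) * T (pri N b) c" for c
  proof -
    have "(\<Sum>d<N. cst (metric N h $$ (a, c) * metric N h $$ (d, b)) * T d c)
        = cst (metric N h $$ (a, c) * metric N h $$ (pri N b, b)) * T (pri N b) c"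
    proof (rule sum_metric_right[OF assms(2)])
      fix d assume d: "d < N" "d \<noteq> pri N b"
      then have "b \<noteq> pri N d" using pri_pri[of d N] by auto
      then show "cst (metric N h $$ (a, c) * metric N h $$ (d, b)) * T d c = 0"
        using d assms(2) by (simp add: metric_nth)
    qed
    also have "metric N h $$ (pri N b, b) = rho_w b"
      using assms(2) by (simp add: metric_nth pri_less pri_pri rho2_pri rho_w_def)
    finally show ?thesis .
  qed
  then have "kappa_T N h a b = (\<Sum>c<N. cst (metric N h $$ (a, c) * rho_w b) * T (pri N b) c)"
    by (simp add: kappa_T_def)
  also have "\<dots> = cst (metric N h $$ (a, pri N a) * rho_w b) * T (pri N b) (pri N a)"
    by (rule sum_metric_right[OF assms(1)]) (use assms(1) in \<open>simp add: metric_nth\<close>)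
  also have "metric N h $$ (a, pri N a) * rho_w b = rho_w b / rho_w a"
    using assms(1) by (simp add: metric_rho_w pri_less divide_inverse)
  finally show ?thesis .
qed

lemma kappa_fr_T:
  "a < N \<Longrightarrow> b < N \<Longrightarrow> h \<noteq> 0 \<Longrightarrow> kappa_fr (T a b) = cst (rho_w b / rho_w a) * T (pri N b) (pri N a)"
  by (simp add: T_def free_ext_var kappa_letter_def flip: kappa_T_eq[unfolded T_def])

lemma keys_kappa_letter:
  assumes "x \<in> T_idx N"
  shows "Poly_Mapping.keys (kappa_letter x) \<subseteq> W"
proof -
  obtain a b where x: "x = (a, b)" "a < N" "b < N" using assms by auto
  have "Poly_Mapping.keys (kappa_T N h a b) \<subseteq> W"
    unfolding kappa_T_def
    by (rule W.keys_sum_subset W.keys_mult_subset W.keys_cst_subset keys_T | simp only: lessThan_iff)+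
  then show ?thesis by (simp add: x kappa_letter_def)
qed

lemma keys_kappa_fr: "Poly_Mapping.keys p \<subseteq> W \<Longrightarrow> Poly_Mapping.keys (kappa_fr p) \<subseteq> W"
  by (rule keys_free_ext[OF submonoid_lists keys_kappa_letter])

lemma metric_rel1_eq: "metric_rel1 N h a b =
    (\<Sum>c<N. \<Sum>d<N. cst (metric N h $$ (c, d)) * (T a c * T b d)) - cst (metric N h $$ (a, b))"
  unfolding metric_rel1_def by (simp only: cst_central[of "T _ _"] mult.assoc)

lemma metric_rel2_eq: "metric_rel2 N h a b =
    (\<Sum>c<N. \<Sum>d<N. cst (metric N h $$ (c, d)) * (T c a * T d b)) - cst (metric N h $$ (a, b))"
  unfolding metric_rel2_def by (simp only: cst_central[of "T _ _"] mult.assoc)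

lemma rtt_rel_eq: "rtt_rel N h a b c d =
    (\<Sum>e<N. \<Sum>f<N. cst (Rm N h a b e f) * (T e c * T f d))
    - (\<Sum>e<N. \<Sum>f<N. cst (Rm N h e f c d) * (T b f * T a e))"
  unfolding rtt_rel_def cst_central[of "T _ _ * T _ _"] by (simp only: mult.assoc)

lemma sum_lessThan_cong2:
  "(\<And>e f. e < N \<Longrightarrow> f < N \<Longrightarrow> F e f = G e f) \<Longrightarrow> (\<Sum>e<N. \<Sum>f<N. F e f) = (\<Sum>e<N. \<Sum>f<N. G e f)"
  by (intro sum.cong refl) auto

text \<open>Reversing products exchanges the two sides of the RTT relation, hence the sign. The
  matrix \<open>R\<close> is adapted by its invariance under transposition combined with priming,
  and the weights q^{\<rho>} come out as one factor because \<open>R\<close> conserves them.\<close>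

lemma kappa_rtt:
  assumes "h \<noteq> 0" and "a < N" "b < N" "c < N" "d < N"
  shows "kappa_fr (rtt_rel N h a b c d) =
    - (cst (rho_w c * rho_w d / (rho_w a * rho_w b)) * rtt_rel N h (pri N c) (pri N d) (pri N a) (pri N b))"
proof -
  let ?p = "pri N"
  let ?z = "rho_w c * rho_w d / (rho_w a * rho_w b)"
  have weight: "Rm N h x y e f * (rho_w x * rho_w y) = Rm N h x y e f * (rho_w e * rho_w f)"
    if "x < N" "y < N" "e < N" "f < N" for x y e f
    using that by (intro Rm_weight) (simp_all add: rho_w_pri assms(1))
  \<comment> \<open>Priming with exchanged tensor factors is followed by R^t = R_21; the two
    exchanges cancel.\<close>
  have R: "Rm N h x y e f = Rm N h (?p e) (?p f) (?p x) (?p y)" if "x < N" "y < N" "e < N" "f < N" for x y e f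
    using Rm_pri[of x N y e f h] Rm_transpose[of "?p y" N "?p x" "?p f" "?p e" h] that by (simp add: pri_less)
  have "kappa_fr (\<Sum>e<N. \<Sum>f<N. cst (Rm N h a b e f) * (T e c * T f d))
      = (\<Sum>e<N. \<Sum>f<N. cst (Rm N h a b e f) * (kappa_fr (T f d) * kappa_fr (T e c)))"
    by (simp add: lin_ext_sum lin_ext_cst_mult free_ext_mult)
  also have "\<dots> = (\<Sum>e<N. \<Sum>f<N. cst (?z * Rm N h (?p e) (?p f) (?p a) (?p b)) * (T (?p d) (?p f) * T (?p c) (?p e)))"
  proof (rule sum_lessThan_cong2)
    fix e f assume ef: "e < N" "f < N"
    have eq: "Rm N h a b e f * (rho_w d / rho_w f * (rho_w c / rho_w e)) = ?z * Rm N h a b e f"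
      using weight[OF assms(2,3) ef] rho_w_nonzero[OF assms(1)] by (auto simp: field_simps)
    show "cst (Rm N h a b e f) * (kappa_fr (T f d) * kappa_fr (T e c))
        = cst (?z * Rm N h (?p e) (?p f) (?p a) (?p b)) * (T (?p d) (?p f) * T (?p c) (?p e))"
      unfolding kappa_fr_T[OF ef(2) assms(5,1)] kappa_fr_T[OF ef(1) assms(4,1)] cst_mult_mult cst_cst_mult eq
      unfolding R[OF assms(2,3) ef] ..
  qed
  also have "\<dots> = (\<Sum>e<N. \<Sum>f<N. cst (?z * Rm N h e f (?p a) (?p b)) * (T (?p d) f * T (?p c) e))"
    by (rule sum_involution2[of N "?p"]) (simp_all add: pri_less pri_pri)
  finally have 1: "kappa_fr (\<Sum>e<N. \<Sum>f<N. cst (Rm N h a b e f) * (T e c * T f d))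
      = cst ?z * (\<Sum>e<N. \<Sum>f<N. cst (Rm N h e f (?p a) (?p b)) * (T (?p d) f * T (?p c) e))"
    by (simp only: sum_distrib_left cst_cst_mult)
  have "kappa_fr (\<Sum>e<N. \<Sum>f<N. cst (Rm N h e f c d) * (T b f * T a e))
      = (\<Sum>e<N. \<Sum>f<N. cst (Rm N h e f c d) * (kappa_fr (T a e) * kappa_fr (T b f)))"
    by (simp add: lin_ext_sum lin_ext_cst_mult free_ext_mult)
  also have "\<dots> = (\<Sum>e<N. \<Sum>f<N. cst (?z * Rm N h (?p c) (?p d) (?p e) (?p f)) * (T (?p e) (?p a) * T (?p f) (?p b)))"
  proof (rule sum_lessThan_cong2)
    fix e f assume ef: "e < N" "f < N"
    have eq: "Rm N h e f c d * (rho_w e / rho_w a * (rho_w f / rho_w b)) = ?z * Rm N h e f c d"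
      using weight[OF ef assms(4,5)] rho_w_nonzero[OF assms(1)] by (auto simp: field_simps)
    show "cst (Rm N h e f c d) * (kappa_fr (T a e) * kappa_fr (T b f))
        = cst (?z * Rm N h (?p c) (?p d) (?p e) (?p f)) * (T (?p e) (?p a) * T (?p f) (?p b))"
      unfolding kappa_fr_T[OF assms(2) ef(1) assms(1)] kappa_fr_T[OF assms(3) ef(2) assms(1)] cst_mult_mult cst_cst_mult eq
      unfolding R[OF ef assms(4,5)] ..
  qed
  also have "\<dots> = (\<Sum>e<N. \<Sum>f<N. cst (?z * Rm N h (?p c) (?p d) e f) * (T e (?p a) * T f (?p b)))"
    by (rule sum_involution2[of N "?p"]) (simp_all add: pri_less pri_pri)
  finally have 2: "kappa_fr (\<Sum>e<N. \<Sum>f<N. cst (Rm N h e f c d) * (T b f * T a e))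
      = cst ?z * (\<Sum>e<N. \<Sum>f<N. cst (Rm N h (?p c) (?p d) e f) * (T e (?p a) * T f (?p b)))"
    by (simp only: sum_distrib_left cst_cst_mult)
  show ?thesis
    unfolding rtt_rel_eq lin_ext_diff 1 2 by (simp add: right_diff_distrib)
qed

lemma metric_sum:
  fixes F :: "nat \<Rightarrow> nat \<Rightarrow> talg"
  shows "(\<Sum>c<N. \<Sum>d<N. cst (metric N h $$ (c, d)) * F c d) = (\<Sum>c<N. cst (inverse (rho_w c)) * F c (pri N c))"
proof (rule sum.cong[OF refl])
  fix c assume c: "c \<in> {..<N}"
  then have "(\<Sum>d<N. cst (metric N h $$ (c, d)) * F c d) = cst (metric N h $$ (c, pri N c)) * F c (pri N c)"
    by (intro sum_metric_right) (auto simp: metric_nth)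
  then show "(\<Sum>d<N. cst (metric N h $$ (c, d)) * F c d) = cst (inverse (rho_w c)) * F c (pri N c)"
    using c by (simp add: metric_rho_w pri_less)
qed

text \<open>The antipode transposes, so it exchanges the two metric relations up to a factor from
  the outer indices; the summation index contributes q^{\<rho>_c + \<rho>_{c'}} = 1.\<close>

lemma kappa_metric_rel1:
  assumes "h \<noteq> 0" and "a < N" "b < N"
  shows "kappa_fr (metric_rel1 N h a b) = cst (inverse (rho_w a * rho_w b)) * metric_rel2 N h (pri N b) (pri N a)"
proof -
  let ?p = "pri N"
  have "kappa_fr (\<Sum>c<N. cst (inverse (rho_w c)) * (T a c * T b (?p c)))
      = (\<Sum>c<N. cst (inverse (rho_w c)) * (kappa_fr (T b (?p c)) * kappa_fr (T a c)))"
    by (simp add: lin_ext_sum lin_ext_cst_mult free_ext_mult)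
  also have "\<dots> = (\<Sum>c<N. cst (inverse (rho_w a * rho_w b) * inverse (rho_w c)) * (T c (?p b) * T (?p c) (?p a)))"
  proof (rule sum.cong[OF refl])
    fix c assume c: "c \<in> {..<N}"
    then have "inverse (rho_w c) * (rho_w (?p c) / rho_w b * (rho_w c / rho_w a)) = inverse (rho_w a * rho_w b) * inverse (rho_w c)"
      using rho_w_pri[OF assms(1), of c] rho_w_nonzero[OF assms(1)] by (simp add: field_simps)
    then show "cst (inverse (rho_w c)) * (kappa_fr (T b (?p c)) * kappa_fr (T a c)) =
        cst (inverse (rho_w a * rho_w b) * inverse (rho_w c)) * (T c (?p b) * T (?p c) (?p a))"
      using c assms by (simp add: kappa_fr_T cst_mult_mult cst_cst_mult pri_less pri_pri)
  qed
  also have "\<dots> = cst (inverse (rho_w a * rho_w b)) * (\<Sum>c<N. cst (inverse (rho_w c)) * (T c (?p b) * T (?p c) (?p a)))"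
    by (simp only: sum_distrib_left cst_cst_mult)
  finally have 1: "kappa_fr (\<Sum>c<N. cst (inverse (rho_w c)) * (T a c * T b (?p c)))
      = cst (inverse (rho_w a * rho_w b)) * (\<Sum>c<N. cst (inverse (rho_w c)) * (T c (?p b) * T (?p c) (?p a)))" .
  have "inverse (rho_w a) * inverse (rho_w (?p a)) = 1"
    using rho_w_pri[OF assms(1,2)] by (metis inverse_1 inverse_mult_distrib)
  then have 2: "metric N h $$ (a, b) = inverse (rho_w a * rho_w b) * metric N h $$ (?p b, ?p a)"
    using assms by (simp add: metric_pri metric_rho_w)
  show ?thesis
    unfolding metric_rel1_eq metric_rel2_eq metric_sum lin_ext_diff free_ext_cst 1 right_diff_distrib
    by (simp add: 2 cst_mult)
qed

lemma kappa_metric_rel2: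
  assumes "h \<noteq> 0" and "a < N" "b < N"
  shows "kappa_fr (metric_rel2 N h a b) = cst (rho_w a * rho_w b) * metric_rel1 N h (pri N b) (pri N a)"
proof -
  let ?p = "pri N"
  have "kappa_fr (\<Sum>c<N. cst (inverse (rho_w c)) * (T c a * T (?p c) b))
      = (\<Sum>c<N. cst (inverse (rho_w c)) * (kappa_fr (T (?p c) b) * kappa_fr (T c a)))"
    by (simp add: lin_ext_sum lin_ext_cst_mult free_ext_mult)
  also have "\<dots> = (\<Sum>c<N. cst (rho_w a * rho_w b * inverse (rho_w c)) * (T (?p b) c * T (?p a) (?p c)))"
  proof (rule sum.cong[OF refl])
    fix c assume c: "c \<in> {..<N}"
    then have "inverse (rho_w c) * (rho_w b / rho_w (?p c) * (rho_w a / rho_w c)) = rho_w a * rho_w b * inverse (rho_w c)"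
      using rho_w_pri[OF assms(1), of c] rho_w_nonzero[OF assms(1)] by (simp add: field_simps)
    then show "cst (inverse (rho_w c)) * (kappa_fr (T (?p c) b) * kappa_fr (T c a)) =
        cst (rho_w a * rho_w b * inverse (rho_w c)) * (T (?p b) c * T (?p a) (?p c))"
      using c assms by (simp add: kappa_fr_T cst_mult_mult cst_cst_mult pri_less pri_pri)
  qed
  also have "\<dots> = cst (rho_w a * rho_w b) * (\<Sum>c<N. cst (inverse (rho_w c)) * (T (?p b) c * T (?p a) (?p c)))"
    by (simp only: sum_distrib_left cst_cst_mult)
  finally have 1: "kappa_fr (\<Sum>c<N. cst (inverse (rho_w c)) * (T c a * T (?p c) b))
      = cst (rho_w a * rho_w b) * (\<Sum>c<N. cst (inverse (rho_w c)) * (T (?p b) c * T (?p a) (?p c)))" .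
  have 2: "metric N h $$ (a, b) = rho_w a * rho_w b * metric N h $$ (?p b, ?p a)"
    using assms rho_w_pri[OF assms(1,2)] by (simp add: metric_pri metric_rho_w)
  show ?thesis
    unfolding metric_rel1_eq metric_rel2_eq metric_sum lin_ext_diff free_ext_cst 1 right_diff_distrib
    by (simp add: 2 cst_mult)
qed

lemma kappa_O_rels:
  assumes "h \<noteq> 0" "x \<in> O_rels N h"
  shows "kappa_fr x \<in> O_ideal N h"
proof -
  from assms(2) consider
      (rtt) a b c d where "x = rtt_rel N h a b c d" "a < N" "b < N" "c < N" "d < N"
    | (rel1) a b where "x = metric_rel1 N h a b" "a < N" "b < N"
    | (rel2) a b where "x = metric_rel2 N h a b" "a < N" "b < N"
    unfolding O_rels_def by blast
  then show ?thesis
    by cases (simp_all add: assms(1) kappa_rtt kappa_metric_rel1 kappa_metric_rel2 O.uminus_mem_ideal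
        O.cst_mult_mem_ideal rtt_mem metric_rel1_mem metric_rel2_mem pri_less)
qed

lemma kappa_O_ideal:
  assumes "h \<noteq> 0" "x \<in> O_ideal N h"
  shows "kappa_fr x \<in> O_ideal N h"
  by (rule O_ideal_image[OF O.monoid_alg_ideal_axioms lin_ext_additive, where a = True])
    (use assms kappa_O_rels keys_kappa_fr in \<open>simp_all add: free_ext_mult\<close>)

text \<open>This is multiplication after \<kappa> \<otimes> id. It is neither multiplicative nor
  antimultiplicative, so \<open>genideal_image\<close> does not cover it and its effect on the ideal
  is treated separately.\<close>

definition antipode_conv :: "ttens \<Rightarrow> talg" where
  "antipode_conv = lin_ext False (\<lambda>(v, w). word_ext True kappa_letter v * Poly_Mapping.single w 1)"

lemma antipode_conv_additive: "additive antipode_conv"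
  by (simp add: antipode_conv_def lin_ext_additive)

lemmas antipode_conv_add = additive.add[OF antipode_conv_additive]
  and antipode_conv_sum = additive.sum[OF antipode_conv_additive]
  and antipode_conv_diff = additive.diff[OF antipode_conv_additive]
  and antipode_conv_zero = additive.zero[OF antipode_conv_additive]

lemma antipode_conv_tens: "antipode_conv (tens p r) = kappa_fr p * r"
proof (rule poly_mapping_single_induct[of p UNIV])
  fix v c
  show "antipode_conv (tens (Poly_Mapping.single v c) r) = kappa_fr (Poly_Mapping.single v c) * r"
  proof (rule poly_mapping_single_induct[of r UNIV])
    fix w :: "(nat \<times> nat) list" and d
    have e: "cst d * Poly_Mapping.single w 1 = Poly_Mapping.single w d"
      by (simp add: cst_times_single)
    have "antipode_conv (tens (Poly_Mapping.single v c) (Poly_Mapping.single w d))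
        = cst (c * d) * (word_ext True kappa_letter v * Poly_Mapping.single w 1)"
      by (simp add: antipode_conv_def tens_single)
    also have "\<dots> = kappa_fr (Poly_Mapping.single v c) * Poly_Mapping.single w d"
      by (simp only: lin_ext_single cj_simps cst_mult_mult[symmetric] e)
    finally show "antipode_conv (tens (Poly_Mapping.single v c) (Poly_Mapping.single w d))
        = kappa_fr (Poly_Mapping.single v c) * Poly_Mapping.single w d" .
  qed (auto simp: tens_add_right antipode_conv_add antipode_conv_zero distrib_left)
qed (auto simp: tens_add_left antipode_conv_add antipode_conv_zero lin_ext_add distrib_right)

lemma single_pair_tens: "Poly_Mapping.single (v, w) z = tens (Poly_Mapping.single v z) (Poly_Mapping.single w 1)"
  by (simp add: tens_single)

text \<open>Modulo T^t C T = C the product \<kappa>(T) T = C T^t C T becomes C C = 1, because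
  q^{\<rho>_a + \<rho>_{a'}} = 1.\<close>

lemma kappa_left_inverse_letter:
  assumes "h \<noteq> 0" "a < N" "b < N"
  shows "(\<Sum>c<N. kappa_fr (T a c) * T c b) - cst (if a = b then 1 else 0) \<in> O_ideal N h"
proof -
  let ?p = "pri N"
  have "(\<Sum>c<N. cst (inverse (rho_w c)) * (T c (?p a) * T (?p c) b))
      = (\<Sum>c<N. cst (inverse (rho_w (?p c))) * (T (?p c) (?p a) * T (?p (?p c)) b))"
    by (rule sum_involution[symmetric, of N "?p"]) (simp_all add: pri_less pri_pri)
  also have "cst (inverse (rho_w a)) * \<dots> = (\<Sum>c<N. kappa_fr (T a c) * T c b)"
    unfolding sum_distrib_left
  proof (rule sum.cong[OF refl])
    fix c assume c: "c \<in> {..<N}"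
    then have "inverse (rho_w (?p c)) = rho_w c"
      using rho_w_pri[OF assms(1), of c] by (metis inverse_unique lessThan_iff mult.commute)
    then show "cst (inverse (rho_w a)) * (cst (inverse (rho_w (?p c))) * (T (?p c) (?p a) * T (?p (?p c)) b))
        = kappa_fr (T a c) * T c b"
      using c assms by (simp add: kappa_fr_T pri_pri cst_cst_mult mult.assoc divide_inverse mult.commute)
  qed
  finally have "cst (inverse (rho_w a)) * metric_rel2 N h (?p a) b
      = (\<Sum>c<N. kappa_fr (T a c) * T c b) - cst (inverse (rho_w a) * metric N h $$ (?p a, b))"
    unfolding metric_rel2_eq metric_sum right_diff_distrib by (simp only: cst_mult)
  also have "inverse (rho_w a) * metric N h $$ (?p a, b) = (if a = b then 1 else 0)"
    using rho_w_pri[OF assms(1,2)] assms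
    by (auto simp: metric_rho_w pri_less pri_pri inverse_eq_divide field_simps)
  finally show ?thesis
    using O.cst_mult_mem_ideal[OF metric_rel2_mem[of "?p a" b]] assms by (metis pri_less)
qed

text \<open>\<kappa> reverses products, so for y = p \<otimes> r the sum of \<kappa>(T^a_c) T^c_b
  ends up between \<kappa>(p) and r, where it may be replaced by the counit.\<close>

lemma antipode_conv_letter:
  assumes "h \<noteq> 0" "a < N" "b < N" "Poly_Mapping.keys y \<subseteq> W2"
  shows "antipode_conv (Delta_free N (T a b) * y) - cst (if a = b then 1 else 0) * antipode_conv y \<in> O_ideal N h"
  using assms(4)
proof (induction y rule: poly_mapping_single_induct)
  case zero
  then show ?case by (simp add: antipode_conv_zero O.zero_mem_ideal)
next
  case (single m z)
  then obtain v w where m: "m = (v, w)" "v \<in> W" "w \<in> W" by blast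
  let ?p = "Poly_Mapping.single v z :: talg" and ?r = "Poly_Mapping.single w 1 :: talg"
  let ?G = "(\<Sum>c<N. kappa_fr (T a c) * T c b) - cst (if a = b then 1 else 0)"
  have "antipode_conv (Delta_free N (T a b) * tens ?p ?r) = (\<Sum>c<N. kappa_fr (T a c * ?p) * (T c b * ?r))"
    by (simp only: Delta_free_T sum_distrib_right tens_mult[symmetric] antipode_conv_sum antipode_conv_tens)
  also have "\<dots> = kappa_fr ?p * (\<Sum>c<N. kappa_fr (T a c) * T c b) * ?r"
    by (simp only: free_ext_mult if_True sum_distrib_left sum_distrib_right mult.assoc)
  finally have "antipode_conv (Delta_free N (T a b) * tens ?p ?r)
      - cst (if a = b then 1 else 0) * antipode_conv (tens ?p ?r) = kappa_fr ?p * ?G * ?r"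
    by (simp only: antipode_conv_tens right_diff_distrib left_diff_distrib cst_central[of "kappa_fr _"] mult.assoc)
  moreover have "kappa_fr ?p * ?G * ?r \<in> O_ideal N h"
    using m by (intro O.mult_right_mem_ideal O.mult_left_mem_ideal kappa_left_inverse_letter assms keys_kappa_fr)
      (auto split: if_splits)
  ultimately show ?case
    unfolding m(1) single_pair_tens by (simp only:)
next
  case (add x y)
  then show ?case
    using O.add_mem_ideal[OF add] by (simp add: distrib_left antipode_conv_add algebra_simps)
qed

lemma eps_free_single_Cons:
  "cst (eps_free (Poly_Mapping.single ((a, b) # w) 1))
    = cst (if a = b then 1 else 0) * (cst (eps_free (Poly_Mapping.single w 1)) :: talg)"
  unfolding cst_eps_free by (simp add: word_ext_def eps_letter_def)

text \<open>The antipode axiom modulo \<open>O_ideal\<close>, obtained by stripping letters from the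
  left of a word.\<close>

lemma antipode_conv_Delta:
  assumes "h \<noteq> 0" "Poly_Mapping.keys p \<subseteq> W"
  shows "antipode_conv (Delta_free N p) - cst (eps_free p) \<in> O_ideal N h"
  using assms(2)
proof (induction p rule: poly_mapping_single_induct)
  case zero
  then show ?case
    by (simp add: additive.zero[OF Delta_free_additive] antipode_conv_zero additive.zero[OF eps_free_additive]
        O.zero_mem_ideal)
next
  case (single w z)
  have *: "antipode_conv (Delta_free N (Poly_Mapping.single w 1)) - cst (eps_free (Poly_Mapping.single w 1)) \<in> O_ideal N h"
    using single
  proof (induction w)
    case Nil
    have "antipode_conv 1 = 1"
      using antipode_conv_tens[of 1 1] by (simp add: tens_one_one free_ext_one)
    moreover have "cst (eps_free 1) = (1 :: talg)"
      unfolding cst_eps_free by (rule free_ext_one)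
    ultimately show ?case
      using Delta_free_cst[of 1] by (simp add: zero_list_eq[symmetric] O.zero_mem_ideal)
  next
    case (Cons x w)
    then obtain a b where x: "x = (a, b)" "a < N" "b < N" by auto
    let ?w = "Poly_Mapping.single w 1 :: talg" and ?d = "cst (if a = b then 1 else 0) :: talg"
    have "Poly_Mapping.keys (Delta_free N ?w) \<subseteq> W2"
      using Cons by (intro keys_Delta_free) auto
    from antipode_conv_letter[OF assms(1) x(2,3) this]
      O.cst_mult_mem_ideal[OF Cons.IH, of "if a = b then 1 else 0"]
    have "(antipode_conv (Delta_free N (T a b) * Delta_free N ?w) - ?d * antipode_conv (Delta_free N ?w))
        + ?d * (antipode_conv (Delta_free N ?w) - cst (eps_free ?w)) \<in> O_ideal N h"
      by (rule O.add_mem_ideal)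
    also have "(antipode_conv (Delta_free N (T a b) * Delta_free N ?w) - ?d * antipode_conv (Delta_free N ?w))
        + ?d * (antipode_conv (Delta_free N ?w) - cst (eps_free ?w))
      = antipode_conv (Delta_free N (T a b * ?w)) - ?d * cst (eps_free ?w)"
      by (simp only: Delta_free_mult right_diff_distrib) simp
    also have "T a b * ?w = Poly_Mapping.single (x # w) 1"
      using single_Cons[of x w 1] by (simp add: T_def x)
    finally show ?case
      unfolding x(1) eps_free_single_Cons .
  qed
  have "Poly_Mapping.single w z = cst z * (Poly_Mapping.single w 1 :: talg)"
    by (simp add: cst_times_single)
  moreover have "antipode_conv (cst z * y) = cst z * antipode_conv y" for y
    by (simp add: antipode_conv_def lin_ext_cst_mult)
  moreover have "cst (eps_free (cst z * y)) = cst z * (cst (eps_free y) :: talg)" for y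
    by (simp add: cst_eps_free lin_ext_cst_mult)
  ultimately show ?case
    using O.cst_mult_mem_ideal[OF *, of z] by (simp only: Delta_free_mult Delta_free_cst right_diff_distrib)
next
  case (add x y)
  then show ?case
    using O.add_mem_ideal[OF add]
    by (simp add: additive.add[OF Delta_free_additive] antipode_conv_add additive.add[OF eps_free_additive]
        cst_add algebra_simps)
qed

text \<open>For pure s and t the element s (i \<otimes> j) t goes to \<kappa>(s_1 i t_1) s_2 j t_2,
  which lies in the ideal as soon as \<open>i\<close> or \<open>j\<close> does. This replaces
  multiplicativity.\<close>

lemma antipode_conv_mult:
  assumes "h \<noteq> 0" "i \<in> O_ideal N h \<or> j \<in> O_ideal N h" "Poly_Mapping.keys i \<subseteq> W" "Poly_Mapping.keys j \<subseteq> W"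
    and "Poly_Mapping.keys s \<subseteq> W2" "Poly_Mapping.keys t \<subseteq> W2"
  shows "antipode_conv (s * tens i j * t) \<in> O_ideal N h"
  using assms(5)
proof (induction s rule: poly_mapping_single_induct)
  case zero
  then show ?case by (simp add: antipode_conv_zero O.zero_mem_ideal)
next
  case (single m z)
  then obtain v w where m: "m = (v, w)" "v \<in> W" "w \<in> W" by blast
  from assms(6) show ?case
  proof (induction t rule: poly_mapping_single_induct)
    case zero
    then show ?case by (simp add: antipode_conv_zero O.zero_mem_ideal)
  next
    case (single m' z')
    then obtain v' w' where m': "m' = (v', w')" "v' \<in> W" "w' \<in> W" by blast
    define s1 s2 t1 t2 :: talg where st: "s1 = Poly_Mapping.single v z" "s2 = Poly_Mapping.single w 1"
      "t1 = Poly_Mapping.single v' z'" "t2 = Poly_Mapping.single w' 1"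
    have keys: "Poly_Mapping.keys s1 \<subseteq> W" "Poly_Mapping.keys s2 \<subseteq> W" "Poly_Mapping.keys t1 \<subseteq> W" "Poly_Mapping.keys t2 \<subseteq> W"
      using m m' by (auto simp: st)
    have "antipode_conv (Poly_Mapping.single m z * tens i j * Poly_Mapping.single m' z')
        = kappa_fr (s1 * i * t1) * (s2 * j * t2)"
      unfolding m(1) m'(1) single_pair_tens st by (simp only: tens_mult[symmetric] antipode_conv_tens)
    moreover have "kappa_fr (s1 * i * t1) * (s2 * j * t2) \<in> O_ideal N h"
      using assms(2)
    proof
      assume "i \<in> O_ideal N h"
      then show ?thesis
        by (intro O.mult_right_mem_ideal kappa_O_ideal O.mult_left_mem_ideal assms W.keys_mult_subset keys)
    next
      assume "j \<in> O_ideal N h"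
      then show ?thesis
        by (intro O.mult_left_mem_ideal[of "s2 * j * t2"] O.mult_right_mem_ideal O.mult_left_mem_ideal[of j]
            keys_kappa_fr assms W.keys_mult_subset keys)
    qed
    ultimately show ?case by (simp only:)
  next
    case (add x y)
    then show ?case
      using O.add_mem_ideal[OF add] by (simp add: distrib_left antipode_conv_add)
  qed
next
  case (add x y)
  then show ?case
    using O.add_mem_ideal[OF add] by (simp add: distrib_right antipode_conv_add)
qed

lemma antipode_conv_ideal:
  assumes "h \<noteq> 0" "x \<in> tensor_ideal (T_idx N) (O_ideal N h) (T_idx N) (O_ideal N h)"
  shows "antipode_conv x \<in> O_ideal N h"
proof -
  interpret W2: submonoid_alg W2 by (rule submonoid_lists_Times)
  note gens = tensor_ideal_ideal(2)[OF O.monoid_alg_ideal_axioms O.monoid_alg_ideal_axioms]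
  show ?thesis
    using assms(2)[unfolded tensor_ideal_def] gens
  proof (induction rule: W2.genideal_induct)
    case zero
    then show ?case by (simp add: antipode_conv_zero O.zero_mem_ideal)
  next
    case (add x y)
    then show ?case by (simp add: antipode_conv_add O.add_mem_ideal)
  next
    case (gen s g t)
    from gen(2) obtain i j where "g = tens i j" "i \<in> O_ideal N h \<or> j \<in> O_ideal N h"
      "Poly_Mapping.keys i \<subseteq> W" "Poly_Mapping.keys j \<subseteq> W"
      using O.mem_carrier W.keys_one_subset by blast
    then show ?case
      using antipode_conv_mult[OF assms(1)] gen(1,3) by blast
  qed
qed

text \<open>Multiplication after \<kappa> \<otimes> id, applied to \<Delta>(D) \<equiv> D \<otimes>
  D, gives \<epsilon>(D) = 1 on one side and \<kappa>(D) D on the other. This happens modulo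
  \<open>O_ideal\<close>; only afterwards does D \<equiv> 1 enter.\<close>

lemma kappa_qdet:
  assumes "h \<noteq> 0" "is_qdet N h D"
  shows "kappa_fr D - 1 \<in> SO_ideal N h"
proof -
  have D: "Poly_Mapping.keys D \<subseteq> W" and eps: "eps_free D = 1"
    and Delta: "Delta_free N D - tens D D \<in> tensor_ideal (T_idx N) (O_ideal N h) (T_idx N) (O_ideal N h)"
    using assms(2) by (simp_all add: is_qdet_def)
  have "antipode_conv (Delta_free N D) - 1 \<in> O_ideal N h"
    using antipode_conv_Delta[OF assms(1) D] by (simp add: eps)
  moreover have "antipode_conv (Delta_free N D) - kappa_fr D * D \<in> O_ideal N h"
    using antipode_conv_ideal[OF assms(1) Delta] by (simp add: antipode_conv_diff antipode_conv_tens)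
  ultimately have "(antipode_conv (Delta_free N D) - 1) - (antipode_conv (Delta_free N D) - kappa_fr D * D) \<in> O_ideal N h"
    by (rule O.diff_mem_ideal)
  then have "kappa_fr D * D - 1 \<in> SO_ideal N h"
    using O_subset_SO by auto
  moreover have "kappa_fr D * (D - 1) \<in> SO_ideal N h"
    by (rule SO.mult_left_mem_ideal[OF qdet_mem[OF assms(2)] keys_kappa_fr[OF D]])
  ultimately have "(kappa_fr D * D - 1) - kappa_fr D * (D - 1) \<in> SO_ideal N h"
    by (rule SO.diff_mem_ideal)
  then show ?thesis by (simp add: right_diff_distrib)
qed

lemma kappa_SO_ideal:
  assumes "h \<noteq> 0" "x \<in> SO_ideal N h"
  shows "kappa_fr x \<in> SO_ideal N h"
proof (rule SO_ideal_image[OF SO.monoid_alg_ideal_axioms lin_ext_additive, where a = True])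
  fix D assume "is_qdet N h D"
  then show "kappa_fr (D - 1) \<in> SO_ideal N h"
    using kappa_qdet[OF assms(1)] by (simp add: lin_ext_diff free_ext_one)
next
  show "kappa_fr x \<in> SO_ideal N h" if "x \<in> O_rels N h" for x
    using kappa_O_rels[OF assms(1) that] O_subset_SO by blast
qed (use assms keys_kappa_fr in \<open>simp_all add: free_ext_mult\<close>)

end

section \<open>Monomial maps\<close>

context quantum_group
begin

section \<open>The ideal of the quantum exterior algebra\<close>

definition ext_rel :: "nat \<Rightarrow> nat \<Rightarrow> (nat list \<Rightarrow>\<^sub>0 complex)" where
  "ext_rel a b = (\<Sum>c<N. \<Sum>d<N. cst ((if a = c \<and> b = d then 1 else 0) - PA N h a b c d) * (var c * var d))"

lemma ext_ideal_eq: "ext_ideal N h = Idl\<^bsub>free_alg {..<N}\<^esub> {ext_rel a b | a b. a < N \<and> b < N}"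
  by (simp add: ext_ideal_def ext_rel_def mult.assoc)

lemma keys_var: "x \<in> A \<Longrightarrow> Poly_Mapping.keys (var x) \<subseteq> lists A"
  by (simp add: var_def)

lemma ext_rels_carrier: "{ext_rel a b | a b. a < N \<and> b < N} \<subseteq> carrier (free_alg {..<N})"
proof
  interpret X: submonoid_alg "lists {..<N}" by (rule submonoid_lists)
  fix x assume "x \<in> {ext_rel a b | a b. a < N \<and> b < N}"
  then obtain a b where x: "x = ext_rel a b" by blast
  have "Poly_Mapping.keys (ext_rel a b) \<subseteq> lists {..<N}"
    unfolding ext_rel_def
    by (rule X.keys_sum_subset X.keys_mult_subset X.keys_cst_subset keys_var | assumption)+
  then show "x \<in> carrier (free_alg {..<N})" by (simp only: x monoid_alg_simps mem_Collect_eq)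
qed

sublocale X: monoid_alg_ideal "lists {..<N}" "ext_ideal N h"
  unfolding ext_ideal_eq by (rule monoid_alg_idealI[OF submonoid_lists ext_rels_carrier])

lemma ext_rel_mem: "a < N \<Longrightarrow> b < N \<Longrightarrow> ext_rel a b \<in> ext_ideal N h"
  unfolding ext_ideal_eq by (rule genideal_mem[OF submonoid_lists ext_rels_carrier]) blast

lemma coact_free_eq: "coact_free N = free_ext False False (\<lambda>a. \<Sum>b<N. tens (T a b) (var b))"
  by (simp add: coact_free_def alg_ext_word)

lemma coact_ideal: "monoid_alg_ideal (lists (T_idx N) \<times> lists {..<N}) (tensor_ideal (T_idx N) (O_ideal N h) {..<N} (ext_ideal N h))"
  by (rule tensor_ideal_ideal(1)[OF O.monoid_alg_ideal_axioms X.monoid_alg_ideal_axioms])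

lemma eps_free_mult: "eps_free (p * r) = eps_free p * eps_free r"
proof -
  have "cst (eps_free (p * r)) = (cst (eps_free p * eps_free r) :: talg)"
    by (simp add: cst_mult cst_eps_free free_ext_mult)
  then show ?thesis by (simp only: cst_inject)
qed

lemma eps_free_cst: "eps_free (cst z) = z"
proof -
  have "cst (eps_free (cst z)) = (cst z :: talg)"
    by (simp add: cst_eps_free free_ext_cst)
  then show ?thesis by (simp only: cst_inject)
qed

lemma eps_free_var: "eps_free (var (a, c)) = (if a = c then 1 else 0)"
proof -
  have "cst (eps_free (var (a, c))) = (cst (if a = c then 1 else 0) :: talg)"
    by (simp add: cst_eps_free free_ext_var eps_letter_def)
  then show ?thesis by (simp only: cst_inject)
qed

end

text \<open>
  The maps \<open>T\<^sup>a\<^sub>c \<mapsto> u\<^sub>a u\<^sub>c\<^sup>-\<^sup>1 T\<^bsup>\<tau> a\<^esup>\<^bsub>\<tau> c\<^esub>\<close>, linear and multiplicative or, if \<open>b\<close> holds, antilinear and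
  antimultiplicative. The automorphism \<open>\<sharp>\<close>, the conjugations and their composites are all of this form.
\<close>

locale monomial_map = quantum_group +
  fixes b :: bool and \<tau> :: "nat \<Rightarrow> nat" and u :: "nat \<Rightarrow> complex"
  assumes tau_less: "a < N \<Longrightarrow> \<tau> a < N"
    and tau_tau: "a < N \<Longrightarrow> \<tau> (\<tau> a) = a"
    and u_nonzero: "a < N \<Longrightarrow> u a \<noteq> 0"
begin

definition letter :: "nat \<times> nat \<Rightarrow> talg" where
  "letter = (\<lambda>(a, c). cst (u a / u c) * T (\<tau> a) (\<tau> c))"

abbreviation phi :: "talg \<Rightarrow> talg" where
  "phi \<equiv> free_ext b b letter"

abbreviation phi2 :: "ttens \<Rightarrow> ttens" where
  "phi2 \<equiv> tensor_map b (word_ext b letter) (word_ext b letter)"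

text \<open>The coordinates scale by u_a, not by a ratio: then T^a_c \<otimes> \<xi>^c acquires (u_a
  / u_c) u_c, which no longer depends on the summation index.\<close>

definition ext_letter :: "nat \<Rightarrow> (nat list \<Rightarrow>\<^sub>0 complex)" where
  "ext_letter a = cst (u a) * var (\<tau> a)"

abbreviation psi :: "(nat list \<Rightarrow>\<^sub>0 complex) \<Rightarrow> (nat list \<Rightarrow>\<^sub>0 complex)" where
  "psi \<equiv> free_ext b b ext_letter"

lemma tau_eq_iff: "a < N \<Longrightarrow> c < N \<Longrightarrow> \<tau> a = \<tau> c \<longleftrightarrow> a = c"
  by (metis tau_tau)

lemma phi_T: "phi (T a c) = cst (u a / u c) * T (\<tau> a) (\<tau> c)"
  by (simp add: T_def free_ext_var letter_def)

lemma psi_var: "psi (var a) = cst (u a) * var (\<tau> a)"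
  by (simp add: free_ext_var ext_letter_def)

lemma keys_letter:
  assumes "x \<in> T_idx N"
  shows "Poly_Mapping.keys (letter x) \<subseteq> W"
proof -
  obtain a c where x: "x = (a, c)" "a < N" "c < N" using assms by auto
  show ?thesis
    unfolding x(1) letter_def prod.case
    by (rule W.keys_mult_subset[OF W.keys_cst_subset keys_T[OF tau_less[OF x(2)] tau_less[OF x(3)]]])
qed

lemma keys_phi: "Poly_Mapping.keys p \<subseteq> W \<Longrightarrow> Poly_Mapping.keys (phi p) \<subseteq> W"
  by (rule keys_free_ext[OF submonoid_lists keys_letter])

lemma keys_ext_letter: "x \<in> {..<N} \<Longrightarrow> Poly_Mapping.keys (ext_letter x) \<subseteq> lists {..<N}"
  unfolding ext_letter_def by (intro X.keys_mult_subset X.keys_cst_subset keys_var) (simp add: tau_less)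

lemma keys_psi: "Poly_Mapping.keys p \<subseteq> lists {..<N} \<Longrightarrow> Poly_Mapping.keys (psi p) \<subseteq> lists {..<N}"
  by (rule keys_free_ext[OF submonoid_lists keys_ext_letter])

lemma sum_tau: "(\<Sum>c<N. F (\<tau> c)) = (\<Sum>c<N. F c)"
  by (rule sum_involution[OF tau_less tau_tau])

lemma sum_tau2: "(\<Sum>c<N. \<Sum>d<N. F (\<tau> c) (\<tau> d)) = (\<Sum>c<N. \<Sum>d<N. F c d)"
  by (rule sum_involution2[OF tau_less tau_tau])

text \<open>Both sides have the letter values \<open>f\<close>: the weights telescope as (u_a /
  u_g)(u_g / u_c), and \<tau> merely permutes the summation index g.\<close>

lemma Delta_phi:
  assumes "Poly_Mapping.keys p \<subseteq> W"
  shows "Delta_free N (phi p) = phi2 (Delta_free N p)"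
proof -
  define f where "f = (\<lambda>(a, c). \<Sum>g<N. cst (u a / u c) * tens (T (\<tau> a) g) (T g (\<tau> c)))"
  have "Delta_free N (phi p) = free_ext b b f p"
    by (rule free_ext_unique[where A = "T_idx N", OF additive_comp[OF Delta_free_additive lin_ext_additive]])
      (auto simp: free_ext_cst Delta_free_cst free_ext_mult Delta_free_mult assms f_def Delta_free_T
        phi_T[unfolded T_def] Delta_free_T[unfolded T_def] T_def sum_distrib_left)
  moreover have "phi2 (Delta_free N p) = free_ext b b f p"
  proof (rule free_ext_unique[where A = "T_idx N", OF additive_comp[OF additive_tensor_map Delta_free_additive]])
    show "phi2 (Delta_free N (cst z)) = cst (cj b z)" for z
      by (simp add: Delta_free_cst tensor_map_def lin_ext_cst zero_prod_def tens_one_one)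
    show "phi2 (Delta_free N (p * r)) = (if b then phi2 (Delta_free N r) * phi2 (Delta_free N p)
        else phi2 (Delta_free N p) * phi2 (Delta_free N r))" for p r
      unfolding Delta_free_mult by (rule tensor_map_mult) (rule word_ext_add)+
    fix x assume "x \<in> T_idx N"
    then obtain a c where x: "x = (a, c)" "a < N" "c < N" by auto
    have "phi2 (Delta_free N (T a c)) = (\<Sum>g<N. tens (phi (T a g)) (phi (T g c)))"
      by (simp only: Delta_free_T additive.sum[OF additive_tensor_map] tensor_map_tens)
    also have "\<dots> = (\<Sum>g<N. cst (u a / u c) * tens (T (\<tau> a) (\<tau> g)) (T (\<tau> g) (\<tau> c)))"
      by (rule sum.cong[OF refl]) (simp add: phi_T tens_cst_left tens_cst_right cst_cst_mult u_nonzero)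
    also have "\<dots> = (\<Sum>g<N. cst (u a / u c) * tens (T (\<tau> a) g) (T g (\<tau> c)))"
      by (rule sum_tau)
    finally show "phi2 (Delta_free N (var x)) = f x"
      by (simp add: x f_def T_def)
  qed (rule assms)
  ultimately show ?thesis by (simp only:)
qed

lemma eps_phi:
  assumes "Poly_Mapping.keys p \<subseteq> W"
  shows "eps_free (phi p) = cj b (eps_free p)"
proof -
  have "additive (\<lambda>p. cst (cj b (eps_free p)) :: talg)"
    by (simp add: additive_def additive.add[OF eps_free_additive] cst_add)
  then have "(cst (cj b (eps_free p)) :: talg) = free_ext b b eps_letter p"
    by (rule free_ext_unique[OF _ _ _ _ assms])
      (auto simp: eps_free_cst eps_free_mult cst_mult cst_central[of "cst _"] eps_free_var eps_letter_def
        mult.commute)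
  moreover have "additive (\<lambda>p. cst (eps_free (phi p)) :: talg)"
    by (simp add: additive_def additive.add[OF eps_free_additive] lin_ext_add cst_add)
  then have "(cst (eps_free (phi p)) :: talg) = free_ext b b eps_letter p"
  proof (rule free_ext_unique[OF _ _ _ _ assms])
    fix x assume "x \<in> T_idx N"
    then obtain a c where x: "x = (a, c)" "a < N" "c < N" by auto
    have "cst (eps_free (phi (T a c))) = (cst (u a / u c) * cst (if \<tau> a = \<tau> c then 1 else 0) :: talg)"
      unfolding cst_eps_free phi_T free_ext_mult if_False free_ext_cst eps_letter_T cj_simps ..
    then show "cst (eps_free (phi (var x))) = eps_letter x"
      using u_nonzero[OF x(2)] by (auto simp: x T_def eps_letter_def tau_eq_iff)
  qed (auto simp: free_ext_cst eps_free_cst free_ext_mult eps_free_mult cst_mult)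
  ultimately have "cst (eps_free (phi p)) = (cst (cj b (eps_free p)) :: talg)" by simp
  then show ?thesis by (simp only: cst_inject)
qed

lemma coact_psi:
  assumes "Poly_Mapping.keys p \<subseteq> lists {..<N}"
  shows "coact_free N (psi p) = tensor_map b (word_ext b letter) (word_ext b ext_letter) (coact_free N p)"
proof -
  let ?m = "tensor_map b (word_ext b letter) (word_ext b ext_letter)"
  define f :: "nat \<Rightarrow> _" where "f = (\<lambda>a. \<Sum>g<N. cst (u a) * tens (T (\<tau> a) g) (var g))"
  have var: "coact_free N (var a) = (\<Sum>g<N. tens (T a g) (var g))" for a
    by (simp add: coact_free_eq free_ext_var)
  have cst: "coact_free N (cst z) = cst z" for z
    by (simp add: coact_free_eq free_ext_cst)
  have mult: "coact_free N (p * r) = coact_free N p * coact_free N r" for p r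
    by (simp add: coact_free_eq free_ext_mult)
  have add: "additive (coact_free N)"
    by (simp add: coact_free_eq lin_ext_additive)
  have "coact_free N (psi p) = free_ext b b f p"
    by (rule free_ext_unique[where A = "{..<N}", OF additive_comp[OF add lin_ext_additive]])
      (auto simp: free_ext_cst cst free_ext_mult mult assms f_def psi_var var sum_distrib_left)
  moreover have "?m (coact_free N p) = free_ext b b f p"
  proof (rule free_ext_unique[where A = "{..<N}", OF additive_comp[OF additive_tensor_map add]])
    show "?m (coact_free N (cst z)) = cst (cj b z)" for z
      by (simp add: cst tensor_map_def lin_ext_cst zero_prod_def tens_one_one)
    show "?m (coact_free N (p * r)) = (if b then ?m (coact_free N r) * ?m (coact_free N p)
        else ?m (coact_free N p) * ?m (coact_free N r))" for p r
      unfolding mult by (rule tensor_map_mult) (rule word_ext_add)+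
    fix a assume "a \<in> {..<N}"
    have "?m (coact_free N (var a)) = (\<Sum>g<N. tens (phi (T a g)) (psi (var g)))"
      by (simp only: var additive.sum[OF additive_tensor_map] tensor_map_tens)
    also have "\<dots> = (\<Sum>g<N. cst (u a) * tens (T (\<tau> a) (\<tau> g)) (var (\<tau> g)))"
      by (rule sum.cong[OF refl])
        (simp add: phi_T psi_var tens_cst_left tens_cst_right cst_cst_mult u_nonzero)
    also have "\<dots> = (\<Sum>g<N. cst (u a) * tens (T (\<tau> a) g) (var g))"
      by (rule sum_tau)
    finally show "?m (coact_free N (var a)) = f a" by (simp add: f_def)
  qed (rule assms)
  ultimately show ?thesis by (simp only:)
qed

text \<open>\<open>is_qdet\<close> quantifies over all forms of degree N, so testing the image of a
  determinant on a form requires a preimage under \<open>psi\<close>. Words suffice, since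
  \<open>psi\<close> maps each word to a nonzero multiple of a word of the same length.\<close>

lemma psi_single_surj:
  assumes "w \<in> lists {..<N}"
  obtains w' z' where "w' \<in> lists {..<N}" "length w' = length w"
    "Poly_Mapping.single w z = psi (Poly_Mapping.single w' z')"
proof -
  \<comment> \<open>If \<open>b\<close> holds, \<open>psi\<close> reverses words, so the preimage is
    reversed in advance.\<close>
  define w' where "w' = map \<tau> (if b then rev w else w)"
  have "prod_list (map ext_letter (map \<tau> v)) = Poly_Mapping.single v (prod_list (map (\<lambda>a. u (\<tau> a)) v))"
    if "v \<in> lists {..<N}" for v
    using that
  proof (induction v)
    case (Cons a v)
    then show ?case
      by (simp add: ext_letter_def tau_tau cst_def var_def mult_single plus_list_eq zero_list_eq)
  next
    case Nil
    have "Poly_Mapping.single ([] :: nat list) (1 :: complex) = 1"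
      by (metis single_one zero_list_eq)
    then show ?case by simp
  qed
  moreover have "(if b then rev w' else w') = map \<tau> w"
    by (simp add: w'_def rev_map)
  ultimately have *: "word_ext b ext_letter w' = Poly_Mapping.single w (prod_list (map (\<lambda>a. u (\<tau> a)) w))"
    using assms by (simp only: word_ext_def)
  have nz: "prod_list (map (\<lambda>a. u (\<tau> a)) w) \<noteq> 0"
    using assms by (auto simp: prod_list_zero_iff u_nonzero tau_less)
  show thesis
  proof (rule that)
    show "w' \<in> lists {..<N}" using assms by (auto simp: w'_def tau_less)
    show "length w' = length w" by (simp add: w'_def)
    show "Poly_Mapping.single w z = psi (Poly_Mapping.single w' (cj b (z / prod_list (map (\<lambda>a. u (\<tau> a)) w))))"
      using nz by (simp only: lin_ext_single * cst_times_single cj_simps) simp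
  qed
qed

end

text \<open>Conditions on the numerical data under which a monomial map respects all relations. For
  antimultiplicative maps each of them exchanges the two tensor factors. The constant \<mu> measures
  how far the conjugate of \<open>R\<close> is from R_21 relabelled by \<tau>: it is 0 for \<star>
  and q - q^{-1} for \<times>.\<close>

locale monomial_symmetry = monomial_map +
  fixes \<mu> :: complex
  assumes u_pri: "a < N \<Longrightarrow> u a * u (pri N a) = 1"
    and metric_tau: "a < N \<Longrightarrow> c < N \<Longrightarrow>
      cj b (metric N h $$ (a, c)) = (if b then metric N h $$ (\<tau> c, \<tau> a) else metric N h $$ (\<tau> a, \<tau> c))"
    and PA_tau: "a < N \<Longrightarrow> a' < N \<Longrightarrow> c < N \<Longrightarrow> c' < N \<Longrightarrow>
      cj b (PA N h a a' c c') = (if b then PA N h (\<tau> a') (\<tau> a) (\<tau> c') (\<tau> c) else PA N h (\<tau> a) (\<tau> a') (\<tau> c) (\<tau> c'))"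
    and Rm_tau_hom: "\<not> b \<Longrightarrow> a < N \<Longrightarrow> a' < N \<Longrightarrow> c < N \<Longrightarrow> c' < N \<Longrightarrow>
      Rm N h (\<tau> a) (\<tau> a') (\<tau> c) (\<tau> c') = Rm N h a a' c c'"
    and Rm_tau_anti: "b \<Longrightarrow> a < N \<Longrightarrow> a' < N \<Longrightarrow> c < N \<Longrightarrow> c' < N \<Longrightarrow>
      cnj (Rm N h a a' c c') = Rm N h (\<tau> a') (\<tau> a) (\<tau> c') (\<tau> c)
        - \<mu> * ((if a = c' \<and> a' = c then 1 else 0) - metric N h $$ (\<tau> a, \<tau> a') * metric N h $$ (\<tau> c', \<tau> c))"
begin

lemma metric_weight: "a < N \<Longrightarrow> c < N \<Longrightarrow> metric N h $$ (a, c) = 0 \<or> u a * u c = 1"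
  by (simp add: metric_nth u_pri)

lemma R_weight: "a < N \<Longrightarrow> a' < N \<Longrightarrow> c < N \<Longrightarrow> c' < N \<Longrightarrow> Rm N h a a' c c' = 0 \<or> u a * u a' = u c * u c'"
  using Rm_weight[of N u a a' c c' h] u_pri by auto

lemma P_weight: "a < N \<Longrightarrow> a' < N \<Longrightarrow> c < N \<Longrightarrow> c' < N \<Longrightarrow> PA N h a a' c c' = 0 \<or> u a * u a' = u c * u c'"
  using PA_weight[of N u a a' c c' h] u_pri by auto

lemma phi_TT:
  "phi (cst z * (T a c * T a' c')) = cst (cj b z * (u a / u c * (u a' / u c'))) *
    (if b then T (\<tau> a') (\<tau> c') * T (\<tau> a) (\<tau> c) else T (\<tau> a) (\<tau> c) * T (\<tau> a') (\<tau> c'))"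
  unfolding lin_ext_cst_mult free_ext_mult phi_T
  by (cases b) (simp_all add: cst_mult_mult cst_cst_mult mult.commute[where 'a = complex])

text \<open>Wherever C_{de} is nonzero, u_d u_e = 1, so only the weights of the outer indices
  survive. In the antimultiplicative case the reversed product matches the relation with exchanged
  indices.\<close>

lemma phi_metric_rel1:
  assumes "a < N" "c < N"
  shows "phi (metric_rel1 N h a c) = cst (u a * u c) *
    (if b then metric_rel1 N h (\<tau> c) (\<tau> a) else metric_rel1 N h (\<tau> a) (\<tau> c))"
proof -
  have "phi (\<Sum>d<N. \<Sum>e<N. cst (metric N h $$ (d, e)) * (T a d * T c e))
      = (\<Sum>d<N. \<Sum>e<N. cst (u a * u c * (if b then metric N h $$ (\<tau> e, \<tau> d) else metric N h $$ (\<tau> d, \<tau> e))) *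
        (if b then T (\<tau> c) (\<tau> e) * T (\<tau> a) (\<tau> d) else T (\<tau> a) (\<tau> d) * T (\<tau> c) (\<tau> e)))"
    unfolding lin_ext_sum
  proof (rule sum_lessThan_cong2)
    fix d e assume de: "d < N" "e < N"
    have "cj b (metric N h $$ (d, e)) * (u a / u d * (u c / u e)) = u a * u c * cj b (metric N h $$ (d, e))"
      using metric_weight[OF de] by (auto simp: field_simps u_nonzero de)
    then show "phi (cst (metric N h $$ (d, e)) * (T a d * T c e)) =
        cst (u a * u c * (if b then metric N h $$ (\<tau> e, \<tau> d) else metric N h $$ (\<tau> d, \<tau> e))) *
        (if b then T (\<tau> c) (\<tau> e) * T (\<tau> a) (\<tau> d) else T (\<tau> a) (\<tau> d) * T (\<tau> c) (\<tau> e))"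
      unfolding phi_TT metric_tau[OF de, symmetric] by simp
  qed
  also have "\<dots> = cst (u a * u c) * (\<Sum>d<N. \<Sum>e<N. cst (if b then metric N h $$ (e, d) else metric N h $$ (d, e)) *
        (if b then T (\<tau> c) e * T (\<tau> a) d else T (\<tau> a) d * T (\<tau> c) e))"
    unfolding sum_distrib_left cst_cst_mult
    by (rule sum_tau2[of "\<lambda>d e. cst (u a * u c * (if b then metric N h $$ (e, d) else metric N h $$ (d, e))) *
        (if b then T (\<tau> c) e * T (\<tau> a) d else T (\<tau> a) d * T (\<tau> c) e)"])
  also have "(\<Sum>d<N. \<Sum>e<N. cst (if b then metric N h $$ (e, d) else metric N h $$ (d, e)) *
        (if b then T (\<tau> c) e * T (\<tau> a) d else T (\<tau> a) d * T (\<tau> c) e))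
      = (if b then \<Sum>d<N. \<Sum>e<N. cst (metric N h $$ (d, e)) * (T (\<tau> c) d * T (\<tau> a) e)
         else \<Sum>d<N. \<Sum>e<N. cst (metric N h $$ (d, e)) * (T (\<tau> a) d * T (\<tau> c) e))"
    by (cases b) (simp, rule sum.swap, simp)
  moreover have "cj b (metric N h $$ (a, c)) = u a * u c * (if b then metric N h $$ (\<tau> c, \<tau> a) else metric N h $$ (\<tau> a, \<tau> c))"
    using metric_weight[OF assms] unfolding metric_tau[OF assms, symmetric] by auto
  ultimately show ?thesis
    unfolding metric_rel1_eq lin_ext_diff free_ext_cst
    by (cases b) (simp_all add: right_diff_distrib cst_mult)
qed

lemma phi_metric_rel2:
  assumes "a < N" "c < N"
  shows "phi (metric_rel2 N h a c) = cst (inverse (u a * u c)) *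
    (if b then metric_rel2 N h (\<tau> c) (\<tau> a) else metric_rel2 N h (\<tau> a) (\<tau> c))"
proof -
  have "phi (\<Sum>d<N. \<Sum>e<N. cst (metric N h $$ (d, e)) * (T d a * T e c))
      = (\<Sum>d<N. \<Sum>e<N. cst (inverse (u a * u c) * (if b then metric N h $$ (\<tau> e, \<tau> d) else metric N h $$ (\<tau> d, \<tau> e))) *
        (if b then T (\<tau> e) (\<tau> c) * T (\<tau> d) (\<tau> a) else T (\<tau> d) (\<tau> a) * T (\<tau> e) (\<tau> c)))"
    unfolding lin_ext_sum
  proof (rule sum_lessThan_cong2)
    fix d e assume de: "d < N" "e < N"
    have "cj b (metric N h $$ (d, e)) * (u d / u a * (u e / u c)) = inverse (u a * u c) * cj b (metric N h $$ (d, e))"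
      using metric_weight[OF de] by (auto simp: field_simps u_nonzero assms)
    then show "phi (cst (metric N h $$ (d, e)) * (T d a * T e c)) =
        cst (inverse (u a * u c) * (if b then metric N h $$ (\<tau> e, \<tau> d) else metric N h $$ (\<tau> d, \<tau> e))) *
        (if b then T (\<tau> e) (\<tau> c) * T (\<tau> d) (\<tau> a) else T (\<tau> d) (\<tau> a) * T (\<tau> e) (\<tau> c))"
      unfolding phi_TT metric_tau[OF de, symmetric] by simp
  qed
  also have "\<dots> = cst (inverse (u a * u c)) * (\<Sum>d<N. \<Sum>e<N. cst (if b then metric N h $$ (e, d) else metric N h $$ (d, e)) *
        (if b then T e (\<tau> c) * T d (\<tau> a) else T d (\<tau> a) * T e (\<tau> c)))"
    unfolding sum_distrib_left cst_cst_mult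
    by (rule sum_tau2[of "\<lambda>d e. cst (inverse (u a * u c) * (if b then metric N h $$ (e, d) else metric N h $$ (d, e))) *
        (if b then T e (\<tau> c) * T d (\<tau> a) else T d (\<tau> a) * T e (\<tau> c))"])
  also have "(\<Sum>d<N. \<Sum>e<N. cst (if b then metric N h $$ (e, d) else metric N h $$ (d, e)) *
        (if b then T e (\<tau> c) * T d (\<tau> a) else T d (\<tau> a) * T e (\<tau> c)))
      = (if b then \<Sum>d<N. \<Sum>e<N. cst (metric N h $$ (d, e)) * (T d (\<tau> c) * T e (\<tau> a))
         else \<Sum>d<N. \<Sum>e<N. cst (metric N h $$ (d, e)) * (T d (\<tau> a) * T e (\<tau> c)))"
    by (cases b) (simp, rule sum.swap, simp)
  moreover have "cj b (metric N h $$ (a, c)) = inverse (u a * u c) * (if b then metric N h $$ (\<tau> c, \<tau> a) else metric N h $$ (\<tau> a, \<tau> c))"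
    using metric_weight[OF assms] unfolding metric_tau[OF assms, symmetric] by (auto simp del: inverse_mult_distrib)
  ultimately show ?thesis
    unfolding metric_rel2_eq lin_ext_diff free_ext_cst
    by (cases b) (simp_all add: right_diff_distrib cst_mult)
qed

text \<open>On the support of \<open>PA\<close> the inner weight u_c u_d equals the outer one by
  \<open>P_weight\<close>, so a single factor can be taken out of the sum.\<close>

lemma psi_ext_rel:
  assumes "a < N" "a' < N"
  shows "psi (ext_rel a a') = cst (u a * u a') * (if b then ext_rel (\<tau> a') (\<tau> a) else ext_rel (\<tau> a) (\<tau> a'))"
proof -
  define G where "G = (\<lambda>c d. cst (u a * u a' * (if b then (if \<tau> a' = d \<and> \<tau> a = c then 1 else 0) - PA N h (\<tau> a') (\<tau> a) d c
      else (if \<tau> a = c \<and> \<tau> a' = d then 1 else 0) - PA N h (\<tau> a) (\<tau> a') c d)) *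
      (if b then var d * var c else var c * var d))"
  have "psi (ext_rel a a') = (\<Sum>c<N. \<Sum>d<N. G (\<tau> c) (\<tau> d))"
    unfolding ext_rel_def lin_ext_sum
  proof (rule sum_lessThan_cong2)
    fix c d assume cd: "c < N" "d < N"
    let ?x = "(if a = c \<and> a' = d then 1 else 0) - PA N h a a' c d"
    have "cj b ?x * (u c * u d) = u a * u a' * cj b ?x"
      using P_weight[OF assms cd] by (auto simp: mult.commute)
    moreover have "cj b ?x = (if b then (if \<tau> a' = \<tau> d \<and> \<tau> a = \<tau> c then 1 else 0) - PA N h (\<tau> a') (\<tau> a) (\<tau> d) (\<tau> c)
      else (if \<tau> a = \<tau> c \<and> \<tau> a' = \<tau> d then 1 else 0) - PA N h (\<tau> a) (\<tau> a') (\<tau> c) (\<tau> d))"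
      unfolding cj_simps PA_tau[OF assms cd] using assms cd by (auto simp: tau_eq_iff)
    moreover have "psi (cst ?x * (var c * var d)) = cst (cj b ?x * (u c * u d)) *
        (if b then var (\<tau> d) * var (\<tau> c) else var (\<tau> c) * var (\<tau> d))"
      unfolding lin_ext_cst_mult free_ext_mult psi_var
      by (cases b) (simp_all only: if_True if_False cst_mult_mult cst_cst_mult mult.commute[of "u d" "u c"])
    ultimately show "psi (cst ?x * (var c * var d)) = G (\<tau> c) (\<tau> d)"
      unfolding G_def by (simp only:)
  qed
  also have "\<dots> = (\<Sum>c<N. \<Sum>d<N. G c d)"
    by (rule sum_tau2)
  also have "\<dots> = cst (u a * u a') * (if b then ext_rel (\<tau> a') (\<tau> a) else ext_rel (\<tau> a) (\<tau> a'))"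
  proof (cases b)
    case True
    then show ?thesis
      unfolding G_def ext_rel_def by (subst sum.swap) (simp add: sum_distrib_left cst_cst_mult)
  qed (simp add: G_def ext_rel_def sum_distrib_left cst_cst_mult)
  finally show ?thesis .
qed

lemma phi_rtt_sums:
  assumes "a < N" "a' < N" "c < N" "c' < N"
  shows "phi (\<Sum>e<N. \<Sum>f<N. cst (Rm N h a a' e f) * (T e c * T f c'))
      = cst (u a * u a' / (u c * u c')) * (\<Sum>e<N. \<Sum>f<N. cst (cj b (Rm N h a a' e f)) *
        (if b then T (\<tau> f) (\<tau> c') * T (\<tau> e) (\<tau> c) else T (\<tau> e) (\<tau> c) * T (\<tau> f) (\<tau> c')))" (is "?l1 = ?r1")
    and "phi (\<Sum>e<N. \<Sum>f<N. cst (Rm N h e f c c') * (T a' f * T a e))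
      = cst (u a * u a' / (u c * u c')) * (\<Sum>e<N. \<Sum>f<N. cst (cj b (Rm N h e f c c')) *
        (if b then T (\<tau> a) (\<tau> e) * T (\<tau> a') (\<tau> f) else T (\<tau> a') (\<tau> f) * T (\<tau> a) (\<tau> e)))" (is "?l2 = ?r2")
proof -
  show "?l1 = ?r1"
    unfolding lin_ext_sum sum_distrib_left cst_cst_mult
  proof (rule sum_lessThan_cong2)
    fix e f assume ef: "e < N" "f < N"
    have "cj b (Rm N h a a' e f) * (u e / u c * (u f / u c')) = u a * u a' / (u c * u c') * cj b (Rm N h a a' e f)"
      using R_weight[OF assms(1,2) ef] by (auto simp: field_simps u_nonzero assms)
    then show "phi (cst (Rm N h a a' e f) * (T e c * T f c')) =
        cst (u a * u a' / (u c * u c') * cj b (Rm N h a a' e f)) *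
        (if b then T (\<tau> f) (\<tau> c') * T (\<tau> e) (\<tau> c) else T (\<tau> e) (\<tau> c) * T (\<tau> f) (\<tau> c'))"
      unfolding phi_TT by (simp only:)
  qed
  show "?l2 = ?r2"
    unfolding lin_ext_sum sum_distrib_left cst_cst_mult
  proof (rule sum_lessThan_cong2)
    fix e f assume ef: "e < N" "f < N"
    have "cj b (Rm N h e f c c') * (u a' / u f * (u a / u e)) = u a * u a' / (u c * u c') * cj b (Rm N h e f c c')"
      using R_weight[OF ef assms(3,4)] by (auto simp: field_simps u_nonzero assms ef)
    then show "phi (cst (Rm N h e f c c') * (T a' f * T a e)) =
        cst (u a * u a' / (u c * u c') * cj b (Rm N h e f c c')) *
        (if b then T (\<tau> a) (\<tau> e) * T (\<tau> a') (\<tau> f) else T (\<tau> a') (\<tau> f) * T (\<tau> a) (\<tau> e))"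
      unfolding phi_TT by (simp only:)
  qed
qed

lemma phi_rtt_hom:
  assumes "\<not> b" "a < N" "a' < N" "c < N" "c' < N"
  shows "phi (rtt_rel N h a a' c c') = cst (u a * u a' / (u c * u c')) * rtt_rel N h (\<tau> a) (\<tau> a') (\<tau> c) (\<tau> c')"
proof -
  have "(\<Sum>e<N. \<Sum>f<N. cst (Rm N h a a' e f) * (T (\<tau> e) (\<tau> c) * T (\<tau> f) (\<tau> c')))
      = (\<Sum>e<N. \<Sum>f<N. cst (Rm N h (\<tau> a) (\<tau> a') (\<tau> e) (\<tau> f)) * (T (\<tau> e) (\<tau> c) * T (\<tau> f) (\<tau> c')))"
    by (rule sum_lessThan_cong2) (simp add: Rm_tau_hom assms)
  also have "\<dots> = (\<Sum>e<N. \<Sum>f<N. cst (Rm N h (\<tau> a) (\<tau> a') e f) * (T e (\<tau> c) * T f (\<tau> c')))"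
    by (rule sum_tau2)
  finally have 1: "(\<Sum>e<N. \<Sum>f<N. cst (Rm N h a a' e f) * (T (\<tau> e) (\<tau> c) * T (\<tau> f) (\<tau> c')))
      = (\<Sum>e<N. \<Sum>f<N. cst (Rm N h (\<tau> a) (\<tau> a') e f) * (T e (\<tau> c) * T f (\<tau> c')))" .
  have "(\<Sum>e<N. \<Sum>f<N. cst (Rm N h e f c c') * (T (\<tau> a') (\<tau> f) * T (\<tau> a) (\<tau> e)))
      = (\<Sum>e<N. \<Sum>f<N. cst (Rm N h (\<tau> e) (\<tau> f) (\<tau> c) (\<tau> c')) * (T (\<tau> a') (\<tau> f) * T (\<tau> a) (\<tau> e)))"
    by (rule sum_lessThan_cong2) (simp add: Rm_tau_hom assms)
  also have "\<dots> = (\<Sum>e<N. \<Sum>f<N. cst (Rm N h e f (\<tau> c) (\<tau> c')) * (T (\<tau> a') f * T (\<tau> a) e))"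
    by (rule sum_tau2)
  finally have 2: "(\<Sum>e<N. \<Sum>f<N. cst (Rm N h e f c c') * (T (\<tau> a') (\<tau> f) * T (\<tau> a) (\<tau> e)))
      = (\<Sum>e<N. \<Sum>f<N. cst (Rm N h e f (\<tau> c) (\<tau> c')) * (T (\<tau> a') f * T (\<tau> a) e))" .
  show ?thesis
    unfolding rtt_rel_eq lin_ext_diff phi_rtt_sums[OF assms(2-)] right_diff_distrib
    using assms(1) 1 2 by simp
qed

lemma sum_delta2:
  fixes F :: "nat \<Rightarrow> nat \<Rightarrow> talg"
  assumes "x < N" "y < N"
  shows "(\<Sum>e<N. \<Sum>f<N. cst (if x = f \<and> y = e then 1 else 0) * F e f) = F y x"
proof -
  have "(\<Sum>f<N. cst (if x = f \<and> y = e then 1 else 0) * F e f) = (if e = y then F y x else 0)" for e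
  proof -
    have "cst (if x = f \<and> y = e then 1 else 0) * F e f = (if f = x then if e = y then F y x else 0 else 0)" for f
      by simp
    then show ?thesis using assms by simp
  qed
  then show ?thesis using assms by simp
qed

text \<open>
  The multiple of the permutation operator by which \<open>R\<close> and its conjugate differ contributes
  nothing, the rank one term contributes multiples of the metric relations.
\<close>

lemma phi_rtt_anti:
  assumes b: "b" and abcd: "a < N" "a' < N" "c < N" "c' < N"
  shows "phi (rtt_rel N h a a' c c') = cst (u a * u a' / (u c * u c')) *
    (rtt_rel N h (\<tau> a') (\<tau> a) (\<tau> c') (\<tau> c)
      + (cst (\<mu> * metric N h $$ (\<tau> a, \<tau> a')) * metric_rel2 N h (\<tau> c') (\<tau> c)
      - cst (\<mu> * metric N h $$ (\<tau> c', \<tau> c)) * metric_rel1 N h (\<tau> a) (\<tau> a')))"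
proof -
  note less = tau_less[OF abcd(1)] tau_less[OF abcd(2)] tau_less[OF abcd(3)] tau_less[OF abcd(4)]
  let ?m = "\<lambda>x y. metric N h $$ (x, y)"
  have split3: "cst (r - \<mu> * (i - m * m')) * x = cst r * x - cst \<mu> * (cst i * x) + cst (\<mu> * m) * (cst m' * x)"
    for r i m m' and x :: talg
  proof -
    have "r - \<mu> * (i - m * m') = r - \<mu> * i + \<mu> * m * m'"
      by (simp add: algebra_simps)
    then show ?thesis
      by (simp only: cst_add cst_diff distrib_right left_diff_distrib cst_cst_mult)
  qed
  have "(\<Sum>e<N. \<Sum>f<N. cst (cnj (Rm N h a a' e f)) * (T (\<tau> f) (\<tau> c') * T (\<tau> e) (\<tau> c)))
      = (\<Sum>e<N. \<Sum>f<N. cst (Rm N h (\<tau> a') (\<tau> a) (\<tau> f) (\<tau> e)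
          - \<mu> * ((if \<tau> a = \<tau> f \<and> \<tau> a' = \<tau> e then 1 else 0) - ?m (\<tau> a) (\<tau> a') * ?m (\<tau> f) (\<tau> e)))
        * (T (\<tau> f) (\<tau> c') * T (\<tau> e) (\<tau> c)))"
    by (rule sum_lessThan_cong2) (simp add: Rm_tau_anti b abcd tau_eq_iff)
  also have "\<dots> = (\<Sum>e<N. \<Sum>f<N. cst (Rm N h (\<tau> a') (\<tau> a) f e
          - \<mu> * ((if \<tau> a = f \<and> \<tau> a' = e then 1 else 0) - ?m (\<tau> a) (\<tau> a') * ?m f e)) * (T f (\<tau> c') * T e (\<tau> c)))"
    by (rule sum_tau2)
  also have "\<dots> = (\<Sum>e<N. \<Sum>f<N. cst (Rm N h (\<tau> a') (\<tau> a) f e) * (T f (\<tau> c') * T e (\<tau> c)))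
      - cst \<mu> * (\<Sum>e<N. \<Sum>f<N. cst (if \<tau> a = f \<and> \<tau> a' = e then 1 else 0) * (T f (\<tau> c') * T e (\<tau> c)))
      + cst (\<mu> * ?m (\<tau> a) (\<tau> a')) * (\<Sum>e<N. \<Sum>f<N. cst (?m f e) * (T f (\<tau> c') * T e (\<tau> c)))"
    unfolding split3 sum.distrib sum_subtractf sum_distrib_left ..
  also have "(\<Sum>e<N. \<Sum>f<N. cst (if \<tau> a = f \<and> \<tau> a' = e then 1 else 0) * (T f (\<tau> c') * T e (\<tau> c)))
      = T (\<tau> a) (\<tau> c') * T (\<tau> a') (\<tau> c)"
    by (rule sum_delta2) (use less in auto)
  finally have 1: "(\<Sum>e<N. \<Sum>f<N. cst (cnj (Rm N h a a' e f)) * (T (\<tau> f) (\<tau> c') * T (\<tau> e) (\<tau> c)))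
      = (\<Sum>f<N. \<Sum>e<N. cst (Rm N h (\<tau> a') (\<tau> a) f e) * (T f (\<tau> c') * T e (\<tau> c)))
      - cst \<mu> * (T (\<tau> a) (\<tau> c') * T (\<tau> a') (\<tau> c))
      + cst (\<mu> * ?m (\<tau> a) (\<tau> a')) * (\<Sum>f<N. \<Sum>e<N. cst (?m f e) * (T f (\<tau> c') * T e (\<tau> c)))"
    unfolding sum.swap[of "\<lambda>f e. cst (Rm N h (\<tau> a') (\<tau> a) f e) * (T f (\<tau> c') * T e (\<tau> c))"]
      sum.swap[of "\<lambda>f e. cst (?m f e) * (T f (\<tau> c') * T e (\<tau> c))"] .
  have "(\<Sum>e<N. \<Sum>f<N. cst (cnj (Rm N h e f c c')) * (T (\<tau> a) (\<tau> e) * T (\<tau> a') (\<tau> f)))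
      = (\<Sum>e<N. \<Sum>f<N. cst (Rm N h (\<tau> f) (\<tau> e) (\<tau> c') (\<tau> c)
          - \<mu> * ((if \<tau> c = \<tau> f \<and> \<tau> c' = \<tau> e then 1 else 0) - ?m (\<tau> c') (\<tau> c) * ?m (\<tau> e) (\<tau> f)))
        * (T (\<tau> a) (\<tau> e) * T (\<tau> a') (\<tau> f)))"
    by (rule sum_lessThan_cong2)
      (simp add: Rm_tau_anti b abcd tau_eq_iff eq_commute[of c] eq_commute[of c'] conj_commute mult.commute[where 'a = complex])
  also have "\<dots> = (\<Sum>e<N. \<Sum>f<N. cst (Rm N h f e (\<tau> c') (\<tau> c)
          - \<mu> * ((if \<tau> c = f \<and> \<tau> c' = e then 1 else 0) - ?m (\<tau> c') (\<tau> c) * ?m e f)) * (T (\<tau> a) e * T (\<tau> a') f))"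
    by (rule sum_tau2)
  also have "\<dots> = (\<Sum>e<N. \<Sum>f<N. cst (Rm N h f e (\<tau> c') (\<tau> c)) * (T (\<tau> a) e * T (\<tau> a') f))
      - cst \<mu> * (\<Sum>e<N. \<Sum>f<N. cst (if \<tau> c = f \<and> \<tau> c' = e then 1 else 0) * (T (\<tau> a) e * T (\<tau> a') f))
      + cst (\<mu> * ?m (\<tau> c') (\<tau> c)) * (\<Sum>e<N. \<Sum>f<N. cst (?m e f) * (T (\<tau> a) e * T (\<tau> a') f))"
    unfolding split3 sum.distrib sum_subtractf sum_distrib_left ..
  also have "(\<Sum>e<N. \<Sum>f<N. cst (if \<tau> c = f \<and> \<tau> c' = e then 1 else 0) * (T (\<tau> a) e * T (\<tau> a') f))
      = T (\<tau> a) (\<tau> c') * T (\<tau> a') (\<tau> c)"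
    by (rule sum_delta2) (use less in auto)
  finally have 2: "(\<Sum>e<N. \<Sum>f<N. cst (cnj (Rm N h e f c c')) * (T (\<tau> a) (\<tau> e) * T (\<tau> a') (\<tau> f)))
      = (\<Sum>f<N. \<Sum>e<N. cst (Rm N h f e (\<tau> c') (\<tau> c)) * (T (\<tau> a) e * T (\<tau> a') f))
      - cst \<mu> * (T (\<tau> a) (\<tau> c') * T (\<tau> a') (\<tau> c))
      + cst (\<mu> * ?m (\<tau> c') (\<tau> c)) * (\<Sum>e<N. \<Sum>f<N. cst (?m e f) * (T (\<tau> a) e * T (\<tau> a') f))"
    unfolding sum.swap[of "\<lambda>f e. cst (Rm N h f e (\<tau> c') (\<tau> c)) * (T (\<tau> a) e * T (\<tau> a') f)"] .
  have m: "cst (\<mu> * ?m (\<tau> a) (\<tau> a')) * cst (?m (\<tau> c') (\<tau> c)) = (cst (\<mu> * ?m (\<tau> c') (\<tau> c)) * cst (?m (\<tau> a) (\<tau> a')) :: talg)"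
    by (simp add: mult_ac flip: cst_mult)
  \<comment> \<open>\<open>p\<close> is the contribution of the flip, the same product of generators
    on both sides. The constant \<open>k\<close>, a multiple of a product of two metric entries, is
    inserted to complete the rank one terms to the two metric relations.\<close>
  have cancel: "x - p + y - (x' - p + y') = x - x' + ((y - k) - (y' - k))" for x x' y y' p k :: talg
    by simp
  show ?thesis
    unfolding rtt_rel_eq[of a] lin_ext_diff phi_rtt_sums[OF abcd] right_diff_distrib[symmetric] if_P[OF b] cj_def 1 2
    unfolding rtt_rel_eq metric_rel1_eq metric_rel2_eq right_diff_distrib[of "cst (\<mu> * _)"] m
    by (rule arg_cong[where f = "(*) _"], rule cancel)
qed

lemma phi_O_rels:
  assumes "x \<in> O_rels N h"
  shows "phi x \<in> O_ideal N h"
proof -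
  from assms consider
      (rtt) a a' c c' where "x = rtt_rel N h a a' c c'" "a < N" "a' < N" "c < N" "c' < N"
    | (rel1) a c where "x = metric_rel1 N h a c" "a < N" "c < N"
    | (rel2) a c where "x = metric_rel2 N h a c" "a < N" "c < N"
    unfolding O_rels_def by blast
  then show ?thesis
  proof cases
    case rtt
    show ?thesis
    proof (cases b)
      case True
      show ?thesis
        unfolding rtt(1) phi_rtt_anti[OF True rtt(2-)]
        by (intro O.cst_mult_mem_ideal O.add_mem_ideal O.diff_mem_ideal rtt_mem metric_rel1_mem metric_rel2_mem tau_less rtt)
    next
      case False
      show ?thesis
        unfolding rtt(1) phi_rtt_hom[OF False rtt(2-)]
        by (intro O.cst_mult_mem_ideal rtt_mem tau_less rtt)
    qed
  qed (simp_all add: phi_metric_rel1 phi_metric_rel2 O.cst_mult_mem_ideal metric_rel1_mem metric_rel2_mem tau_less)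
qed

lemma phi_O_ideal:
  assumes "x \<in> O_ideal N h"
  shows "phi x \<in> O_ideal N h"
  by (rule O_ideal_image[OF O.monoid_alg_ideal_axioms lin_ext_additive, where a = b])
    (use assms phi_O_rels keys_phi in \<open>simp_all add: free_ext_mult\<close>)

lemma psi_ext_ideal:
  assumes "x \<in> ext_ideal N h"
  shows "psi x \<in> ext_ideal N h"
proof (rule genideal_image[OF submonoid_lists X.monoid_alg_ideal_axioms lin_ext_additive ext_rels_carrier, where a = b])
  fix g assume "g \<in> {ext_rel a a' | a a'. a < N \<and> a' < N}"
  then obtain a a' where "g = ext_rel a a'" "a < N" "a' < N" by blast
  then show "psi g \<in> ext_ideal N h"
    by (simp add: psi_ext_rel X.cst_mult_mem_ideal ext_rel_mem tau_less)
next
  show "psi (x * y) = (if b then psi y * psi x else psi x * psi y)" for x y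
    by (rule free_ext_mult)
next
  show "x \<in> Idl\<^bsub>free_alg {..<N}\<^esub> {ext_rel a a' | a a'. a < N \<and> a' < N}"
    using assms by (simp only: ext_ideal_eq)
qed (rule keys_psi)

lemma phi_qdet:
  assumes "is_qdet N h D"
  shows "is_qdet N h (phi D)"
  unfolding is_qdet_def
proof (intro conjI ballI impI)
  have D: "Poly_Mapping.keys D \<subseteq> W"
    using assms by (rule is_qdet_carrier)
  then show "phi D \<in> carrier (free_alg (T_idx N))" by (simp only: monoid_alg_simps mem_Collect_eq keys_phi)
  have "phi2 (Delta_free N D - tens D D) \<in> tensor_ideal (T_idx N) (O_ideal N h) (T_idx N) (O_ideal N h)"
    using assms
    by (intro tensor_map_tensor_ideal[OF O.monoid_alg_ideal_axioms O.monoid_alg_ideal_axioms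
          O.monoid_alg_ideal_axioms O.monoid_alg_ideal_axioms] keys_letter phi_O_ideal) (simp_all add: is_qdet_def)
  then show "Delta_free N (phi D) - tens (phi D) (phi D) \<in> tensor_ideal (T_idx N) (O_ideal N h) (T_idx N) (O_ideal N h)"
    by (simp only: Delta_phi[OF D] additive.diff[OF additive_tensor_map] tensor_map_tens)
  show "eps_free (phi D) = 1"
    using assms by (simp add: eps_phi[OF D] is_qdet_def)
  let ?J = "tensor_ideal (T_idx N) (O_ideal N h) {..<N} (ext_ideal N h)"
  let ?m = "tensor_map b (word_ext b letter) (word_ext b ext_letter)"
  interpret J: monoid_alg_ideal "lists (T_idx N) \<times> lists {..<N}" ?J by (rule coact_ideal)
  fix \<omega> assume "\<omega> \<in> carrier (free_alg {..<N})" "\<forall>w\<in>Poly_Mapping.keys \<omega>. length w = N"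
  then have "Poly_Mapping.keys \<omega> \<subseteq> {w \<in> lists {..<N}. length w = N}" by auto
  then show "coact_free N \<omega> - tens (phi D) \<omega> \<in> ?J"
  proof (induction \<omega> rule: poly_mapping_single_induct)
    case zero
    then show ?case by (simp add: coact_free_eq J.zero_mem_ideal)
  next
    case (single w z)
    \<comment> \<open>The form is pulled back along \<open>psi\<close>; the coaction relation of
      \<open>D\<close> on the preimage is then pushed forward by \<open>phi\<close> and
      \<open>psi\<close> together.\<close>
    then obtain w' z' where w': "w' \<in> lists {..<N}" "length w' = N"
      and eq: "Poly_Mapping.single w z = psi (Poly_Mapping.single w' z')"
      using psi_single_surj[of w z] by auto
    let ?p = "Poly_Mapping.single w' z' :: nat list \<Rightarrow>\<^sub>0 complex"
    have p: "Poly_Mapping.keys ?p \<subseteq> lists {..<N}" "\<forall>w\<in>Poly_Mapping.keys ?p. length w = N"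
      using w' by (simp_all add: keys_single)
    then have "coact_free N ?p - tens D ?p \<in> ?J"
      using assms by (simp add: is_qdet_def)
    then have "?m (coact_free N ?p - tens D ?p) \<in> ?J"
      by (intro tensor_map_tensor_ideal[OF O.monoid_alg_ideal_axioms X.monoid_alg_ideal_axioms
            O.monoid_alg_ideal_axioms X.monoid_alg_ideal_axioms] keys_letter keys_ext_letter phi_O_ideal psi_ext_ideal)
    then show ?case
      by (simp only: eq coact_psi[OF p(1)] additive.diff[OF additive_tensor_map] tensor_map_tens)
  next
    case (add x y)
    then show ?case
      using J.add_mem_ideal[OF add]
      by (simp add: coact_free_eq lin_ext_add tens_add_right algebra_simps)
  qed
qed

lemma phi_SO_ideal:
  assumes "x \<in> SO_ideal N h"
  shows "phi x \<in> SO_ideal N h"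
proof (rule SO_ideal_image[OF SO.monoid_alg_ideal_axioms lin_ext_additive, where a = b])
  fix D assume "is_qdet N h D"
  then show "phi (D - 1) \<in> SO_ideal N h"
    using qdet_mem[OF phi_qdet] by (simp add: lin_ext_diff free_ext_one)
next
  show "phi x \<in> SO_ideal N h" if "x \<in> O_rels N h" for x
    using phi_O_rels[OF that] O_subset_SO by blast
qed (use assms keys_phi in \<open>simp_all add: free_ext_mult\<close>)

end

section \<open>Maps of the quotient\<close>

context quantum_group
begin

abbreviation "cls2 \<equiv> cls W2 (SO2_ideal N h)"

lemma SO_class_eq: "SO_class N h = cls W (SO_ideal N h)"
  by (simp add: fun_eq_iff SO_class_def cls_def)

lemma carrier_SOq: "carrier (SOq N h) = SO_class N h ` {p. Poly_Mapping.keys p \<subseteq> W}"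
  by (simp add: SOq_def SO.carrier_Quot SO_class_eq)

lemma SO_class_cases:
  assumes "Z1 \<in> carrier (SOq N h)"
  obtains x where "Z1 = SO_class N h x" "Poly_Mapping.keys x \<subseteq> W"
  using assms unfolding carrier_SOq by blast

lemma SO_class_carrier: "Poly_Mapping.keys x \<subseteq> W \<Longrightarrow> SO_class N h x \<in> carrier (SOq N h)"
  unfolding carrier_SOq by blast

lemma SOq_ops:
  assumes "Poly_Mapping.keys x \<subseteq> W" "Poly_Mapping.keys y \<subseteq> W"
  shows "SO_class N h x \<oplus>\<^bsub>SOq N h\<^esub> SO_class N h y = SO_class N h (x + y)"
    and "SO_class N h x \<otimes>\<^bsub>SOq N h\<^esub> SO_class N h y = SO_class N h (x * y)"
  using SO.Quot_add[of x y] SO.Quot_mult[of x y] assms by (simp_all only: SOq_def SO_class_eq monoid_alg_simps mem_Collect_eq)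

lemma SOq_one: "\<one>\<^bsub>SOq N h\<^esub> = SO_class N h 1"
  by (simp add: SOq_def FactRing_def SO_class_def)

lemma scal_class: "Poly_Mapping.keys x \<subseteq> W \<Longrightarrow> scal N h c (SO_class N h x) = SO_class N h (cst c * x)"
  unfolding scal_def by (rule SOq_ops(2)[OF W.keys_cst_subset])

lemma induced_class:
  assumes "additive f" "\<And>x. x \<in> SO_ideal N h \<Longrightarrow> f x \<in> SO_ideal N h" "Poly_Mapping.keys x \<subseteq> W"
  shows "induced (free_alg (T_idx N)) (SO_ideal N h) f (SO_class N h x) = SO_class N h (f x)"
  unfolding SO_class_eq
  by (rule induced_cls[OF SO.monoid_alg_ideal_axioms SO.monoid_alg_ideal_axioms assms])

lemma Delta_class: "Poly_Mapping.keys x \<subseteq> W \<Longrightarrow> Delta N h (SO_class N h x) = cls2 (Delta_free N x)"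
  unfolding Delta_def SO_class_eq
  by (rule induced_cls[OF SO.monoid_alg_ideal_axioms SO2_ideal Delta_free_additive Delta_free_SO_ideal])

lemma eps_class:
  assumes "Poly_Mapping.keys x \<subseteq> W"
  shows "eps N h (SO_class N h x) = eps_free x"
  unfolding eps_def SO_class_eq
proof (rule SO.the_elem_image_cls[OF _ assms])
  fix y assume "y - x \<in> SO_ideal N h"
  then show "eps_free y = eps_free x"
    using eps_SO_ideal[of "y - x"] by (simp add: additive.diff[OF eps_free_additive])
qed

lemma kappa_class:
  "h \<noteq> 0 \<Longrightarrow> Poly_Mapping.keys x \<subseteq> W \<Longrightarrow> kappa N h (SO_class N h x) = SO_class N h (kappa_fr x)"
  unfolding kappa_def kappa_free_eq by (rule induced_class[OF lin_ext_additive kappa_SO_ideal])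

text \<open>Independence of representatives comes from v \<otimes> w - x \<otimes> y = (v - x)
  \<otimes> y + v \<otimes> (w - y).\<close>

lemma pure_class:
  assumes "Poly_Mapping.keys x \<subseteq> W" "Poly_Mapping.keys y \<subseteq> W"
  shows "pure N h (SO_class N h x) (SO_class N h y) = cls2 (tens x y)"
proof -
  interpret SO2: monoid_alg_ideal W2 "SO2_ideal N h" by (rule SO2_ideal)
  have eq: "cls2 (tens v w) = cls2 (tens x y)" if "v \<in> SO_class N h x" "w \<in> SO_class N h y" for v w
  proof -
    have vw: "v - x \<in> SO_ideal N h" "w - y \<in> SO_ideal N h"
      using that by (simp_all add: SO_class_eq SO.mem_cls_iff)
    have "Poly_Mapping.keys v \<subseteq> W"
      using W.keys_add_subset[OF SO.mem_carrier[OF vw(1)] assms(1)] by simp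
    then have "tens (v - x) y + tens v (w - y) \<in> SO2_ideal N h"
      by (intro SO2.add_mem_ideal tens_SO_left tens_SO_right vw assms)
    also have "tens (v - x) y + tens v (w - y) = tens v w - tens x y"
      by (simp add: tens_diff_left tens_diff_right)
    finally show ?thesis by (simp only: SO2.cls_eq_iff)
  qed
  have "x \<in> SO_class N h x" "y \<in> SO_class N h y"
    by (simp_all add: SO_class_eq SO.mem_cls_iff SO.zero_mem_ideal)
  then have "{cls2 (tens v w) | v w. v \<in> SO_class N h x \<and> w \<in> SO_class N h y} = {cls2 (tens x y)}"
    using eq by blast
  then show ?thesis by (simp add: pure_def cls_def[symmetric])
qed

lemma finsum_pure:
  fixes k :: nat
  assumes "\<And>i. i < k \<Longrightarrow> Poly_Mapping.keys (v i) \<subseteq> W" "\<And>i. i < k \<Longrightarrow> Poly_Mapping.keys (w i) \<subseteq> W"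
    and "\<And>i. i < k \<Longrightarrow> Z1 i = SO_class N h (v i)" "\<And>i. i < k \<Longrightarrow> Z2 i = SO_class N h (w i)"
  shows "(\<Oplus>\<^bsub>SOq2 N h\<^esub>i\<in>{..<k}. pure N h (Z1 i) (Z2 i)) = cls2 (\<Sum>i<k. tens (v i) (w i))"
proof -
  interpret SO2: monoid_alg_ideal W2 "SO2_ideal N h" by (rule SO2_ideal)
  interpret Q: ring "SO2.R Quot SO2_ideal N h" by (rule SO2.quotient_is_ring)
  have tens: "tens (v i) (w i) \<in> carrier SO2.R" if "i < k" for i
    using keys_tens[OF assms(1,2)[OF that]] by (simp only: monoid_alg_simps mem_Collect_eq)
  have "(\<Oplus>\<^bsub>SOq2 N h\<^esub>i\<in>{..<k}. pure N h (Z1 i) (Z2 i)) = (\<Oplus>\<^bsub>SOq2 N h\<^esub>i\<in>{..<k}. cls2 (tens (v i) (w i)))"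
    unfolding SOq2_def
  proof (rule Q.finsum_cong'[OF refl])
    show "(\<lambda>i. cls2 (tens (v i) (w i))) \<in> {..<k} \<rightarrow> carrier (SO2.R Quot SO2_ideal N h)"
      using tens unfolding SO2.carrier_Quot by blast
  qed (simp add: assms pure_class)
  also have "\<dots> = cls2 (\<Sum>i<k. tens (v i) (w i))"
    unfolding SOq2_def by (rule SO2.Quot_finsum) (use tens in simp_all)
  finally show ?thesis .
qed

text \<open>One pure tensor for each pair of words in the support, with the coefficient put into the
  left factor. The support is enumerated because \<open>tensor_sq\<close> sums over initial segments
  of the naturals.\<close>

lemma tensor_decomposition:
  assumes "Poly_Mapping.keys z \<subseteq> W2"
  obtains k :: nat and v w where "\<And>i. i < k \<Longrightarrow> Poly_Mapping.keys (v i) \<subseteq> W"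
    "\<And>i. i < k \<Longrightarrow> Poly_Mapping.keys (w i) \<subseteq> W" "z = (\<Sum>i<k. tens (v i) (w i))"
proof -
  define k where "k = card (Poly_Mapping.keys z)"
  obtain g where g: "bij_betw g {..<k} (Poly_Mapping.keys z)"
    using ex_bij_betw_nat_finite[OF finite_keys[of z]] by (auto simp: k_def lessThan_atLeast0)
  define v where "v i = (Poly_Mapping.single (fst (g i)) (Poly_Mapping.lookup z (g i)) :: talg)" for i
  define w where "w i = (Poly_Mapping.single (snd (g i)) 1 :: talg)" for i
  have mem: "g i \<in> W2" if "i < k" for i
    using g that assms by (auto simp: bij_betw_def)
  show thesis
  proof (rule that)
    show "Poly_Mapping.keys (v i) \<subseteq> W" "Poly_Mapping.keys (w i) \<subseteq> W" if "i < k" for i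
      using mem[OF that] by (auto simp: v_def w_def keys_single mem_Times_iff split: if_splits)
    have "(\<Sum>i<k. tens (v i) (w i)) = (\<Sum>i<k. Poly_Mapping.single (g i) (Poly_Mapping.lookup z (g i)))"
      by (simp add: v_def w_def tens_single)
    also have "\<dots> = (\<Sum>m\<in>Poly_Mapping.keys z. Poly_Mapping.single m (Poly_Mapping.lookup z m))"
      by (rule sum.reindex_bij_betw[OF g])
    finally show "z = (\<Sum>i<k. tens (v i) (w i))"
      by (simp flip: poly_mapping_sum_singles)
  qed
qed

end

text \<open>Compatibility with the ideal is assumed instead of the symmetry conditions, so that
  composites qualify without verifying those conditions anew for the composite data.\<close>

locale hopf_map = monomial_map +
  fixes s :: "talg set \<Rightarrow> talg set"
  assumes phi_SO: "x \<in> SO_ideal N h \<Longrightarrow> phi x \<in> SO_ideal N h"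
    and s_class: "Poly_Mapping.keys x \<subseteq> W \<Longrightarrow> s (SO_class N h x) = SO_class N h (phi x)"
begin

lemma phi2_SO2:
  assumes "x \<in> SO2_ideal N h"
  shows "phi2 x \<in> SO2_ideal N h"
  unfolding SO2_ideal_def
  by (intro tensor_map_tensor_ideal[OF SO.monoid_alg_ideal_axioms SO.monoid_alg_ideal_axioms
        SO.monoid_alg_ideal_axioms SO.monoid_alg_ideal_axioms] keys_letter phi_SO)
    (use assms in \<open>simp_all only: SO2_ideal_def\<close>)

text \<open>\<open>tensor_sq\<close> picks the only value taken over all decompositions into pure
  tensors. Some decomposition exists, and since \<open>phi2\<close> preserves the ideal, all of them
  give the same value.\<close>

lemma tensor_sq_class:
  assumes z: "Poly_Mapping.keys z \<subseteq> W2"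
  shows "tensor_sq N h s (cls2 z) = cls2 (phi2 z)"
proof -
  interpret SO2: monoid_alg_ideal W2 "SO2_ideal N h" by (rule SO2_ideal)
  define S where "S = {\<Oplus>\<^bsub>SOq2 N h\<^esub>i\<in>{..<k}. pure N h (s (Z1 i)) (s (Z2 i)) | (k::nat) Z1 Z2.
       Z1 \<in> {..<k} \<rightarrow> carrier (SOq N h) \<and> Z2 \<in> {..<k} \<rightarrow> carrier (SOq N h) \<and>
       cls2 z = (\<Oplus>\<^bsub>SOq2 N h\<^esub>i\<in>{..<k}. pure N h (Z1 i) (Z2 i))}"
  have image: "(\<Oplus>\<^bsub>SOq2 N h\<^esub>i\<in>{..<k}. pure N h (s (Z1 i)) (s (Z2 i))) = cls2 (phi2 (\<Sum>i<k. tens (v i) (w i)))"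
    if "\<And>i. i < k \<Longrightarrow> Poly_Mapping.keys (v i) \<subseteq> W" "\<And>i. i < k \<Longrightarrow> Poly_Mapping.keys (w i) \<subseteq> W"
      "\<And>i. i < k \<Longrightarrow> Z1 i = SO_class N h (v i)" "\<And>i. i < k \<Longrightarrow> Z2 i = SO_class N h (w i)" for k :: nat and Z1 Z2 v w
  proof -
    have "(\<Oplus>\<^bsub>SOq2 N h\<^esub>i\<in>{..<k}. pure N h (s (Z1 i)) (s (Z2 i))) = cls2 (\<Sum>i<k. tens (phi (v i)) (phi (w i)))"
      by (rule finsum_pure) (simp_all add: that keys_phi s_class)
    then show ?thesis by (simp only: additive.sum[OF additive_tensor_map] tensor_map_tens)
  qed
  have "cls2 (phi2 z) \<in> S"
  proof -
    obtain k :: nat and v w where vw: "\<And>i. i < k \<Longrightarrow> Poly_Mapping.keys (v i) \<subseteq> W"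
      "\<And>i. i < k \<Longrightarrow> Poly_Mapping.keys (w i) \<subseteq> W" "z = (\<Sum>i<k. tens (v i) (w i))"
      by (rule tensor_decomposition[OF z]) (rule that)
    let ?Z1 = "\<lambda>i. SO_class N h (v i)" and ?Z2 = "\<lambda>i. SO_class N h (w i)"
    have "cls2 (phi2 z) = (\<Oplus>\<^bsub>SOq2 N h\<^esub>i\<in>{..<k}. pure N h (s (?Z1 i)) (s (?Z2 i)))"
      unfolding vw(3) by (rule image[symmetric]) (use vw in simp_all)
    moreover have "cls2 z = (\<Oplus>\<^bsub>SOq2 N h\<^esub>i\<in>{..<k}. pure N h (?Z1 i) (?Z2 i))"
      unfolding vw(3) by (rule finsum_pure[symmetric]) (use vw in simp_all)
    moreover have "?Z1 \<in> {..<k} \<rightarrow> carrier (SOq N h)" "?Z2 \<in> {..<k} \<rightarrow> carrier (SOq N h)"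
      using SO_class_carrier[OF vw(1)] SO_class_carrier[OF vw(2)] by auto
    ultimately show ?thesis
      unfolding S_def by - (rule CollectI, rule exI[of _ k], rule exI[of _ ?Z1], rule exI[of _ ?Z2], intro conjI; assumption)
  qed
  moreover have "A = cls2 (phi2 z)" if "A \<in> S" for A
  proof -
    from that obtain k :: nat and Z1 Z2 where A: "A = (\<Oplus>\<^bsub>SOq2 N h\<^esub>i\<in>{..<k}. pure N h (s (Z1 i)) (s (Z2 i)))"
      and XY: "Z1 \<in> {..<k} \<rightarrow> carrier (SOq N h)" "Z2 \<in> {..<k} \<rightarrow> carrier (SOq N h)"
      and eq: "cls2 z = (\<Oplus>\<^bsub>SOq2 N h\<^esub>i\<in>{..<k}. pure N h (Z1 i) (Z2 i))"
      unfolding S_def by blast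
    \<comment> \<open>An arbitrary decomposition consists of classes, so representatives are chosen
      in order to compute in the free algebra.\<close>
    define v where "v i = (SOME x. Z1 i = SO_class N h x \<and> Poly_Mapping.keys x \<subseteq> W)" for i
    define w where "w i = (SOME x. Z2 i = SO_class N h x \<and> Poly_Mapping.keys x \<subseteq> W)" for i
    have vw: "Z1 i = SO_class N h (v i) \<and> Poly_Mapping.keys (v i) \<subseteq> W"
      "Z2 i = SO_class N h (w i) \<and> Poly_Mapping.keys (w i) \<subseteq> W" if "i < k" for i
    proof -
      have "i \<in> {..<k}" using that by simp
      then have "Z1 i \<in> carrier (SOq N h)" "Z2 i \<in> carrier (SOq N h)"
        using funcset_mem[OF XY(1)] funcset_mem[OF XY(2)] by blast+
      then have ex: "\<exists>x. Z1 i = SO_class N h x \<and> Poly_Mapping.keys x \<subseteq> W"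
        "\<exists>x. Z2 i = SO_class N h x \<and> Poly_Mapping.keys x \<subseteq> W"
        unfolding carrier_SOq by blast+
      show "Z1 i = SO_class N h (v i) \<and> Poly_Mapping.keys (v i) \<subseteq> W"
        unfolding v_def by (rule someI_ex[OF ex(1)])
      show "Z2 i = SO_class N h (w i) \<and> Poly_Mapping.keys (w i) \<subseteq> W"
        unfolding w_def by (rule someI_ex[OF ex(2)])
    qed
    have "cls2 z = cls2 (\<Sum>i<k. tens (v i) (w i))"
      unfolding eq by (rule finsum_pure) (use vw in simp_all)
    then have "phi2 (z - (\<Sum>i<k. tens (v i) (w i))) \<in> SO2_ideal N h"
      by (intro phi2_SO2) (simp only: SO2.cls_eq_iff)
    then have "cls2 (phi2 z) = cls2 (phi2 (\<Sum>i<k. tens (v i) (w i)))"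
      by (simp only: SO2.cls_eq_iff additive.diff[OF additive_tensor_map])
    moreover have "A = cls2 (phi2 (\<Sum>i<k. tens (v i) (w i)))"
      unfolding A by (rule image) (use vw in simp_all)
    ultimately show ?thesis by simp
  qed
  ultimately have "S = {cls2 (phi2 z)}" by blast
  then show ?thesis unfolding tensor_sq_def S_def by (simp only: the_elem_eq)
qed

lemma Delta_s:
  assumes "Z1 \<in> carrier (SOq N h)"
  shows "Delta N h (s Z1) = tensor_sq N h s (Delta N h Z1)"
proof -
  obtain x where x: "Z1 = SO_class N h x" "Poly_Mapping.keys x \<subseteq> W"
    using assms by (rule SO_class_cases)
  show ?thesis
    unfolding x(1) s_class[OF x(2)] Delta_class[OF x(2)] Delta_class[OF keys_phi[OF x(2)]] Delta_phi[OF x(2)]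
    by (rule tensor_sq_class[OF keys_Delta_free[OF x(2)], symmetric])
qed

lemma eps_s:
  assumes "Z1 \<in> carrier (SOq N h)"
  shows "eps N h (s Z1) = cj b (eps N h Z1)"
proof -
  obtain x where x: "Z1 = SO_class N h x" "Poly_Mapping.keys x \<subseteq> W"
    using assms by (rule SO_class_cases)
  show ?thesis
    unfolding x(1) s_class[OF x(2)] eps_class[OF x(2)] eps_class[OF keys_phi[OF x(2)]] by (rule eps_phi[OF x(2)])
qed

lemma s_carrier: "Z1 \<in> carrier (SOq N h) \<Longrightarrow> s Z1 \<in> carrier (SOq N h)"
  by (elim SO_class_cases) (simp only: s_class SO_class_carrier keys_phi)

lemma s_add:
  assumes "Z1 \<in> carrier (SOq N h)" "Z2 \<in> carrier (SOq N h)"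
  shows "s (Z1 \<oplus>\<^bsub>SOq N h\<^esub> Z2) = s Z1 \<oplus>\<^bsub>SOq N h\<^esub> s Z2"
proof -
  obtain x where x: "Z1 = SO_class N h x" "Poly_Mapping.keys x \<subseteq> W" using assms(1) by (rule SO_class_cases)
  obtain y where y: "Z2 = SO_class N h y" "Poly_Mapping.keys y \<subseteq> W" using assms(2) by (rule SO_class_cases)
  show ?thesis
    using x y by (simp only: SOq_ops s_class keys_phi W.keys_add_subset lin_ext_add)
qed

lemma s_mult:
  assumes "Z1 \<in> carrier (SOq N h)" "Z2 \<in> carrier (SOq N h)"
  shows "s (Z1 \<otimes>\<^bsub>SOq N h\<^esub> Z2) = (if b then s Z2 \<otimes>\<^bsub>SOq N h\<^esub> s Z1 else s Z1 \<otimes>\<^bsub>SOq N h\<^esub> s Z2)"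
proof -
  obtain x where x: "Z1 = SO_class N h x" "Poly_Mapping.keys x \<subseteq> W" using assms(1) by (rule SO_class_cases)
  obtain y where y: "Z2 = SO_class N h y" "Poly_Mapping.keys y \<subseteq> W" using assms(2) by (rule SO_class_cases)
  have "s (Z1 \<otimes>\<^bsub>SOq N h\<^esub> Z2) = SO_class N h (phi (x * y))"
    using x y by (simp only: SOq_ops s_class W.keys_mult_subset)
  also have "\<dots> = (if b then s Z2 \<otimes>\<^bsub>SOq N h\<^esub> s Z1 else s Z1 \<otimes>\<^bsub>SOq N h\<^esub> s Z2)"
    unfolding free_ext_mult using x y by (simp only: SOq_ops s_class keys_phi split: if_split) simp
  finally show ?thesis .
qed

lemma s_scal:
  assumes "Z1 \<in> carrier (SOq N h)"
  shows "s (scal N h c Z1) = scal N h (cj b c) (s Z1)"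
proof -
  obtain x where x: "Z1 = SO_class N h x" "Poly_Mapping.keys x \<subseteq> W" using assms by (rule SO_class_cases)
  show ?thesis
    using x by (simp only: scal_class s_class keys_phi W.keys_mult_subset W.keys_cst_subset lin_ext_cst_mult)
qed

lemma s_one: "s \<one>\<^bsub>SOq N h\<^esub> = \<one>\<^bsub>SOq N h\<^esub>"
  unfolding SOq_one s_class[OF W.keys_one_subset] free_ext_one ..

lemma star_conjugationI:
  assumes "b" "\<And>Z. Z \<in> carrier (SOq N h) \<Longrightarrow> s (s Z) = Z"
  shows "star_conjugation N h s"
  using assms by (simp add: star_conjugation_def s_carrier s_add s_mult s_scal Delta_s eps_s)

text \<open>Both composites are antimultiplicative, so letters decide. There u_{c'} / u_{a'} = u_a /
  u_c by u_a u_{a'} = 1, and q^{\<rho>} is unchanged by \<tau>.\<close>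

lemma kappa_s:
  assumes "h \<noteq> 0" "\<not> b" and pri: "\<And>a. a < N \<Longrightarrow> \<tau> (pri N a) = pri N (\<tau> a)"
    "\<And>a. a < N \<Longrightarrow> rho2 N (\<tau> a) = rho2 N a" "\<And>a. a < N \<Longrightarrow> u a * u (pri N a) = 1"
    and "Z1 \<in> carrier (SOq N h)"
  shows "kappa N h (s Z1) = s (kappa N h Z1)"
proof -
  obtain x where x: "Z1 = SO_class N h x" "Poly_Mapping.keys x \<subseteq> W" using assms(6) by (rule SO_class_cases)
  define f where "f = (\<lambda>(a, c). kappa_fr (phi (T a c)))"
  have b: "b = False" using assms(2) by simp
  have "kappa_fr (phi x) = free_ext False True f x"
    by (rule free_ext_unique[OF additive_comp[OF lin_ext_additive lin_ext_additive] _ _ _ x(2)])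
      (auto simp: free_ext_cst free_ext_mult f_def T_def b)
  moreover have "phi (kappa_fr x) = free_ext False True f x"
  proof (rule free_ext_unique[OF additive_comp[OF lin_ext_additive lin_ext_additive] _ _ _ x(2)])
    fix y assume "y \<in> T_idx N"
    then obtain a c where y: "y = (a, c)" "a < N" "c < N" by auto
    have "u (pri N c) / u (pri N a) = u a / u c"
      using pri(3)[OF y(2)] pri(3)[OF y(3)] u_nonzero[OF y(2)] u_nonzero[OF y(3)]
        u_nonzero[OF pri_less[OF y(2)]] by (simp add: field_simps)
    moreover have "rho_w (\<tau> c) / rho_w (\<tau> a) = rho_w c / rho_w a"
      using y by (simp add: rho_w_def pri(2))
    ultimately show "phi (kappa_fr (var y)) = f y"
      using y assms(1) unfolding f_def y(1) prod.case T_def[symmetric]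
      by (simp add: kappa_fr_T phi_T[unfolded b] lin_ext_cst_mult b tau_less cst_cst_mult pri
          mult.commute[where 'a = complex])
  qed (simp_all add: free_ext_cst free_ext_mult b)
  ultimately have "kappa_fr (phi x) = phi (kappa_fr x)" by simp
  then show ?thesis
    unfolding x(1) s_class[OF x(2)] kappa_class[OF assms(1) x(2)]
      kappa_class[OF assms(1) keys_phi[OF x(2)]] s_class[OF keys_kappa_fr[OF x(2)]] by simp
qed

lemma hopf_automorphismI:
  assumes "h \<noteq> 0" "\<not> b" and "\<And>a. a < N \<Longrightarrow> \<tau> (pri N a) = pri N (\<tau> a)"
    "\<And>a. a < N \<Longrightarrow> rho2 N (\<tau> a) = rho2 N a" "\<And>a. a < N \<Longrightarrow> u a * u (pri N a) = 1"
    and inv: "\<And>x. x \<in> carrier (SOq N h) \<Longrightarrow> t x \<in> carrier (SOq N h)"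
      "\<And>x. x \<in> carrier (SOq N h) \<Longrightarrow> t (s x) = x" "\<And>x. x \<in> carrier (SOq N h) \<Longrightarrow> s (t x) = x"
  shows "hopf_automorphism N h s"
proof -
  have "s \<in> Ring.ring_hom (SOq N h) (SOq N h)"
    by (rule ring_hom_memI) (use assms(2) in \<open>simp_all add: s_carrier s_add s_mult s_one\<close>)
  moreover have "bij_betw s (carrier (SOq N h)) (carrier (SOq N h))"
    by (rule bij_betw_byWitness[where f' = t]) (use inv s_carrier in auto)
  ultimately have "s \<in> ring_iso (SOq N h) (SOq N h)" by (simp add: ring_iso_def)
  then show ?thesis
    using assms(2) kappa_s[OF assms(1-5)]
    by (simp add: hopf_automorphism_def s_scal Delta_s eps_s)
qed

end

section \<open>Composition, uniqueness and inverses of monomial maps\<close>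

context quantum_group
begin

text \<open>The letters of \<open>monomial_map.letter\<close> with \<tau> and \<open>u\<close> as
  arguments, so that maps with different data can be compared.\<close>

definition mletter :: "(nat \<Rightarrow> nat) \<Rightarrow> (nat \<Rightarrow> complex) \<Rightarrow> nat \<times> nat \<Rightarrow> talg" where
  "mletter \<tau> u = (\<lambda>(a, c). cst (u a / u c) * T (\<tau> a) (\<tau> c))"

text \<open>Only ratios of weights enter, which allows the common factor \<open>k\<close>. The inner
  weights are conjugated exactly when the outer map is antilinear, and two antilinear maps compose
  to a linear one.\<close>

lemma mphi_comp:
  assumes "\<And>a. a < N \<Longrightarrow> \<tau>2 a < N \<and> \<tau> a = \<tau>1 (\<tau>2 a) \<and> u a = k * (cj b1 (u2 a) * u1 (\<tau>2 a))" "k \<noteq> 0"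
    and "b \<longleftrightarrow> b1 \<noteq> b2" "Poly_Mapping.keys p \<subseteq> W"
  shows "free_ext b1 b1 (mletter \<tau>1 u1) (free_ext b2 b2 (mletter \<tau>2 u2) p) = free_ext b b (mletter \<tau> u) p"
proof (rule free_ext_unique[OF additive_comp[OF lin_ext_additive lin_ext_additive] _ _ _ assms(4)])
  fix x assume "x \<in> T_idx N"
  then obtain a c where x: "x = (a, c)" "a < N" "c < N" by auto
  have "cj b1 (u2 a / u2 c) * (u1 (\<tau>2 a) / u1 (\<tau>2 c)) = u a / u c"
    using assms(1)[OF x(2)] assms(1)[OF x(3)] assms(2) by simp
  then show "free_ext b1 b1 (mletter \<tau>1 u1) (free_ext b2 b2 (mletter \<tau>2 u2) (var x)) = mletter \<tau> u x"
    using assms(1)[OF x(2)] assms(1)[OF x(3)]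
    by (simp only: x mletter_def prod.case free_ext_var lin_ext_cst_mult T_def cst_cst_mult)
next
  show "free_ext b1 b1 (mletter \<tau>1 u1) (free_ext b2 b2 (mletter \<tau>2 u2) (p * r)) =
      (if b then free_ext b1 b1 (mletter \<tau>1 u1) (free_ext b2 b2 (mletter \<tau>2 u2) r) *
        free_ext b1 b1 (mletter \<tau>1 u1) (free_ext b2 b2 (mletter \<tau>2 u2) p)
       else free_ext b1 b1 (mletter \<tau>1 u1) (free_ext b2 b2 (mletter \<tau>2 u2) p) *
        free_ext b1 b1 (mletter \<tau>1 u1) (free_ext b2 b2 (mletter \<tau>2 u2) r))" for p r
    unfolding free_ext_mult[of b2] assms(3) by (cases b1; cases b2) (simp_all add: free_ext_mult)
qed (auto simp: free_ext_cst cj_def assms(3))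

lemma hopf_map_letter:
  assumes "hopf_map N h b \<tau> u s"
  shows "monomial_map.letter \<tau> u = mletter \<tau> u"
  using assms monomial_map.letter_def[of N \<tau> u] by (simp add: hopf_map_def mletter_def)

lemma hopf_map_class:
  assumes "hopf_map N h b \<tau> u s" "Poly_Mapping.keys x \<subseteq> W"
  shows "s (SO_class N h x) = SO_class N h (free_ext b b (mletter \<tau> u) x)"
  using hopf_map.s_class[OF assms] by (simp only: hopf_map_letter[OF assms(1)])

lemma hopf_mapI:
  assumes "monomial_map N \<tau> u" "\<And>x. x \<in> SO_ideal N h \<Longrightarrow> free_ext b b (mletter \<tau> u) x \<in> SO_ideal N h"
    and "\<And>x. Poly_Mapping.keys x \<subseteq> W \<Longrightarrow> s (SO_class N h x) = SO_class N h (free_ext b b (mletter \<tau> u) x)"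
  shows "hopf_map N h b \<tau> u s"
proof -
  have "monomial_map.letter \<tau> u = mletter \<tau> u"
    using monomial_map.letter_def[OF assms(1)] by (simp add: mletter_def)
  then show ?thesis
    using assms by (simp add: hopf_map_def hopf_map_axioms_def)
qed

lemma hopf_map_induced:
  assumes "monomial_symmetry N h b \<tau> u \<mu>" "\<And>x. x \<in> T_idx N \<Longrightarrow> f x = mletter \<tau> u x"
    and "s = induced (free_alg (T_idx N)) (SO_ideal N h) (free_ext b b f)"
  shows "hopf_map N h b \<tau> u s"
proof -
  interpret S: monomial_symmetry N h b \<tau> u \<mu> by fact
  have letter: "S.letter = mletter \<tau> u"
    by (simp add: S.letter_def mletter_def)
  have eq: "free_ext b b f x = free_ext b b (mletter \<tau> u) x" if "Poly_Mapping.keys x \<subseteq> W" for x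
    by (rule free_ext_eqI[OF assms(2) that])
  show ?thesis
  proof (rule hopf_mapI[OF S.monomial_map_axioms])
    show *: "free_ext b b (mletter \<tau> u) x \<in> SO_ideal N h" if "x \<in> SO_ideal N h" for x
      using S.phi_SO_ideal[OF that] by (simp only: letter)
    show "s (SO_class N h x) = SO_class N h (free_ext b b (mletter \<tau> u) x)" if "Poly_Mapping.keys x \<subseteq> W" for x
      unfolding assms(3) eq[OF that, symmetric]
      by (rule induced_class[OF lin_ext_additive _ that]) (simp only: eq[OF SO.mem_carrier] *)
  qed
qed

text \<open>Two involutions compose to an involution only if they commute, hence the separate
  hypothesis on \<tau>.\<close>

lemma hopf_map_comp:
  assumes s1: "hopf_map N h b1 \<tau>1 u1 s1" and s2: "hopf_map N h b2 \<tau>2 u2 s2"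
    and eq: "\<And>a. a < N \<Longrightarrow> \<tau> a = \<tau>1 (\<tau>2 a) \<and> u a = k * (cj b1 (u2 a) * u1 (\<tau>2 a))" "k \<noteq> 0"
    and inv: "\<And>a. a < N \<Longrightarrow> \<tau> (\<tau> a) = a" and b: "b \<longleftrightarrow> b1 \<noteq> b2"
  shows "hopf_map N h b \<tau> u (s1 \<circ> s2)"
proof -
  interpret S1: hopf_map N h b1 \<tau>1 u1 s1 by (rule s1)
  interpret S2: hopf_map N h b2 \<tau>2 u2 s2 by (rule s2)
  have comp: "free_ext b1 b1 (mletter \<tau>1 u1) (free_ext b2 b2 (mletter \<tau>2 u2) p) = free_ext b b (mletter \<tau> u) p"
    if "Poly_Mapping.keys p \<subseteq> W" for p
    by (rule mphi_comp[OF _ eq(2) b that]) (use eq(1) S2.tau_less in blast)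
  show ?thesis
  proof (rule hopf_mapI)
    show "monomial_map N \<tau> u"
      using eq inv by (simp add: monomial_map_def S1.tau_less S2.tau_less S1.u_nonzero S2.u_nonzero)
    show "free_ext b b (mletter \<tau> u) x \<in> SO_ideal N h" if "x \<in> SO_ideal N h" for x
      using S1.phi_SO[OF S2.phi_SO[OF that]]
      unfolding comp[OF SO.mem_carrier[OF that], symmetric] hopf_map_letter[OF s1] hopf_map_letter[OF s2] .
    show "(s1 \<circ> s2) (SO_class N h x) = SO_class N h (free_ext b b (mletter \<tau> u) x)" if "Poly_Mapping.keys x \<subseteq> W" for x
      using S2.keys_phi[OF that] unfolding hopf_map_letter[OF s2] comp[OF that, symmetric] o_def hopf_map_class[OF s2 that]
      by (rule hopf_map_class[OF s1])
  qed
qed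

lemma hopf_map_unique:
  assumes "hopf_map N h b \<tau> u s" "hopf_map N h b \<tau> u t" "Z \<in> carrier (SOq N h)"
  shows "s Z = t Z"
  using assms(3) by (rule SO_class_cases) (simp only: hopf_map_class[OF assms(1)] hopf_map_class[OF assms(2)])

lemma hopf_map_id: "hopf_map N h False (\<lambda>a. a) (\<lambda>a. 1) (\<lambda>x. x)"
proof -
  have "free_ext False False (mletter (\<lambda>a. a) (\<lambda>a. 1)) x = x" if "Poly_Mapping.keys x \<subseteq> W" for x
    by (rule free_ext_unique[symmetric, OF _ _ _ _ that]) (auto simp: additive_def mletter_def T_def)
  then show ?thesis
    by (intro hopf_mapI) (simp_all add: monomial_map_def SO.mem_carrier)
qed

lemma hopf_map_inverse:
  assumes "hopf_map N h b \<tau> u s" "hopf_map N h b \<tau>' u' t"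
    and "\<And>a. a < N \<Longrightarrow> \<tau> (\<tau>' a) = a \<and> cj b (u' a) * u (\<tau>' a) = 1" "Z \<in> carrier (SOq N h)"
  shows "s (t Z) = Z"
proof -
  have "hopf_map N h False (\<lambda>a. a) (\<lambda>a. 1) (s \<circ> t)"
    by (rule hopf_map_comp[OF assms(1,2), where k = 1]) (use assms(3) in auto)
  from hopf_map_unique[OF this hopf_map_id assms(4)] show ?thesis by simp
qed

lemma hopf_map_gen:
  "hopf_map N h b \<tau> u s \<Longrightarrow> a < N \<Longrightarrow> c < N \<Longrightarrow> s (gen N h a c) = SO_class N h (cst (u a / u c) * T (\<tau> a) (\<tau> c))"
  unfolding gen_def using hopf_map_class[OF _ keys_T] by (simp add: T_def free_ext_var mletter_def)

end

subsection \<open>Monomial matrices\<close>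

definition monomial_mat :: "nat \<Rightarrow> (nat \<Rightarrow> nat) \<Rightarrow> (nat \<Rightarrow> complex) \<Rightarrow> complex mat" where
  "monomial_mat N \<tau> x = mat N N (\<lambda>(i, j). if j = \<tau> i then x i else 0)"

lemma monomial_mat_carrier [simp]: "monomial_mat N \<tau> x \<in> carrier_mat N N"
  by (simp add: monomial_mat_def)

text \<open>\<open>minv\<close> reads off an option; invertibility excludes \<open>None\<close>, and
  the inverse found is then identified by uniqueness of inverses.\<close>

lemma minv_eq:
  assumes "A \<in> carrier_mat N N" "B \<in> carrier_mat N N" "A * B = 1\<^sub>m N"
  shows "minv A = B"
proof -
  have BA: "B * A = 1\<^sub>m N" using mat_mult_left_right_inverse[OF assms] .
  have "det A * det B = 1" using det_mult[OF assms(1,2)] assms(3) by simp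
  then have "det A \<noteq> 0" by auto
  then have "A \<in> Units (ring_mat TYPE(complex) N ())" by (rule det_non_zero_imp_unit[OF assms(1)])
  then obtain C where C: "mat_inverse A = Some C"
    using mat_inverse(1)[OF assms(1), where b = "()"] by (cases "mat_inverse A") auto
  from mat_inverse(2)[OF assms(1) this] have AC: "A * C = 1\<^sub>m N" "C \<in> carrier_mat N N" by auto
  have "C = (B * A) * C" using AC by (simp add: BA)
  also have "\<dots> = B * (A * C)" by (rule assoc_mult_mat[OF assms(2,1) AC(2)])
  also have "\<dots> = B" using assms(2) by (simp add: AC)
  finally show ?thesis by (simp add: C)
qed

lemma monomial_mat_mult:
  assumes "\<And>a. a < N \<Longrightarrow> \<tau> a < N" "A \<in> carrier_mat N N" "i < N" "j < N"
  shows "(monomial_mat N \<tau> x * A) $$ (i, j) = x i * A $$ (\<tau> i, j)"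
proof -
  have "(monomial_mat N \<tau> x * A) $$ (i, j) = (\<Sum>k = 0..<N. (if k = \<tau> i then x i else 0) * A $$ (k, j))"
    using assms by (simp add: monomial_mat_def scalar_prod_def)
  also have "\<dots> = (\<Sum>k = 0..<N. if k = \<tau> i then x i * A $$ (k, j) else 0)"
    by (intro sum.cong) auto
  also have "\<dots> = x i * A $$ (\<tau> i, j)" using assms by simp
  finally show ?thesis .
qed

locale monomial_matrix =
  fixes N :: nat and \<tau> :: "nat \<Rightarrow> nat" and x :: "nat \<Rightarrow> complex"
  assumes less: "a < N \<Longrightarrow> \<tau> a < N" and invol: "a < N \<Longrightarrow> \<tau> (\<tau> a) = a" and nz: "a < N \<Longrightarrow> x a \<noteq> 0"
begin

lemma mult_inverse: "monomial_mat N \<tau> x * monomial_mat N \<tau> (\<lambda>a. 1 / x (\<tau> a)) = 1\<^sub>m N"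
proof (rule eq_matI)
  fix i j assume ij: "i < dim_row (1\<^sub>m N :: complex mat)" "j < dim_col (1\<^sub>m N :: complex mat)"
  then have "(monomial_mat N \<tau> x * monomial_mat N \<tau> (\<lambda>a. 1 / x (\<tau> a))) $$ (i, j)
      = x i * monomial_mat N \<tau> (\<lambda>a. 1 / x (\<tau> a)) $$ (\<tau> i, j)"
    by (intro monomial_mat_mult less) auto
  also have "\<dots> = 1\<^sub>m N $$ (i, j)"
    using ij by (auto simp: monomial_mat_def less invol nz)
  finally show "(monomial_mat N \<tau> x * monomial_mat N \<tau> (\<lambda>a. 1 / x (\<tau> a))) $$ (i, j) = 1\<^sub>m N $$ (i, j)" .
qed (simp_all add: monomial_mat_def)

lemma minv_monomial: "minv (monomial_mat N \<tau> x) = monomial_mat N \<tau> (\<lambda>a. 1 / x (\<tau> a))"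
  by (rule minv_eq[OF _ _ mult_inverse]) simp_all

lemma invertible_monomial: "invertible_mat (monomial_mat N \<tau> x)"
proof -
  have "monomial_mat N \<tau> (\<lambda>a. 1 / x (\<tau> a)) * monomial_mat N \<tau> x = 1\<^sub>m N"
    by (rule mat_mult_left_right_inverse[OF _ _ mult_inverse]) simp_all
  with mult_inverse show ?thesis
    unfolding invertible_mat_def inverts_mat_def square_mat.simps
    by (intro conjI exI[of _ "monomial_mat N \<tau> (\<lambda>a. 1 / x (\<tau> a))"]) (simp_all add: monomial_mat_def)
qed

lemma UTU_monomial:
  assumes "a < N" "c < N"
  shows "UTU N (monomial_mat N \<tau> x) a c = cst (x a / x c) * T (\<tau> a) (\<tau> c)"
proof -
  have entry: "monomial_mat N \<tau> x $$ (a, e) * minv (monomial_mat N \<tau> x) $$ (d, c)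
      = (if d = \<tau> c then if e = \<tau> a then x a / x c else 0 else 0)" if "d < N" "e < N" for d e
  proof -
    have "c = \<tau> d \<longleftrightarrow> d = \<tau> c" using that assms invol by metis
    then show ?thesis using assms that unfolding minv_monomial by (auto simp: monomial_mat_def less invol)
  qed
  have "UTU N (monomial_mat N \<tau> x) a c
      = (\<Sum>e<N. \<Sum>d<N. if d = \<tau> c then if e = \<tau> a then cst (x a / x c) * T (\<tau> a) (\<tau> c) else 0 else 0)"
    unfolding UTU_def by (intro sum.cong refl) (auto simp: entry)
  also have "\<dots> = cst (x a / x c) * T (\<tau> a) (\<tau> c)"
    using assms by (simp add: less)
  finally show ?thesis .
qed

end

lemma Dmat_monomial: "N > 2 \<Longrightarrow> Dmat N = monomial_mat N (flip_idx N) (flip_sgn N)"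
proof (rule eq_matI)
  fix i j assume N: "N > 2" and "i < dim_row (monomial_mat N (flip_idx N) (flip_sgn N))"
    "j < dim_col (monomial_mat N (flip_idx N) (flip_sgn N))"
  then have ij: "i < N" "j < N" by (simp_all add: monomial_mat_def)
  have iff: "i = flip_idx N j \<longleftrightarrow> j = flip_idx N i"
    by (rule iffI) simp_all
  show "Dmat N $$ (i, j) = monomial_mat N (flip_idx N) (flip_sgn N) $$ (i, j)"
  proof (cases "even N")
    case True
    then have "Dmat N $$ (i, j) = (if i = flip_idx N j then 1 else 0)"
      using ij by (simp add: Dmat_def flip_idx_def)
    then show ?thesis
      unfolding iff using ij True by (simp add: monomial_mat_def flip_sgn_def)
  next
    case False
    then show ?thesis
      using ij by (simp add: Dmat_def monomial_mat_def mat_diag_def flip_idx_def flip_sgn_def)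
  qed
qed (auto simp: Dmat_def monomial_mat_def mat_diag_def)

section \<open>The automorphism and the conjugations\<close>

lemma flip_idx_pri_pri:
  assumes "N > 2" "a < N"
  shows "flip_idx N (pri N (flip_idx N (pri N a))) = a" "pri N (flip_idx N (pri N (flip_idx N a))) = a"
  using assms by (simp_all add: flip_idx_pri flip_idx_less pri_pri pri_less)

lemma flip_sgn_sq [simp]: "flip_sgn N a * flip_sgn N a = 1"
  by (simp add: flip_sgn_def)

lemma cnj_flip_sgn [simp]: "cnj (flip_sgn N a) = flip_sgn N a"
  by (simp add: flip_sgn_def)

lemma flip_sgn_nonzero [simp]: "flip_sgn N a \<noteq> 0"
  by (simp add: flip_sgn_def)

lemma flip_sgn_pri_eq: "a < N \<Longrightarrow> flip_sgn N (pri N a) = flip_sgn N a"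
  by (auto simp: flip_sgn_def pri_def elim!: oddE)

context quantum_group
begin

lemma hopf_map_sharp:
  assumes "N > 2"
  shows "hopf_map N h False (flip_idx N) (flip_sgn N) (sharp N h)"
proof (rule hopf_map_induced)
  show "monomial_symmetry N h False (flip_idx N) (flip_sgn N) 0"
    using assms by unfold_locales
      (simp_all add: flip_idx_less flip_sgn_pri metric_flip PA_flip Rm_flip)
  show "sharp N h = induced (free_alg (T_idx N)) (SO_ideal N h) (free_ext False False (\<lambda>(a, b). UTU N (Dmat N) a b))"
    by (simp add: sharp_def alg_ext_word)
  interpret D: monomial_matrix N "flip_idx N" "flip_sgn N"
    using assms by unfold_locales (simp_all add: flip_idx_less)
  show "(\<lambda>(a, b). UTU N (Dmat N) a b) x = mletter (flip_idx N) (flip_sgn N) x" if "x \<in> T_idx N" for x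
    using that by (auto simp: Dmat_monomial[OF assms] D.UTU_monomial mletter_def)
qed

lemma hopf_map_times:
  assumes "N > 2" "h \<in> q_roots_unit N"
  shows "hopf_map N h True (\<lambda>a. a) (\<lambda>a. 1) (times_conj N h)"
proof (rule hopf_map_induced)
  show "monomial_symmetry N h True (\<lambda>a. a) (\<lambda>a. 1) (h\<^sup>2 - inverse (h\<^sup>2))"
    using assms by unfold_locales (simp_all add: cnj_metric_unit cnj_PA_unit cnj_Rm_unit)
  show "times_conj N h = induced (free_alg (T_idx N)) (SO_ideal N h) (free_ext True True (\<lambda>(a, b). T a b))"
    by (simp add: times_conj_def star_ext_word)
qed (auto simp: mletter_def)

text \<open>Transposing \<kappa>(T) undoes its exchange of indices, so that both are merely primed.
  For real q the data are real, and priming with exchanged factors is a symmetry of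
  \<open>R\<close>; hence no correction term arises and \<mu> = 0.\<close>

lemma hopf_map_star:
  assumes "h \<in> q_roots_real N"
  shows "hopf_map N h True (pri N) rho_w (star_conj N h)"
proof (rule hopf_map_induced)
  have h: "h \<noteq> 0" using q_roots_nonzero[OF q_roots_real_subset[OF assms]] .
  show "monomial_symmetry N h True (pri N) rho_w 0"
    using assms by unfold_locales
      (simp_all add: pri_less pri_pri rho_w_nonzero rho_w_pri h metric_pri cnj_metric_real PA_pri cnj_PA_real
        Rm_pri cnj_Rm_real)
  show "star_conj N h = induced (free_alg (T_idx N)) (SO_ideal N h) (free_ext True True (\<lambda>(a, b). kappa_T N h b a))"
    by (simp add: star_conj_def star_ext_word)
  show "(\<lambda>(a, b). kappa_T N h b a) x = mletter (pri N) rho_w x" if "x \<in> T_idx N" for x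
    using that h by (auto simp: mletter_def kappa_T_eq)
qed

lemma sharp_sharp:
  assumes "N > 2" "Z \<in> carrier (SOq N h)"
  shows "sharp N h (sharp N h Z) = Z"
  by (rule hopf_map_inverse[OF hopf_map_sharp hopf_map_sharp]) (use assms in \<open>simp_all add: flip_sgn_idx\<close>)

lemma sharp_automorphism:
  assumes "N > 2" "h \<noteq> 0"
  shows "hopf_automorphism N h (sharp N h)"
proof -
  interpret S: hopf_map N h False "flip_idx N" "flip_sgn N" "sharp N h"
    by (rule hopf_map_sharp[OF assms(1)])
  show ?thesis
    by (rule S.hopf_automorphismI[where t = "sharp N h"])
      (use assms in \<open>simp_all add: flip_idx_pri rho2_flip_idx flip_sgn_pri S.s_carrier sharp_sharp\<close>)
qed

lemma hopf_map_star_sharp: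
  assumes "N > 2" "h \<in> q_roots_real N"
  shows "hopf_map N h True (\<lambda>a. flip_idx N (pri N a)) (\<lambda>a. rho_w a * flip_sgn N (pri N a)) (star_sharp N h)"
  unfolding star_sharp_def
  by (rule hopf_map_comp[OF hopf_map_sharp hopf_map_star, where k = 1])
    (use assms in \<open>simp_all add: flip_idx_pri_pri\<close>)

lemma star_sharp_commute:
  assumes "N > 2" "h \<in> q_roots_real N" "Z \<in> carrier (SOq N h)"
  shows "sharp N h (star_conj N h Z) = star_conj N h (sharp N h Z)"
proof -
  have "hopf_map N h True (\<lambda>a. flip_idx N (pri N a)) (\<lambda>a. rho_w a * flip_sgn N (pri N a)) (star_conj N h \<circ> sharp N h)"
    by (rule hopf_map_comp[OF hopf_map_star hopf_map_sharp, where k = 1])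
      (use assms in \<open>simp_all add: flip_idx_pri flip_idx_less pri_less pri_pri rho_w_def rho2_flip_idx flip_sgn_pri_eq\<close>)
  from hopf_map_unique[OF hopf_map_star_sharp[OF assms(1,2)] this assms(3)] show ?thesis
    by (simp add: star_sharp_def)
qed

text \<open>The square has the weights cnj(q^{\<rho>_a}) q^{\<rho>_{a'}}, equal to 1 because
  q^{\<rho>_a} is real, times a product of two equal signs.\<close>

lemma star_sharp_conjugation:
  assumes "N > 2" "h \<in> q_roots_real N"
  shows "star_conjugation N h (star_sharp N h)"
proof (rule hopf_map.star_conjugationI[OF hopf_map_star_sharp[OF assms]])
  have h: "h \<noteq> 0" using q_roots_nonzero[OF q_roots_real_subset[OF assms(2)]] .
  have "cnj (rho_w a) = rho_w a" for a
    unfolding rho_w_def by (rule cnj_powi_rho2[OF assms(2)])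
  moreover have "rho_w a * rho_w (flip_idx N (pri N a)) = 1" if "a < N" for a
    using rho_w_pri[OF h that] that assms(1) by (simp add: rho_w_def rho2_flip_idx pri_less)
  moreover have "flip_sgn N (pri N a) * flip_sgn N (pri N (flip_idx N (pri N a))) = 1" if "a < N" for a
    using that assms(1) by (simp add: flip_sgn_pri_eq flip_sgn_idx flip_idx_less pri_less)
  ultimately have "cj True (rho_w a * flip_sgn N (pri N a)) *
      (rho_w (flip_idx N (pri N a)) * flip_sgn N (pri N (flip_idx N (pri N a)))) = 1" if "a < N" for a
    using that by (simp add: mult.assoc mult.left_commute[of "flip_sgn N _" "rho_w _"])
  then show "star_sharp N h (star_sharp N h Z) = Z" if "Z \<in> carrier (SOq N h)" for Z
    using assms that by (intro hopf_map_inverse[OF hopf_map_star_sharp hopf_map_star_sharp])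
      (simp_all only: flip_idx_pri_pri simp_thms)
qed simp

lemma hopf_map_times_sharp:
  assumes "N > 2" "h \<in> q_roots_unit N"
  shows "hopf_map N h True (flip_idx N) (flip_sgn N) (times_sharp N h)"
  unfolding times_sharp_def
  by (rule hopf_map_comp[OF hopf_map_sharp hopf_map_times, where k = 1]) (use assms in simp_all)

lemma times_sharp_commute:
  assumes "N > 2" "h \<in> q_roots_unit N" "Z \<in> carrier (SOq N h)"
  shows "sharp N h (times_conj N h Z) = times_conj N h (sharp N h Z)"
proof -
  have "hopf_map N h True (flip_idx N) (flip_sgn N) (times_conj N h \<circ> sharp N h)"
    by (rule hopf_map_comp[OF hopf_map_times hopf_map_sharp, where k = 1]) (use assms in simp_all)
  from hopf_map_unique[OF hopf_map_times_sharp[OF assms(1,2)] this assms(3)] show ?thesis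
    by (simp add: times_sharp_def)
qed

lemma times_sharp_conjugation:
  assumes "N > 2" "h \<in> q_roots_unit N"
  shows "star_conjugation N h (times_sharp N h)"
proof (rule hopf_map.star_conjugationI[OF hopf_map_times_sharp[OF assms]])
  show "times_sharp N h (times_sharp N h Z) = Z" if "Z \<in> carrier (SOq N h)" for Z
    by (rule hopf_map_inverse[OF hopf_map_times_sharp hopf_map_times_sharp])
      (use assms that in \<open>simp_all add: flip_sgn_idx\<close>)
qed simp

text \<open>
  For odd \<open>N\<close> the equivalence is realised by conjugation with \<open>A = diag(i, \<dots>, i, 1, - i, \<dots>, - i)\<close>:
  it preserves the metric, and \<open>A\<^sup>2\<close> equals \<open>\<D>\<close> up to sign.
\<close>

definition torus :: "nat \<Rightarrow> complex" where
  "torus a = (if a < N div 2 then \<i> else if a = N div 2 then 1 else - \<i>)"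

lemma torus_pri: "odd N \<Longrightarrow> a < N \<Longrightarrow> torus a * torus (pri N a) = 1"
  by (auto simp: torus_def pri_def elim!: oddE)

text \<open>With the identity as index map the conditions on \<open>R\<close>, \<open>C\<close> and
  \<open>PA\<close> are trivial and only u_a u_{a'} = 1 has to be checked. The reciprocal weights
  are included because they give the inverse automorphism.\<close>

lemma hopf_map_torus:
  assumes "odd N" "u = torus \<or> u = (\<lambda>a. 1 / torus a)"
  obtains s where "hopf_map N h False (\<lambda>a. a) u s"
proof
  have "torus a \<noteq> 0" for a by (simp add: torus_def)
  moreover have "1 / torus a * (1 / torus (pri N a)) = 1" if "a < N" for a
    using torus_pri[OF assms(1) that] by simp
  ultimately have "monomial_symmetry N h False (\<lambda>a. a) u 0"
    using assms torus_pri by unfold_locales auto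
  then show "hopf_map N h False (\<lambda>a. a) u
      (induced (free_alg (T_idx N)) (SO_ideal N h) (free_ext False False (mletter (\<lambda>a. a) u)))"
    by (rule hopf_map_induced) simp_all
qed

lemma times_sharp_equivalent:
  assumes "N > 2" "odd N" "h \<in> q_roots_unit N"
  shows "conj_equivalent N h (times_conj N h) (times_sharp N h)"
proof -
  have h: "h \<noteq> 0" using q_roots_nonzero[OF q_roots_unit_subset[OF assms(3)]] .
  obtain \<alpha> where \<alpha>: "hopf_map N h False (\<lambda>a. a) torus \<alpha>"
    using hopf_map_torus[OF assms(2)] by blast
  obtain \<beta> where \<beta>: "hopf_map N h False (\<lambda>a. a) (\<lambda>a. 1 / torus a) \<beta>"
    using hopf_map_torus[OF assms(2)] by blast
  interpret \<alpha>: hopf_map N h False "\<lambda>a. a" torus \<alpha> by (rule \<alpha>)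
  interpret \<beta>: hopf_map N h False "\<lambda>a. a" "\<lambda>a. 1 / torus a" \<beta> by (rule \<beta>)
  have nz: "torus a \<noteq> 0" for a by (simp add: torus_def)
  have inv: "\<alpha> (\<beta> Z) = Z" "\<beta> (\<alpha> Z) = Z" if "Z \<in> carrier (SOq N h)" for Z
    using hopf_map_inverse[OF \<alpha> \<beta> _ that] hopf_map_inverse[OF \<beta> \<alpha> _ that] by (simp_all add: nz)
  have "hopf_automorphism N h \<alpha>"
    by (rule \<alpha>.hopf_automorphismI[where t = \<beta>]) (simp_all add: h torus_pri assms(2) inv \<beta>.s_carrier)
  moreover have "times_sharp N h Z = \<alpha> (times_conj N h (inv_into (carrier (SOq N h)) \<alpha> Z))"
    if Z: "Z \<in> carrier (SOq N h)" for Z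
  proof -
    have "inj_on \<alpha> (carrier (SOq N h))"
      by (rule inj_on_inverseI[of _ \<beta>]) (rule inv(2))
    then have "inv_into (carrier (SOq N h)) \<alpha> Z = \<beta> Z"
      by (rule inv_into_f_eq) (simp_all add: Z \<beta>.s_carrier inv)
    \<comment> \<open>The outer map \<times> conjugates the weights of \<beta>. The torus entries
      have modulus 1, so each reciprocal conjugate is the entry itself.\<close>
    moreover have "hopf_map N h True (\<lambda>a. a) (\<lambda>a. 1 / cnj (torus a)) (times_conj N h \<circ> \<beta>)"
      by (rule hopf_map_comp[OF hopf_map_times \<beta>, where k = 1]) (use assms in simp_all)
    \<comment> \<open>The weights of the composite are the squares -1, 1, -1 of the torus entries,
      that is minus the entries of \<open>Dmat\<close>; the factor k = -1 removes the sign.\<close>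
    then have "hopf_map N h True (flip_idx N) (flip_sgn N) (\<alpha> \<circ> (times_conj N h \<circ> \<beta>))"
      by (rule hopf_map_comp[OF \<alpha>, where k = "- 1"])
        (use assms in \<open>auto simp: flip_idx_def flip_sgn_def torus_def\<close>)
    ultimately show ?thesis
      using hopf_map_unique[OF hopf_map_times_sharp[OF assms(1,3)] _ Z] by simp
  qed
  ultimately show ?thesis by (auto simp: conj_equivalent_def)
qed

end

section \<open>Real forms\<close>

lemma map_mat_mult:
  fixes f :: "'a::comm_ring_1 \<Rightarrow> 'b::comm_ring_1"
  assumes "f 0 = 0" "f 1 = 1" "\<And>x y. f (x + y) = f x + f y" "\<And>x y. f (x * y) = f x * f y"
    and "A \<in> carrier_mat N N" "B \<in> carrier_mat N N"
  shows "map_mat f (A * B) = map_mat f A * map_mat f B"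
proof -
  interpret semiring_hom f using assms(1-4) by unfold_locales
  show ?thesis by (rule mat_hom_mult[OF assms(5,6)])
qed

abbreviation sig_mat :: "nat \<Rightarrow> nat \<Rightarrow> 'a::ring_1 mat" where
  "sig_mat l m \<equiv> mat_diag (l + m) (\<lambda>i. if i < l then 1 else - 1)"

lemma sig_mat_carrier [simp]: "sig_mat l m \<in> carrier_mat (l + m) (l + m)"
  by (simp add: mat_diag_def)

text \<open>Being real is rewritten as being fixed by entrywise conjugation. This puts the group in
  the same form as \<open>limit_group\<close>, with the identity in place of U_1.\<close>

lemma SO_real_eq:
  "SO_real l m = {g \<in> carrier_mat (l + m) (l + m). det g = 1 \<and>
     transpose_mat g * sig_mat l m * g = sig_mat l m \<and> map_mat cnj g = g}" (is "_ = ?S")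
proof -
  let ?N = "l + m" and ?r = "map_mat complex_of_real" and ?E = "sig_mat l m :: real mat"
  have E: "?r ?E = sig_mat l m"
    by (rule eq_matI) (auto simp: mat_diag_def)
  have iff: "?r g \<in> ?S \<longleftrightarrow> det g = 1 \<and> transpose_mat g * ?E * g = ?E" if g: "g \<in> carrier_mat ?N ?N" for g
  proof -
    have "transpose_mat (?r g) * sig_mat l m * ?r g = ?r (transpose_mat g * ?E * g)"
      using g unfolding E[symmetric] map_mat_transpose
      by (simp add: map_mat_mult[of complex_of_real _ ?N])
    moreover have "?r (transpose_mat g * ?E * g) = ?r ?E \<longleftrightarrow> transpose_mat g * ?E * g = ?E"
    proof -
      have "transpose_mat g * ?E * g \<in> carrier_mat ?N ?N"
        by (rule mult_carrier_mat[OF mult_carrier_mat[OF _ sig_mat_carrier] g]) (use g in simp)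
      then show ?thesis by (auto simp: mat_eq_iff)
    qed
    moreover have "map_mat cnj (?r g) = ?r g" by (rule eq_matI) auto
    ultimately show ?thesis
      using g unfolding E[symmetric] by simp
  qed
  have "g = ?r (map_mat Re g)" if "map_mat cnj g = g" for g
  proof (rule eq_matI)
    fix i j assume ij: "i < dim_row (?r (map_mat Re g))" "j < dim_col (?r (map_mat Re g))"
    then have "map_mat cnj g $$ (i, j) = cnj (g $$ (i, j))" by simp
    then have "cnj (g $$ (i, j)) = g $$ (i, j)" using that by simp
    then show "g $$ (i, j) = ?r (map_mat Re g) $$ (i, j)"
      using ij by (simp add: complex_eq_iff)
  qed simp_all
  then have "g \<in> ?r ` {g \<in> carrier_mat ?N ?N. det g = 1 \<and> transpose_mat g * ?E * g = ?E}" if "g \<in> ?S" for g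
    using that iff[of "map_mat Re g"] by (intro image_eqI[of _ _ "map_mat Re g"]) auto
  moreover have "?r g \<in> ?S" if "g \<in> carrier_mat ?N ?N" "det g = 1" "transpose_mat g * ?E * g = ?E" for g
    using iff that by blast
  ultimately show ?thesis
    unfolding SO_real_def Let_def by blast
qed

lemma metric_one: "metric N 1 = monomial_mat N (pri N) (\<lambda>_. 1)"
  by (rule eq_matI) (auto simp: metric_def monomial_mat_def pri_def)

text \<open>The columns of \<open>M\<close> form a basis fixed by v \<mapsto> U^{-1} cnj v in which
  the form is twice a diagonal one. In this basis each of the three conditions of the limit group
  becomes the corresponding condition of SO(l, m), as a form and its double have the same
  isometries.\<close>

lemma limit_group_conj:
  assumes N: "N = l + m" and M: "M \<in> carrier_mat N N" and U: "U \<in> carrier_mat N N" and V: "V \<in> carrier_mat N N"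
    and UV: "U * V = 1\<^sub>m N" and conj: "map_mat cnj M = U * M"
    and form: "transpose_mat M * metric N 1 * M = 2 \<cdot>\<^sub>m sig_mat l m"
  shows "invertible_mat M" "limit_group N U = (\<lambda>g. M * g * minv M) ` SO_real l m"
proof -
  let ?J = "metric N 1" and ?E = "sig_mat l m :: complex mat"
  have J: "?J \<in> carrier_mat N N" by (simp add: metric_def)
  have E: "?E \<in> carrier_mat N N" by (simp add: N)
  have "det ?E * det ?E = 1"
  proof -
    have "?E * ?E = 1\<^sub>m N"
      unfolding N by (subst mat_diag_diag) (auto simp: mat_diag_def intro!: eq_matI)
    then show ?thesis using det_mult[OF E E] by simp
  qed
  then have "det (2 \<cdot>\<^sub>m ?E) \<noteq> 0" by auto
  \<comment> \<open>The Gram matrix is invertible and det M is a factor of its determinant, so the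
    columns are independent.\<close>
  then have "det M \<noteq> 0"
    unfolding form[symmetric] using det_mult[of "transpose_mat M * ?J" N M] M J by auto
  then have "M \<in> Units (ring_mat TYPE(complex) N ())" by (rule det_non_zero_imp_unit[OF M])
  then obtain W where W: "W \<in> carrier_mat N N" "M * W = 1\<^sub>m N" "W * M = 1\<^sub>m N"
    by (auto simp: Units_def ring_mat_def)
  have minv: "minv M = W" "minv U = V"
    by (rule minv_eq[OF M W(1,2)], rule minv_eq[OF U V UV])
  have VU: "V * U = 1\<^sub>m N" by (rule mat_mult_left_right_inverse[OF U V UV])
  show "invertible_mat M"
    unfolding invertible_mat_def inverts_mat_def square_mat.simps using M W by (intro conjI exI[of _ W]) auto
  note carr = M U V W(1) J E
  note [simp] = mult_carrier_mat[of _ N N _ N] assoc_mult_mat[of _ N N _ N _ N] transpose_mult[of _ N N _ N]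
  \<comment> \<open>Products are normalised to the right by associativity, so cancellation of
    inverse pairs is stated with a remaining factor \<open>A\<close>.\<close>
  have cancel: "W * (M * A) = A" "M * (W * A) = A" "V * (U * A) = A" "U * (V * A) = A"
    if "A \<in> carrier_mat N N" for A
    using assoc_mult_mat[OF W(1) M that] assoc_mult_mat[OF M W(1) that] assoc_mult_mat[OF V U that]
      assoc_mult_mat[OF U V that] that by (simp_all add: W VU UV del: assoc_mult_mat)
  have cancel_right: "A = B" if "A \<in> carrier_mat N N" "B \<in> carrier_mat N N" "A * M = B * M" for A B
  proof -
    have "A * (M * W) = A * M * W" by (rule assoc_mult_mat[OF that(1) M W(1), symmetric])
    also have "\<dots> = B * (M * W)" unfolding that(3) by (rule assoc_mult_mat[OF that(2) M W(1)])
    finally show ?thesis using that(1,2) by (simp add: W)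
  qed
  have key: "M * g * W \<in> limit_group N U \<longleftrightarrow> g \<in> SO_real l m" if g: "g \<in> carrier_mat N N" for g
  proof -
    let ?y = "M * g * W"
    have y: "?y \<in> carrier_mat N N" using carr g by simp
    have yM: "?y * M = M * g" using carr g W by simp
    have "det M * det W = 1" using det_mult[OF M W(1)] W by simp
    then have 1: "det ?y = det g"
      using det_mult[of "M * g" N W] det_mult[OF M g] carr g by (simp add: mult.commute mult.left_commute)
    have T: "transpose_mat M * (transpose_mat ?y * ?J * ?y) * M = transpose_mat (?y * M) * ?J * (?y * M)"
      using carr g y by simp
    also have "\<dots> = transpose_mat g * (transpose_mat M * ?J * M) * g"
      unfolding yM using carr g by simp
    also have "\<dots> = 2 \<cdot>\<^sub>m (transpose_mat g * ?E * g)"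
      unfolding form using carr g
      by (simp add: mult_smult_distrib[of _ N N _ N] mult_smult_assoc_mat[of _ N N _ N])
    finally have T: "transpose_mat M * (transpose_mat ?y * ?J * ?y) * M = 2 \<cdot>\<^sub>m (transpose_mat g * ?E * g)" .
    have half: "(1 / 2 :: complex) \<cdot>\<^sub>m (2 \<cdot>\<^sub>m A) = A" for A by (rule eq_matI) auto
    have 2: "transpose_mat ?y * ?J * ?y = ?J \<longleftrightarrow> transpose_mat g * ?E * g = ?E"
    proof
      assume "transpose_mat ?y * ?J * ?y = ?J"
      then have "2 \<cdot>\<^sub>m (transpose_mat g * ?E * g) = 2 \<cdot>\<^sub>m ?E"
        using T form by simp
      then show "transpose_mat g * ?E * g = ?E" by (metis half)
    next
      assume "transpose_mat g * ?E * g = ?E"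
      then have "transpose_mat M * (transpose_mat ?y * ?J * ?y) * M = transpose_mat M * ?J * M"
        using T form by (simp only:)
      then have eq: "transpose_mat M * (transpose_mat ?y * ?J * ?y) = transpose_mat M * ?J"
        by (rule cancel_right[rotated 2]) (use carr y in simp_all)
      have "transpose_mat W * (transpose_mat M * A) = A" if "A \<in> carrier_mat N N" for A
      proof -
        have "transpose_mat W * transpose_mat M = 1\<^sub>m N"
          using transpose_mult[OF M W(1)] W by simp
        then show ?thesis
          using assoc_mult_mat[of "transpose_mat W" N N "transpose_mat M" N A N] carr that
          by (simp del: assoc_mult_mat)
      qed
      then show "transpose_mat ?y * ?J * ?y = ?J"
        using arg_cong[OF eq, of "\<lambda>A. transpose_mat W * A"] carr y
        by (metis J mult_carrier_mat transpose_carrier_mat)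
    qed
    have cy: "map_mat cnj ?y \<in> carrier_mat N N" "map_mat cnj g \<in> carrier_mat N N" using y g by simp_all
    \<comment> \<open>Both sides are compared after right multiplication by U M, which is cnj M;
      they become U M cnj(g) and U M g.\<close>
    have 3: "map_mat cnj ?y = U * ?y * V \<longleftrightarrow> map_mat cnj g = g"
    proof -
      have "map_mat cnj ?y * map_mat cnj M = map_mat cnj (?y * M)"
        by (rule map_mat_mult[OF _ _ _ _ y M, symmetric]) simp_all
      also have "\<dots> = map_mat cnj M * map_mat cnj g"
        unfolding yM by (rule map_mat_mult[OF _ _ _ _ M g]) simp_all
      finally have A: "map_mat cnj ?y * (U * M) = U * (M * map_mat cnj g)"
        unfolding conj using carr cy by simp
      have B: "U * ?y * V * (U * M) = U * (M * g)"
        using carr y g by (simp add: cancel W)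
      show ?thesis
      proof
        assume "map_mat cnj ?y = U * ?y * V"
        then have "U * (M * map_mat cnj g) = U * (M * g)" using A B by (simp only:)
        then have "W * (V * (U * (M * map_mat cnj g))) = W * (V * (U * (M * g)))" by (simp only:)
        then show "map_mat cnj g = g" using carr g cy by (simp add: cancel)
      next
        assume "map_mat cnj g = g"
        then have "map_mat cnj ?y * (U * M) = U * ?y * V * (U * M)" using A B by (simp only:)
        then have "map_mat cnj ?y * U * M = U * ?y * V * U * M"
          using carr y cy by simp
        then have "map_mat cnj ?y * U = U * ?y * V * U"
          by (rule cancel_right[rotated 2]) (use carr y cy in simp_all)
        then have "map_mat cnj ?y * U * V = U * ?y * V * U * V" by (simp only:)
        then show "map_mat cnj ?y = U * ?y * V" using carr y cy by (simp add: UV cancel)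
      qed
    qed
    have S: "g \<in> SO_real l m \<longleftrightarrow> det g = 1 \<and> transpose_mat g * ?E * g = ?E \<and> map_mat cnj g = g"
      using g unfolding SO_real_eq N by blast
    show ?thesis
      unfolding limit_group_def minv mem_Collect_eq 1 2 3 S using y by blast
  qed
  have "limit_group N U \<subseteq> carrier_mat N N" by (auto simp: limit_group_def)
  moreover have "SO_real l m \<subseteq> carrier_mat N N" unfolding SO_real_eq N by auto
  moreover have "y = M * (W * y * M) * W" "W * y * M \<in> carrier_mat N N" if "y \<in> carrier_mat N N" for y
    using that carr by (simp_all add: cancel W)
  ultimately show "limit_group N U = (\<lambda>g. M * g * minv M) ` SO_real l m"
    unfolding minv using key by (auto simp: image_iff) (metis subsetD)+
qed

subsection \<open>Adapted bases\<close>

text \<open>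
  The columns of \<open>frame_mat\<close> are the vectors \<open>\<alpha>\<^sub>j e\<^bsub>\<kappa> j\<^esub> + \<beta>\<^sub>j e\<^bsub>(\<kappa> j)'\<^esub>\<close>. They are chosen fixed by the
  real structure \<open>v \<mapsto> U\<^sup>-\<^sup>1 cnj v\<close> and orthogonal for the form given by the classical metric, with
  squares \<open>\<plusminus> 2\<close>; their signs give the signature.
\<close>

definition frame_mat :: "nat \<Rightarrow> (nat \<Rightarrow> nat) \<Rightarrow> (nat \<Rightarrow> complex) \<Rightarrow> (nat \<Rightarrow> complex) \<Rightarrow> complex mat" where
  "frame_mat N \<kappa> \<alpha> \<beta> = mat N N (\<lambda>(i, j). (if i = \<kappa> j then \<alpha> j else 0) + (if i = pri N (\<kappa> j) then \<beta> j else 0))"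

lemma frame_mat_carrier [simp]: "frame_mat N \<kappa> \<alpha> \<beta> \<in> carrier_mat N N"
  by (simp add: frame_mat_def)

lemma frame_form:
  fixes \<alpha> \<beta> :: "nat \<Rightarrow> complex"
  assumes "\<And>j. j < N \<Longrightarrow> \<kappa> j < N" "j < N" "k < N"
  defines "M \<equiv> frame_mat N \<kappa> \<alpha> \<beta>"
  shows "(transpose_mat M * metric N 1 * M) $$ (j, k) = \<alpha> j * M $$ (pri N (\<kappa> j), k) + \<beta> j * M $$ (\<kappa> j, k)"
proof -
  have M: "M \<in> carrier_mat N N" by (simp add: M_def)
  have A: "metric N 1 * M \<in> carrier_mat N N" by (rule mult_carrier_mat[OF _ M]) (simp add: metric_def)
  have JM: "(metric N 1 * M) $$ (i, k) = M $$ (pri N i, k)" if "i < N" for i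
    using monomial_mat_mult[of N "pri N" M i k "\<lambda>_. 1"] that M assms(3) by (simp add: metric_one pri_less)
  have "transpose_mat M * metric N 1 * M = transpose_mat M * (metric N 1 * M)"
    by (rule assoc_mult_mat[of _ N N _ N _ N]) (use M in \<open>simp_all add: metric_def\<close>)
  then have "(transpose_mat M * metric N 1 * M) $$ (j, k) = (\<Sum>i = 0..<N. M $$ (i, j) * (metric N 1 * M) $$ (i, k))"
    using M A assms(2,3) by (simp add: scalar_prod_def)
  also have "\<dots> = (\<Sum>i = 0..<N. M $$ (i, j) * M $$ (pri N i, k))"
    by (rule sum.cong) (simp_all add: JM)
  also have "\<dots> = (\<Sum>i = 0..<N. (if i = \<kappa> j then \<alpha> j * M $$ (pri N (\<kappa> j), k) else 0)
      + (if i = pri N (\<kappa> j) then \<beta> j * M $$ (\<kappa> j, k) else 0))"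
    by (rule sum.cong) (use assms(1,2) in \<open>auto simp: M_def frame_mat_def distrib_right pri_pri\<close>)
  also have "\<dots> = \<alpha> j * M $$ (pri N (\<kappa> j), k) + \<beta> j * M $$ (\<kappa> j, k)"
    using assms(1)[OF assms(2)] by (simp add: sum.distrib pri_less)
  finally show ?thesis .
qed

text \<open>The classical form pairs e_a only with e_{a'}, so two frame vectors interact only on a
  common pair. At the middle index of odd N both conditions hold at once.\<close>

lemma frame_gram:
  assumes "\<kappa> j < N" "\<kappa> k < N" "k < N"
  shows "\<alpha> j * frame_mat N \<kappa> \<alpha> \<beta> $$ (pri N (\<kappa> j), k) + \<beta> j * frame_mat N \<kappa> \<alpha> \<beta> $$ (\<kappa> j, k)
    = (if \<kappa> j = \<kappa> k then \<alpha> j * \<beta> k + \<beta> j * \<alpha> k else 0)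
      + (if \<kappa> j = pri N (\<kappa> k) then \<alpha> j * \<alpha> k + \<beta> j * \<beta> k else 0)"
proof -
  have 1: "pri N (\<kappa> j) = pri N (\<kappa> k) \<longleftrightarrow> \<kappa> j = \<kappa> k"
    using assms(1,2) by (rule pri_eq_iff)
  have 2: "pri N (\<kappa> j) = \<kappa> k \<longleftrightarrow> \<kappa> j = pri N (\<kappa> k)"
    using eq_pri_iff[OF assms(1,2)] by metis
  have entry: "frame_mat N \<kappa> \<alpha> \<beta> $$ (i, k) = (if i = \<kappa> k then \<alpha> k else 0) + (if i = pri N (\<kappa> k) then \<beta> k else 0)"
    if "i < N" for i using that assms(3) by (simp add: frame_mat_def)
  show ?thesis
    unfolding entry[OF pri_less[OF assms(1)]] entry[OF assms(1)] 1 2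
    by (simp add: distrib_left)
qed

text \<open>The two alternatives are that the real structure exchanges the lines of e_a and e_{a'}
  or preserves each of them. Conjugation then relates \<alpha> to \<beta>, or each coefficient to
  itself, up to the weight.\<close>

lemma frame_conj:
  assumes tau: "\<And>a. a < N \<Longrightarrow> \<tau> a < N" "\<And>a. a < N \<Longrightarrow> \<tau> (\<tau> a) = a"
    and a: "\<kappa> j < N" "v (pri N (\<kappa> j)) = v (\<kappa> j)"
    and cases: "\<tau> (\<kappa> j) = pri N (\<kappa> j) \<and> cnj (\<alpha> j) = v (\<kappa> j) * \<beta> j \<and> cnj (\<beta> j) = v (\<kappa> j) * \<alpha> j \<or>
      \<tau> (\<kappa> j) = \<kappa> j \<and> \<tau> (pri N (\<kappa> j)) = pri N (\<kappa> j) \<and> cnj (\<alpha> j) = v (\<kappa> j) * \<alpha> j \<and> cnj (\<beta> j) = v (\<kappa> j) * \<beta> j"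
    and ij: "i < N" "j < N"
  shows "cnj (frame_mat N \<kappa> \<alpha> \<beta> $$ (i, j)) = v i * frame_mat N \<kappa> \<alpha> \<beta> $$ (\<tau> i, j)"
proof -
  have entry: "frame_mat N \<kappa> \<alpha> \<beta> $$ (i, j) = (if i = \<kappa> j then \<alpha> j else 0) + (if i = pri N (\<kappa> j) then \<beta> j else 0)"
    if "i < N" for i using that ij(2) by (simp add: frame_mat_def)
  have iff: "\<tau> i = c \<longleftrightarrow> i = \<tau> c" if "c < N" for c
    using tau(2)[OF ij(1)] tau(2)[OF that] by metis
  from cases show ?thesis
  proof
    assume c: "\<tau> (\<kappa> j) = pri N (\<kappa> j) \<and> cnj (\<alpha> j) = v (\<kappa> j) * \<beta> j \<and> cnj (\<beta> j) = v (\<kappa> j) * \<alpha> j"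
    then have "\<tau> (pri N (\<kappa> j)) = \<kappa> j" using tau(2)[OF a(1)] by metis
    with c show ?thesis
      unfolding entry[OF ij(1)] entry[OF tau(1)[OF ij(1)]] iff[OF a(1)] iff[OF pri_less[OF a(1)]]
      using a(2) by (simp add: distrib_left)
  next
    assume c: "\<tau> (\<kappa> j) = \<kappa> j \<and> \<tau> (pri N (\<kappa> j)) = pri N (\<kappa> j) \<and> cnj (\<alpha> j) = v (\<kappa> j) * \<alpha> j \<and> cnj (\<beta> j) = v (\<kappa> j) * \<beta> j"
    then show ?thesis
      unfolding entry[OF ij(1)] entry[OF tau(1)[OF ij(1)]] iff[OF a(1)] iff[OF pri_less[OF a(1)]]
      using a(2) by (simp add: distrib_left)
  qed
qed

text \<open>The index map does not depend on q, so convergence of U_q concerns the weights alone.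
  What remains is a frame that is real for the limit and has the right Gram matrix.\<close>

lemma has_real_formI:
  assumes N: "N = l + m"
    and s: "\<And>h. h \<in> H \<Longrightarrow> hopf_map N h True \<tau> (u h) (s h)"
    and v: "\<And>a. a < N \<Longrightarrow> v a \<noteq> 0" "\<And>a. a < N \<Longrightarrow> \<tau> a < N" "\<And>a. a < N \<Longrightarrow> \<tau> (\<tau> a) = a"
    and lim: "\<And>a. a < N \<Longrightarrow> ((\<lambda>h. u h a) \<longlongrightarrow> v a) (at 1 within H)"
    and \<kappa>: "\<And>j. j < N \<Longrightarrow> \<kappa> j < N"
    and conj: "\<And>i j. i < N \<Longrightarrow> j < N \<Longrightarrow> cnj (frame_mat N \<kappa> \<alpha> \<beta> $$ (i, j)) = v i * frame_mat N \<kappa> \<alpha> \<beta> $$ (\<tau> i, j)"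
    and form: "\<And>j k. j < N \<Longrightarrow> k < N \<Longrightarrow> \<alpha> j * frame_mat N \<kappa> \<alpha> \<beta> $$ (pri N (\<kappa> j), k) + \<beta> j * frame_mat N \<kappa> \<alpha> \<beta> $$ (\<kappa> j, k)
      = (if j = k then if j < l then 2 else - 2 else 0)"
  shows "has_real_form N H s l m"
proof -
  let ?M = "frame_mat N \<kappa> \<alpha> \<beta>"
  interpret U1: monomial_matrix N \<tau> v using v by unfold_locales
  have family: "monomial_mat N \<tau> (u h) \<in> carrier_mat N N \<and> invertible_mat (monomial_mat N \<tau> (u h)) \<and>
      (\<forall>a<N. \<forall>b<N. s h (gen N h a b) = SO_class N h (UTU N (monomial_mat N \<tau> (u h)) a b))" if "h \<in> H" for h
  proof -
    interpret s: hopf_map N h True \<tau> "u h" "s h" by (rule s[OF that])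
    interpret U: monomial_matrix N \<tau> "u h"
      using s.tau_less s.tau_tau s.u_nonzero by unfold_locales
    show ?thesis
      using s.hopf_map_gen[OF s[OF that]] U.invertible_monomial by (simp add: U.UTU_monomial)
  qed
  have "map_mat cnj ?M = monomial_mat N \<tau> v * ?M"
  proof (rule eq_matI)
    fix i j assume "i < dim_row (monomial_mat N \<tau> v * ?M)" "j < dim_col (monomial_mat N \<tau> v * ?M)"
    then have ij: "i < N" "j < N" by (simp_all add: monomial_mat_def frame_mat_def)
    have "map_mat cnj ?M $$ (i, j) = cnj (?M $$ (i, j))"
      by (rule index_map_mat(1)) (use ij in \<open>simp_all add: frame_mat_def\<close>)
    moreover have "(monomial_mat N \<tau> v * ?M) $$ (i, j) = v i * ?M $$ (\<tau> i, j)"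
      by (rule monomial_mat_mult) (use v ij in simp_all)
    ultimately show "map_mat cnj ?M $$ (i, j) = (monomial_mat N \<tau> v * ?M) $$ (i, j)"
      by (simp only: conj[OF ij])
  qed (simp_all add: monomial_mat_def frame_mat_def)
  moreover have "transpose_mat ?M * metric N 1 * ?M = 2 \<cdot>\<^sub>m sig_mat l m"
  proof (rule eq_matI)
    fix j k assume "j < dim_row (2 \<cdot>\<^sub>m sig_mat l m :: complex mat)" "k < dim_col (2 \<cdot>\<^sub>m sig_mat l m :: complex mat)"
    then have jk: "j < N" "k < N" by (simp_all add: mat_diag_def N)
    have "(transpose_mat ?M * metric N 1 * ?M) $$ (j, k) = (if j = k then if j < l then 2 else - 2 else 0)"
      unfolding form[OF jk, symmetric] by (rule frame_form) (use \<kappa> jk in simp_all)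
    then show "(transpose_mat ?M * metric N 1 * ?M) $$ (j, k) = (2 \<cdot>\<^sub>m sig_mat l m) $$ (j, k)"
      using jk by (simp only:) (simp add: mat_diag_def N)
  qed (simp_all add: mat_diag_def frame_mat_def N)
  ultimately have "invertible_mat ?M \<and> limit_group N (monomial_mat N \<tau> v) = (\<lambda>g. ?M * g * minv ?M) ` SO_real l m"
    using limit_group_conj[OF N frame_mat_carrier _ _ U1.mult_inverse] by simp
  moreover have "((\<lambda>h. monomial_mat N \<tau> (u h) $$ (a, b)) \<longlongrightarrow> monomial_mat N \<tau> v $$ (a, b)) (at 1 within H)"
    if "a < N" "b < N" for a b
    using that lim by (simp add: monomial_mat_def)
  ultimately show ?thesis
    unfolding has_real_form_def using family U1.invertible_monomial
    by (intro exI[of _ "\<lambda>h. monomial_mat N \<tau> (u h)"] exI[of _ "monomial_mat N \<tau> v"] conjI ballI bexI[of _ ?M])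
      auto
qed

section \<open>Signatures of the two classical limits\<close>

lemma sqrt2_sq: "complex_of_real (sqrt 2) * complex_of_real (sqrt 2) = 2"
  by (simp flip: of_real_mult)

lemma star_sharp_real_form:
  assumes "N > 2" "N = 2 * n \<or> N = 2 * n + 1"
  shows "has_real_form N (q_roots_real N) (star_sharp N) (N - 1) 1"
proof -
  \<comment> \<open>On a pair exchanged by the real structure, e_a + e_{a'} and i(e_a - e_{a'}) both
    have square 2. The last vector supplies the minus sign: for even N the flip makes both middle
    basis vectors real, and their difference has square -2; for odd N the sign at the middle index
    forces an imaginary multiple of e_n, and the factor i sqrt 2 gives -2.\<close>
  define \<kappa> where "\<kappa> j = (if j < n then j else if j < 2 * n then j - n else n)" for j
  define \<alpha> where "\<alpha> j = (if j < n then 1 else if j < 2 * n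
    then if N = 2 * n \<and> j = N - 1 then 1 else \<i> else \<i> * complex_of_real (sqrt 2))" for j
  define \<beta> where "\<beta> j = (if j < n then 1 else if j < 2 * n then - \<alpha> j else 0)" for j
  let ?M = "frame_mat N \<kappa> \<alpha> \<beta>"
  have \<kappa>: "\<kappa> j < N" if "j < N" for j using that assms by (auto simp: \<kappa>_def)
  have bound: "\<kappa> j \<le> n" "\<kappa> j = n \<longleftrightarrow> N = 2 * n + 1 \<and> j = 2 * n" if "j < N" for j
    using that assms by (auto simp: \<kappa>_def)
  have flip: "flip_idx N a = (if N = 2 * n \<and> a = n then n - 1 else if N = 2 * n \<and> a = n - 1 then n else a)" for a
    using assms by (auto simp: flip_idx_eq mid_def)
  have sgn: "flip_sgn N a = (if N = 2 * n + 1 \<and> a = n then - 1 else 1)" for a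
    using assms by (auto simp: flip_sgn_def)
  \<comment> \<open>Apart from the middle index of odd N, \<kappa> takes values in the lower half,
    whose primes lie in the upper half.\<close>
  have kp: "\<kappa> j = pri N (\<kappa> k) \<longleftrightarrow> N = 2 * n + 1 \<and> j = 2 * n \<and> k = 2 * n" if "j < N" "k < N" for j k
    using bound[OF that(1)] bound[OF that(2)] assms unfolding pri_def by linarith
  show ?thesis
  proof (rule has_real_formI[where \<tau> = "\<lambda>a. flip_idx N (pri N a)" and v = "\<lambda>a. flip_sgn N (pri N a)"
        and u = "\<lambda>h a. quantum_group.rho_w N h a * flip_sgn N (pri N a)" and \<kappa> = \<kappa> and \<alpha> = \<alpha> and \<beta> = \<beta>])
    show "hopf_map N h True (\<lambda>a. flip_idx N (pri N a)) (\<lambda>a. quantum_group.rho_w N h a * flip_sgn N (pri N a)) (star_sharp N h)"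
      if "h \<in> q_roots_real N" for h
      by (rule quantum_group.hopf_map_star_sharp[OF assms(1) that])
    show "((\<lambda>h. quantum_group.rho_w N h a * flip_sgn N (pri N a)) \<longlongrightarrow> flip_sgn N (pri N a)) (at 1 within q_roots_real N)" for a
    proof -
      have "((\<lambda>h :: complex. h powi rho2 N a) \<longlongrightarrow> 1 powi rho2 N a) (at 1 within q_roots_real N)"
        by (rule tendsto_power_int) (auto intro: tendsto_ident_at)
      from tendsto_mult_right[OF this, of "flip_sgn N (pri N a)"] show ?thesis
        by (simp add: quantum_group.rho_w_def)
    qed
    show "cnj (?M $$ (i, j)) = flip_sgn N (pri N i) * ?M $$ (flip_idx N (pri N i), j)" if ij: "i < N" "j < N" for i j
    proof (rule frame_conj[where v = "\<lambda>a. flip_sgn N (pri N a)" and \<tau> = "\<lambda>a. flip_idx N (pri N a)" and \<kappa> = \<kappa> and j = j])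
      let ?a = "\<kappa> j"
      show "flip_sgn N (pri N (pri N ?a)) = flip_sgn N (pri N ?a)"
        using \<kappa>[OF ij(2)] by (simp add: flip_sgn_pri_eq pri_less)
      consider (mid) "?a = n" | (inner) "N = 2 * n" "?a = n - 1" "n > 0" | (outer) "?a < n" "\<not> (N = 2 * n \<and> ?a = n - 1)"
        using bound(1)[OF ij(2)] bound(2)[OF ij(2)] assms by linarith
      then show "flip_idx N (pri N ?a) = pri N ?a \<and> cnj (\<alpha> j) = flip_sgn N (pri N ?a) * \<beta> j \<and>
          cnj (\<beta> j) = flip_sgn N (pri N ?a) * \<alpha> j \<or>
        flip_idx N (pri N ?a) = ?a \<and> flip_idx N (pri N (pri N ?a)) = pri N ?a \<and>
          cnj (\<alpha> j) = flip_sgn N (pri N ?a) * \<alpha> j \<and> cnj (\<beta> j) = flip_sgn N (pri N ?a) * \<beta> j"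
      proof cases
        case mid
        then have "N = 2 * n + 1" "j = 2 * n" using bound(2)[OF ij(2)] by auto
        then show ?thesis unfolding mid flip sgn by (simp add: \<alpha>_def \<beta>_def pri_def)
      next
        case inner
        then have "j = n - 1 \<or> j = N - 1" using ij(2) by (auto simp: \<kappa>_def split: if_splits)
        then have "cnj (\<alpha> j) = \<alpha> j" "cnj (\<beta> j) = \<beta> j"
          using inner by (auto simp: \<alpha>_def \<beta>_def)
        moreover have "pri N (n - 1) = n" "pri N n = n - 1" using inner by (auto simp: pri_def)
        moreover have "flip_idx N n = n - 1" "flip_idx N (n - 1) = n" "flip_sgn N n = 1"
          unfolding flip sgn using inner by auto
        ultimately show ?thesis unfolding inner(2) by simp
      next
        case outer
        then have "j < 2 * n" "\<not> (N = 2 * n \<and> j = N - 1)" using ij(2) assms by (auto simp: \<kappa>_def split: if_splits)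
        moreover have "pri N ?a \<noteq> n - 1" "pri N ?a = n \<longrightarrow> N \<noteq> 2 * n" "pri N ?a = n \<longrightarrow> N \<noteq> 2 * n + 1"
          using outer assms by (auto simp: pri_def)
        ultimately show ?thesis unfolding flip sgn by (auto simp: \<alpha>_def \<beta>_def)
      qed
    qed (use assms \<kappa> ij in \<open>simp_all add: flip_idx_less pri_less flip_idx_pri_pri\<close>)
    show "\<alpha> j * ?M $$ (pri N (\<kappa> j), k) + \<beta> j * ?M $$ (\<kappa> j, k) = (if j = k then if j < N - 1 then 2 else - 2 else 0)"
      if jk: "j < N" "k < N" for j k
      unfolding frame_gram[OF \<kappa>[OF jk(1)] \<kappa>[OF jk(2)] jk(2)] kp[OF jk] using jk assms
      by (cases "j < n"; cases "j < 2 * n"; cases "k < n"; cases "k < 2 * n")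
        (auto simp: \<kappa>_def \<alpha>_def \<beta>_def sqrt2_sq mult.assoc mult.left_commute[of "complex_of_real _"])
  qed (use assms \<kappa> in \<open>simp_all add: flip_idx_less pri_less flip_idx_pri_pri\<close>)
qed

lemma times_sharp_real_form:
  assumes "N > 2" "N = 2 * n \<and> l = n + 1 \<and> m = n - 1 \<or> N = 2 * n + 1 \<and> l = n \<and> m = n + 1"
  shows "has_real_form N (q_roots_unit N) (times_sharp N) l m"
proof -
  \<comment> \<open>The real structure of \<times> fixes each e_a, so e_a + e_{a'} and e_a - e_{a'}
    have squares 2 and -2: the split form. For even N the flip exchanges the middle pair and the
    difference there must be multiplied by i, turning one minus into a plus; for odd N the middle
    vector becomes imaginary, with square -2 instead of 2.\<close>
  define \<kappa> where "\<kappa> j = (if j < n then j else pri N j)" for j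
  define \<alpha> where "\<alpha> j = (if j = n then if N = 2 * n then \<i> else \<i> * complex_of_real (sqrt 2) else 1)" for j
  define \<beta> where "\<beta> j = (if j < n then 1 else if N = 2 * n + 1 \<and> j = n then 0 else - \<alpha> j)" for j
  let ?M = "frame_mat N \<kappa> \<alpha> \<beta>"
  have \<kappa>: "\<kappa> j < N" if "j < N" for j using that assms by (auto simp: \<kappa>_def pri_less)
  have bound: "\<kappa> j \<le> n" "\<kappa> j = n \<longleftrightarrow> N = 2 * n + 1 \<and> j = n" if "j < N" for j
    using that assms by (auto simp: \<kappa>_def pri_def)
  have flip: "flip_idx N a = (if N = 2 * n \<and> a = n then n - 1 else if N = 2 * n \<and> a = n - 1 then n else a)" for a
    using assms by (auto simp: flip_idx_eq mid_def)
  have sgn: "flip_sgn N a = (if N = 2 * n + 1 \<and> a = n then - 1 else 1)" for a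
    using assms by (auto simp: flip_sgn_def)
  have kp: "\<kappa> j = pri N (\<kappa> k) \<longleftrightarrow> N = 2 * n + 1 \<and> j = n \<and> k = n" if "j < N" "k < N" for j k
    using bound[OF that(1)] bound[OF that(2)] assms unfolding pri_def by linarith
  show ?thesis
  proof (rule has_real_formI[where \<tau> = "flip_idx N" and v = "flip_sgn N"
        and u = "\<lambda>h. flip_sgn N" and \<kappa> = \<kappa> and \<alpha> = \<alpha> and \<beta> = \<beta>])
    show "N = l + m" using assms by auto
    show "hopf_map N h True (flip_idx N) (flip_sgn N) (times_sharp N h)" if "h \<in> q_roots_unit N" for h
      by (rule quantum_group.hopf_map_times_sharp[OF assms(1) that])
    show "cnj (?M $$ (i, j)) = flip_sgn N i * ?M $$ (flip_idx N i, j)" if ij: "i < N" "j < N" for i j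
    proof (rule frame_conj[where v = "flip_sgn N" and \<tau> = "flip_idx N" and \<kappa> = \<kappa> and j = j])
      let ?a = "\<kappa> j"
      show "flip_sgn N (pri N ?a) = flip_sgn N ?a"
        using \<kappa>[OF ij(2)] by (simp add: flip_sgn_pri_eq)
      consider (mid) "?a = n" | (inner) "N = 2 * n" "?a = n - 1" "n > 0" | (outer) "?a < n" "\<not> (N = 2 * n \<and> ?a = n - 1)"
        using bound(1)[OF ij(2)] bound(2)[OF ij(2)] assms by linarith
      then show "flip_idx N ?a = pri N ?a \<and> cnj (\<alpha> j) = flip_sgn N ?a * \<beta> j \<and> cnj (\<beta> j) = flip_sgn N ?a * \<alpha> j \<or>
        flip_idx N ?a = ?a \<and> flip_idx N (pri N ?a) = pri N ?a \<and>
          cnj (\<alpha> j) = flip_sgn N ?a * \<alpha> j \<and> cnj (\<beta> j) = flip_sgn N ?a * \<beta> j"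
      proof cases
        case mid
        then have "N = 2 * n + 1" "j = n" using bound(2)[OF ij(2)] by auto
        then show ?thesis unfolding mid flip sgn by (simp add: \<alpha>_def \<beta>_def pri_def)
      next
        case inner
        then have "j = n - 1 \<or> j = n" using ij(2) by (auto simp: \<kappa>_def pri_def split: if_splits)
        then have "cnj (\<alpha> j) = \<beta> j" "cnj (\<beta> j) = \<alpha> j"
          using inner by (auto simp: \<alpha>_def \<beta>_def)
        moreover have "pri N (n - 1) = n" using inner by (auto simp: pri_def)
        moreover have "flip_idx N (n - 1) = n" "flip_sgn N (n - 1) = 1"
          unfolding flip sgn using inner by auto
        ultimately show ?thesis unfolding inner(2) by simp
      next
        case outer
        then have "j \<noteq> n" using assms by (auto simp: \<kappa>_def pri_def split: if_splits)
        moreover have "pri N ?a \<noteq> n - 1" "pri N ?a = n \<longrightarrow> N \<noteq> 2 * n" "pri N ?a = n \<longrightarrow> N \<noteq> 2 * n + 1"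
          using outer assms by (auto simp: pri_def)
        ultimately show ?thesis unfolding flip sgn using outer by (auto simp: \<alpha>_def \<beta>_def)
      qed
    qed (use assms(1) \<kappa> ij in \<open>simp_all add: flip_idx_less\<close>)
    show "\<alpha> j * ?M $$ (pri N (\<kappa> j), k) + \<beta> j * ?M $$ (\<kappa> j, k) = (if j = k then if j < l then 2 else - 2 else 0)"
      if jk: "j < N" "k < N" for j k
      unfolding frame_gram[OF \<kappa>[OF jk(1)] \<kappa>[OF jk(2)] jk(2)] kp[OF jk] using jk assms
      by (cases "j < n"; cases "j = n"; cases "k < n"; cases "k = n")
        (auto simp: \<kappa>_def \<alpha>_def \<beta>_def pri_def sqrt2_sq mult.assoc mult.left_commute[of "complex_of_real _"])
  qed (use assms(1) \<kappa> in \<open>simp_all add: flip_idx_less\<close>)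
qed

theorem mainTheorem2:
  fixes N n :: nat
  assumes "N > 2" and "N = 2 * n \<or> N = 2 * n + 1"
  shows
    "(\<forall>h\<in>q_roots N.
        hopf_automorphism N h (sharp N h) \<and>
        (\<forall>a<N. \<forall>b<N. sharp N h (gen N h a b) = SO_class N h (UTU N (Dmat N) a b)) \<and>
        (\<forall>x\<in>carrier (SOq N h). sharp N h (sharp N h x) = x)) \<and>
     (\<forall>h\<in>q_roots_real N.
        (\<forall>x\<in>carrier (SOq N h). sharp N h (star_conj N h x) = star_conj N h (sharp N h x)) \<and>
        star_conjugation N h (star_sharp N h)) \<and>
     has_real_form N (q_roots_real N) (star_sharp N) (N - 1) 1 \<and>
     (\<forall>h\<in>q_roots_unit N.
        (\<forall>x\<in>carrier (SOq N h). sharp N h (times_conj N h x) = times_conj N h (sharp N h x)) \<and>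
        star_conjugation N h (times_sharp N h)) \<and>
     (N = 2 * n \<longrightarrow> has_real_form N (q_roots_unit N) (times_sharp N) (n + 1) (n - 1)) \<and>
     (N = 2 * n + 1 \<longrightarrow>
        has_real_form N (q_roots_unit N) (times_sharp N) n (n + 1) \<and>
        (\<forall>h\<in>q_roots_unit N. conj_equivalent N h (times_conj N h) (times_sharp N h)))"
proof -
  interpret D: monomial_matrix N "flip_idx N" "flip_sgn N"
    using assms(1) by unfold_locales (simp_all add: flip_idx_less)
  have "sharp N h (gen N h a b) = SO_class N h (UTU N (Dmat N) a b)" if "a < N" "b < N" for h a b
    unfolding Dmat_monomial[OF assms(1)] D.UTU_monomial[OF that]
    by (rule quantum_group.hopf_map_gen[OF quantum_group.hopf_map_sharp[OF assms(1)] that])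
  moreover have "odd N" if "N = 2 * n + 1" using that by simp
  moreover have "has_real_form N (q_roots_unit N) (times_sharp N) (n + 1) (n - 1)" if "N = 2 * n"
    by (rule times_sharp_real_form[of N n]) (use assms that in simp_all)
  moreover have "has_real_form N (q_roots_unit N) (times_sharp N) n (n + 1)" if "N = 2 * n + 1"
    by (rule times_sharp_real_form[of N n]) (use assms that in simp_all)
  ultimately show ?thesis
    using assms(1) star_sharp_real_form[OF assms]
    by (intro conjI ballI impI allI)
      (simp_all only: quantum_group.sharp_automorphism q_roots_nonzero quantum_group.sharp_sharp
        quantum_group.star_sharp_commute quantum_group.star_sharp_conjugation
        quantum_group.times_sharp_commute quantum_group.times_sharp_conjugation
        quantum_group.times_sharp_equivalent not_False_eq_True simp_thms)
qed

end
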